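(* Let $x_3=u(x_1,x_2)$, $(x_1,x_2)\in\Omega$, be a vanishing viscosity minimal graph, i.e. let $u\in Lip(\Omega)$ be a vanishing viscosity solution in $\Omega$ of $$X_{1,u}\left(\frac{X_{1,u}u}{\sqrt{1+|X_{1,u}u|^2}}\right)=0 .$$ Then the flow of the vector field $X_{1,u}$ yields a foliation of the domain $\Omega$ by horizontal curves $\gamma$ (integral curves of $X_{1,u}$). More precisely, let $(x_1,x_2)\in\Omega$ and denote by $\gamma$ the integral curve of $X_{1,u}$ passing through it. Then $u$ is differentiable at $(x_1,x_2)$ along $\gamma$ and the equation reduces to $$\frac{d^2}{dt^2}u(\gamma(t))=0 .$$
   Context: Setting. $\Omega\subset\mathbb R^2$ is an open set. $\sigma_1^1,\sigma_1^2:\mathbb R^3\to\mathbb R$ are fixed $C^\infty$ functions, $\sigma_2^j:=\partial_{x_3}\sigma_1^j$ ($j=1,2$), and it is assumed that $|\sigma_1^1\,\partial_{x_3}\sigma_1^2-\sigma_1^2\,\partial_{x_3}\sigma_1^1|>0$ at every point of $\mathbb R^3$. (These are the components along $\partial_{x_1},\partial_{x_2}$ of vector fields $X_1$ and $X_2=[X_3,X_1]$ on $\mathbb R^3$, where $X_3=\partial_{x_3}$.) For a function $u:\Omega\to\mathbb R$ and $\epsilon>0$ define the vector fields on $\Omega$ $$X_{1,u}=\sum_{j=1}^2\sigma_1^j(x_1,x_2,u(x_1,x_2))\partial_{x_j},\quad Y_u=\sum_{j=1}^2\sigma_2^j(x_1,x_2,u(x_1,x_2))\partial_{x_j},\quad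 X_{2,u}=\epsilon Y_u,$$ and $\nabla_\epsilon=(X_{1,u},X_{2,u})$. Define $$L_{\epsilon,u}u=\sum_{i=1}^2X_{i,u}\left(\frac{X_{i,u}u}{\sqrt{1+|\nabla_\epsilon u|^2}}\right).$$ Vanishing viscosity solution: $u\in Lip(\Omega)$ is a vanishing viscosity solution of the equation $$X_{1,u}\left(\frac{X_{1,u}u}{\sqrt{1+|X_{1,u}u|^2}}\right)=0$$ if there exist $\epsilon_n>0$ with $\epsilon_n\to0$ and $u_n\in C^\infty(\Omega)$ such that (1) $L_{\epsilon_n,u_n}u_n=0$ in $\Omega$ for all $n$; (2) there is $l>0$ with $\|u_n\|_{Lip(\Omega)}\le l$ for all $n$, and $u_n\to u$ uniformly on compact subsets of $\Omega$. *)

theory Defs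
  imports "HOL-Analysis.Analysis" "HOL-Library.Disjoint_Sets"
begin

definition partial_deriv :: "(real^'n \<Rightarrow> real) \<Rightarrow> 'n \<Rightarrow> real^'n \<Rightarrow> real" where
  "partial_deriv f i x = deriv (\<lambda>h. f (x + h *\<^sub>R axis i 1)) 0"

text \<open>Continuous differentiability up to order \<open>k\<close>, meant for open sets \<open>S\<close>.\<close>

primrec Ck_on :: "nat \<Rightarrow> (real^'n) set \<Rightarrow> (real^'n \<Rightarrow> real) \<Rightarrow> bool" where
  "Ck_on 0 S f \<longleftrightarrow> continuous_on S f"
| "Ck_on (Suc k) S f \<longleftrightarrow> f differentiable_on S \<and> (\<forall>i. Ck_on k S (partial_deriv f i))"

definition smooth_on :: "(real^'n) set \<Rightarrow> (real^'n \<Rightarrow> real) \<Rightarrow> bool" where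
  "smooth_on S f \<longleftrightarrow> (\<forall>k. Ck_on k S f)"

text \<open>The usual norm on bounded Lipschitz functions: sup norm plus least Lipschitz constant.
  It is extended-valued, so that a bound \<open>lip_norm S f \<le> ennreal l\<close> includes finiteness.\<close>

definition lip_norm :: "'a::metric_space set \<Rightarrow> ('a \<Rightarrow> real) \<Rightarrow> ennreal" where
  "lip_norm S f = (SUP x\<in>S. ennreal \<bar>f x\<bar>)
     + (SUP x\<in>S. SUP y\<in>S - {x}. ennreal (\<bar>f x - f y\<bar> / dist x y))"

definition graph_point :: "(real^2 \<Rightarrow> real) \<Rightarrow> real^2 \<Rightarrow> real^3" where
  "graph_point u x = vector [x $ 1, x $ 2, u x]"

text \<open>Vector fields on the plane are given by their component functions. The argument \<open>\<sigma>\<close> is the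
  family \<open>\<sigma>\<^sub>1\<^sup>j\<close>, from which \<open>\<sigma>\<^sub>2\<^sup>j = \<partial>\<sigma>\<^sub>1\<^sup>j/\<partial>x\<^sub>3\<close> is derived.\<close>

definition X1 :: "(2 \<Rightarrow> real^3 \<Rightarrow> real) \<Rightarrow> (real^2 \<Rightarrow> real) \<Rightarrow> real^2 \<Rightarrow> real^2" where
  "X1 \<sigma> u x = (\<chi> j. \<sigma> j (graph_point u x))"

definition Yu :: "(2 \<Rightarrow> real^3 \<Rightarrow> real) \<Rightarrow> (real^2 \<Rightarrow> real) \<Rightarrow> real^2 \<Rightarrow> real^2" where
  "Yu \<sigma> u x = (\<chi> j. partial_deriv (\<sigma> j) 3 (graph_point u x))"

definition X2 :: "(2 \<Rightarrow> real^3 \<Rightarrow> real) \<Rightarrow> real \<Rightarrow> (real^2 \<Rightarrow> real) \<Rightarrow> real^2 \<Rightarrow> real^2" where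
  "X2 \<sigma> \<epsilon> u x = \<epsilon> *\<^sub>R Yu \<sigma> u x"

text \<open>Action of the vector field \<open>X\<close>, as a first order differential operator, on a function.\<close>

definition apply_field :: "(real^2 \<Rightarrow> real^2) \<Rightarrow> (real^2 \<Rightarrow> real) \<Rightarrow> real^2 \<Rightarrow> real" where
  "apply_field X f x = (\<Sum>j\<in>UNIV. X x $ j * partial_deriv f j x)"

definition area_density :: "(2 \<Rightarrow> real^3 \<Rightarrow> real) \<Rightarrow> real \<Rightarrow> (real^2 \<Rightarrow> real) \<Rightarrow> real^2 \<Rightarrow> real" where
  "area_density \<sigma> \<epsilon> u x =
     sqrt (1 + ((apply_field (X1 \<sigma> u) u x)\<^sup>2 + (apply_field (X2 \<sigma> \<epsilon> u) u x)\<^sup>2))"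

definition L_op :: "(2 \<Rightarrow> real^3 \<Rightarrow> real) \<Rightarrow> real \<Rightarrow> (real^2 \<Rightarrow> real) \<Rightarrow> real^2 \<Rightarrow> real" where
  "L_op \<sigma> \<epsilon> u x =
     apply_field (X1 \<sigma> u) (\<lambda>y. apply_field (X1 \<sigma> u) u y / area_density \<sigma> \<epsilon> u y) x
   + apply_field (X2 \<sigma> \<epsilon> u) (\<lambda>y. apply_field (X2 \<sigma> \<epsilon> u) u y / area_density \<sigma> \<epsilon> u y) x"

definition vanishing_viscosity_solution ::
  "(2 \<Rightarrow> real^3 \<Rightarrow> real) \<Rightarrow> (real^2) set \<Rightarrow> (real^2 \<Rightarrow> real) \<Rightarrow> bool" where
  "vanishing_viscosity_solution \<sigma> \<Omega> u \<longleftrightarrow>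
     (\<exists>C. C-lipschitz_on \<Omega> u) \<and>
     (\<exists>(\<epsilon> :: nat \<Rightarrow> real) (v :: nat \<Rightarrow> real^2 \<Rightarrow> real).
        (\<forall>n. \<epsilon> n > 0) \<and> \<epsilon> \<longlonglongrightarrow> 0 \<and>
        (\<forall>n. smooth_on \<Omega> (v n)) \<and>
        (\<forall>n. \<forall>x\<in>\<Omega>. L_op \<sigma> (\<epsilon> n) (v n) x = 0) \<and>
        (\<exists>l>0. \<forall>n. lip_norm \<Omega> (v n) \<le> ennreal l) \<and>
        (\<forall>K. compact K \<and> K \<subseteq> \<Omega> \<longrightarrow> uniform_limit K v u sequentially))"

text \<open>The values of \<open>\<gamma>\<close> outside the time interval \<open>I\<close> are irrelevant.\<close>

definition integral_curve ::
  "(real^2 \<Rightarrow> real^2) \<Rightarrow> (real^2) set \<Rightarrow> real set \<Rightarrow> (real \<Rightarrow> real^2) \<Rightarrow> bool" where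
  "integral_curve X \<Omega> I \<gamma> \<longleftrightarrow>
     open I \<and> is_interval I \<and> I \<noteq> {} \<and>
     (\<forall>t\<in>I. \<gamma> t \<in> \<Omega> \<and> (\<gamma> has_vector_derivative X (\<gamma> t)) (at t))"

definition maximal_integral_curve ::
  "(real^2 \<Rightarrow> real^2) \<Rightarrow> (real^2) set \<Rightarrow> real set \<Rightarrow> (real \<Rightarrow> real^2) \<Rightarrow> bool" where
  "maximal_integral_curve X \<Omega> I \<gamma> \<longleftrightarrow>
     integral_curve X \<Omega> I \<gamma> \<and>
     (\<forall>J \<delta>. integral_curve X \<Omega> J \<delta> \<and> I \<subseteq> J \<and> (\<forall>t\<in>I. \<delta> t = \<gamma> t) \<longrightarrow> J = I)"

text \<open>One-dimensional (topological) foliation of an open subset of the plane: a decomposition into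
  disjoint connected leaves such that near every point there are coordinates \<open>\<phi>\<close> in which the
  connected components of the traces of the leaves are the lines \<open>\<phi>\<^sub>2 = const\<close>.\<close>

definition foliation :: "(real^2) set \<Rightarrow> (real^2) set set \<Rightarrow> bool" where
  "foliation \<Omega> \<F> \<longleftrightarrow>
     partition_on \<Omega> \<F> \<and> (\<forall>L\<in>\<F>. connected L) \<and>
     (\<forall>p\<in>\<Omega>. \<exists>V (\<phi> :: real^2 \<Rightarrow> real^2) \<psi>.
        open V \<and> p \<in> V \<and> V \<subseteq> \<Omega> \<and> homeomorphism V UNIV \<phi> \<psi> \<and>
        (\<forall>L\<in>\<F>. \<forall>C\<in>components (L \<inter> V). \<exists>c. C = {q\<in>V. \<phi> q $ 2 = c}))"

end

theory Submission
  imports Defs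
begin

text \<open>The proof replaces regularity theory by a comparison argument along lifted curves, that is, solutions
  \<open>\<Gamma>\<close> of \<open>\<Gamma>' = \<sigma>(\<Gamma>, B)\<close> for a prescribed height \<open>B(t)\<close>. Let \<open>D = B - u \<circ> \<Gamma>\<close>. If \<open>B'' < 0\<close>, then
  \<open>D\<close> cannot touch \<open>0\<close> from above: at a maximum of
  \<open>v\<^sub>n(x) - B(t) - K/2 |x - \<Gamma>(t)|\<^sup>2\<close> over \<open>(t, x)\<close>, the second order condition in the directions
  \<open>(1, X\<^sub>1)\<close>, \<open>(0, X\<^sub>2)\<close> and \<open>(b, bX\<^sub>1 - aX\<^sub>2)\<close> contradicts \<open>L v\<^sub>n = 0\<close> if first \<open>K\<close> and then \<open>n\<close> are
  large. This yields a maximum principle for \<open>D\<close> on short time intervals and, by symmetry, a minimum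
  principle. A shooting argument finds an affine \<open>B\<close> with \<open>D = 0\<close> at both ends of the interval, hence
  \<open>D\<close> vanishes: \<open>\<Gamma>\<close> is an integral curve of \<open>X\<^sub>1\<close>, and \<open>u\<close> is affine along it. Since the field
  \<open>X\<^sub>1\<close> is locally Lipschitz and does not vanish, its integral curves are unique and foliate \<open>\<Omega>\<close>.\<close>

section \<open>Gradients and smooth fields\<close>


text \<open>The height \<open>B\<close> is prescribed rather than read off from \<open>u\<close>
  because integral curves of \<open>X1 \<sigma> u\<close> with \<open>u\<close> Lipschitz have a
  priori only Lipschitz velocity, while a lifted curve over a polynomial \<open>B\<close> is twice
  differentiable and can enter a second order test. The obstacle is that only Lipschitz bounds on
  the \<open>v n\<close> are uniform; nothing is known about their second derivatives as \<epsilon>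
  tends to 0. So the test must survive a penalty with large \<open>K\<close>. Letting time move
  together with space achieves this in the one direction of size O(1): a displacement by
  \<open>X1\<close> is nearly cancelled by the motion of \<Gamma>. The other two directions are
  O(\<epsilon>) and cost K times O(\<epsilon>^2), which is why \<open>n\<close> is chosen after
  \<open>K\<close>. The first order terms are harmless for another reason: at a contact point the
  slope of \<open>B\<close> equals the derivative of \<open>v n\<close> along the velocity of
  \<Gamma>. Hence the derivative of \<open>X1\<close> along the graph and the acceleration of
  \<Gamma> are values of one continuous function at neighbouring points, and their difference is
  small compared with the strict concavity of \<open>B\<close>.\<close>

definition grad :: "(real^'n \<Rightarrow> real) \<Rightarrow> real^'n \<Rightarrow> real^'n" where
  "grad f x = (\<chi> i. partial_deriv f i x)"

lemma has_derivative_grad: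
  fixes f :: "real^'n \<Rightarrow> real"
  assumes "f differentiable (at x)"
  shows "(f has_derivative (\<lambda>h. grad f x \<bullet> h)) (at x)"
proof -
  obtain f' where f': "(f has_derivative f') (at x)"
    using assms unfolding differentiable_def by blast
  then have lin: "bounded_linear f'" by (rule has_derivative_bounded_linear)
  have pd: "partial_deriv f i x = f' (axis i 1)" for i
  proof -
    have "((\<lambda>h. f (x + h *\<^sub>R axis i 1)) has_derivative (\<lambda>h. f' (h *\<^sub>R axis i 1))) (at 0)"
    proof (rule has_derivative_compose[where g = f and f = "\<lambda>h. x + h *\<^sub>R axis i 1"])
      show "((\<lambda>h. x + h *\<^sub>R axis i 1) has_derivative (\<lambda>h. h *\<^sub>R axis i 1)) (at 0)"
        by (auto intro!: derivative_eq_intros)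
    qed (use f' in simp)
    moreover have "(\<lambda>h. f' (h *\<^sub>R axis i 1)) = (*) (f' (axis i 1))"
      by (simp add: fun_eq_iff linear_scale[OF bounded_linear.linear[OF lin]])
    ultimately have "((\<lambda>h. f (x + h *\<^sub>R axis i 1)) has_field_derivative f' (axis i 1)) (at 0)"
      unfolding has_field_derivative_def by simp
    then show ?thesis unfolding partial_deriv_def by (rule DERIV_imp_deriv)
  qed
  have "f' h = grad f x \<bullet> h" for h
  proof -
    have "f' h = f' (\<Sum>i\<in>UNIV. h $ i *\<^sub>R axis i 1)"
      by (metis (no_types, lifting) basis_expansion scalar_mult_eq_scaleR sum.cong)
    also have "\<dots> = (\<Sum>i\<in>UNIV. h $ i * f' (axis i 1))"
      by (simp add: linear_sum[OF bounded_linear.linear[OF lin]] linear_scale[OF bounded_linear.linear[OF lin]])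
    finally show ?thesis by (simp add: grad_def inner_vec_def pd mult.commute)
  qed
  with f' show ?thesis by (metis (no_types, lifting) ext)
qed

lemma apply_field_eq: "apply_field X f x = grad f x \<bullet> X x"
  by (simp add: apply_field_def grad_def inner_vec_def mult.commute)

lemma apply_field_has_derivative:
  assumes "(f has_derivative f') (at x)"
  shows "apply_field X f x = f' (X x)"
proof -
  have "(f has_derivative (\<lambda>h. grad f x \<bullet> h)) (at x)"
    using assms by (intro has_derivative_grad) (auto simp: differentiable_def)
  then show ?thesis
    using assms by (metis apply_field_eq has_derivative_unique)
qed

lemma smooth_onD:
  assumes "smooth_on S f"
  shows "f differentiable_on S" "smooth_on S (partial_deriv f i)" "continuous_on S f"
  using assms Ck_on.simps unfolding smooth_on_def by blast+

lemma smooth_on_has_derivative: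
  assumes "smooth_on S f" "open S" "x \<in> S"
  shows "(f has_derivative (\<lambda>h. grad f x \<bullet> h)) (at x)"
  using smooth_onD(1)[OF assms(1)] assms(2,3)
  by (intro has_derivative_grad) (metis at_within_open differentiable_on_def)

lemma continuous_on_grad:
  assumes "smooth_on S f"
  shows "continuous_on S (grad f)"
  unfolding grad_def
  by (intro continuous_on_vec_lambda smooth_onD(3) smooth_onD(2)[OF assms])

section \<open>Smooth fields on space, evaluated at points over the plane\<close>

definition pt :: "real^2 \<Rightarrow> real \<Rightarrow> real^3" where
  "pt x z = vector [x $ 1, x $ 2, z]"

lemma pt_nth [simp]: "pt x z $ 1 = x $ 1" "pt x z $ 2 = x $ 2" "pt x z $ 3 = z"
  by (simp_all add: pt_def)

lemma bounded_linear_pt: "bounded_linear (\<lambda>w. pt (fst w) (snd w))"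
  by (intro linear_conv_bounded_linear[THEN iffD1] linearI)
    (simp_all add: vec_eq_iff forall_3)

lemma continuous_on_pt [continuous_intros]:
  assumes "continuous_on A f" "continuous_on A g"
  shows "continuous_on A (\<lambda>x. pt (f x) (g x))"
  using bounded_linear.continuous_on[OF bounded_linear_pt, of A "\<lambda>x. (f x, g x)"] assms
  by (simp add: continuous_on_Pair)

lemma has_derivative_pt:
  assumes "(f has_derivative f') (at a within A)" "(g has_derivative g') (at a within A)"
  shows "((\<lambda>x. pt (f x) (g x)) has_derivative (\<lambda>h. pt (f' h) (g' h))) (at a within A)"
  using bounded_linear.has_derivative[OF bounded_linear_pt has_derivative_Pair[OF assms]] by simp

lemma pt_diff: "pt x z - pt y w = pt (x - y) (z - w)"
  by (simp add: vec_eq_iff forall_3)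

lemma norm_pt_le: "norm (pt x z) \<le> norm x + \<bar>z\<bar>"
proof -
  have "(norm (pt x z))\<^sup>2 = (norm x)\<^sup>2 + z\<^sup>2"
    unfolding power2_norm_eq_inner by (simp add: inner_vec_def sum_3 sum_2 power2_eq_square)
  also have "\<dots> \<le> (norm x + \<bar>z\<bar>)\<^sup>2"
    by (simp add: power2_sum)
  finally show ?thesis by (rule power2_le_imp_le) simp
qed

definition field :: "(2 \<Rightarrow> real^3 \<Rightarrow> real) \<Rightarrow> real^3 \<Rightarrow> real^2" where
  "field g w = (\<chi> j. g j w)"

definition field_deriv :: "(2 \<Rightarrow> real^3 \<Rightarrow> real) \<Rightarrow> real^3 \<Rightarrow> real^3 \<Rightarrow> real^2" where
  "field_deriv g w h = (\<chi> j. grad (g j) w \<bullet> h)"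

text \<open>With this family, \<open>Y\<close> on the graph becomes
  \<open>field (dz \<sigma>)\<close>, so that bounds proved for the field of an arbitrary smooth
  family serve both vector fields.\<close>

definition dz :: "(2 \<Rightarrow> real^3 \<Rightarrow> real) \<Rightarrow> 2 \<Rightarrow> real^3 \<Rightarrow> real" where
  "dz g j = partial_deriv (g j) 3"

lemma X1_eq: "X1 \<sigma> u x = field \<sigma> (pt x (u x))"
  by (simp add: X1_def field_def graph_point_def pt_def)

lemma X2_eq: "X2 \<sigma> \<epsilon> u x = \<epsilon> *\<^sub>R field (dz \<sigma>) (pt x (u x))"
  by (simp add: X2_def Yu_def field_def graph_point_def pt_def dz_def)

lemma field_has_derivative:
  assumes "\<And>j. smooth_on UNIV (g j)"
  shows "(field g has_derivative field_deriv g w) (at w within A)"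
proof -
  have "((\<lambda>w. \<chi> j. g j w) has_derivative (\<lambda>h. \<chi> j. grad (g j) w \<bullet> h)) (at w within A)"
    by (subst has_derivative_componentwise_within)
      (auto simp: Basis_vec_def inner_axis
        intro!: has_derivative_at_withinI[OF smooth_on_has_derivative[OF assms open_UNIV UNIV_I]])
  then show ?thesis by (simp add: field_def[abs_def] field_deriv_def[abs_def])
qed

lemma continuous_on_field:
  assumes "\<And>j. smooth_on UNIV (g j)"
  shows "continuous_on A (field g)"
  by (rule has_derivative_continuous_on[OF field_has_derivative[OF assms]])

lemma continuous_on_field_deriv [continuous_intros]:
  assumes "\<And>j. smooth_on UNIV (g j)" "continuous_on A f" "continuous_on A h"
  shows "continuous_on A (\<lambda>x. field_deriv g (f x) (h x))"
  unfolding field_deriv_def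
  by (intro continuous_intros continuous_on_compose2[OF continuous_on_grad[OF assms(1)] assms(2)] assms) auto

lemma norm_field_deriv_bound:
  assumes "\<And>j. smooth_on UNIV (g j)" "compact Q"
  obtains M where "\<And>w h. w \<in> Q \<Longrightarrow> norm (field_deriv g w h) \<le> M * norm h"
proof -
  have "bounded ((\<lambda>w. norm (grad (g 1) w) + norm (grad (g 2) w)) ` Q)"
    by (intro compact_imp_bounded compact_continuous_image continuous_intros assms(2)
        continuous_on_subset[OF continuous_on_grad[OF assms(1)]] subset_UNIV)
  then obtain M where "\<forall>y\<in>(\<lambda>w. norm (grad (g 1) w) + norm (grad (g 2) w)) ` Q. norm y \<le> M"
    unfolding bounded_iff by blast
  then have M: "norm (grad (g 1) w) + norm (grad (g 2) w) \<le> M" if "w \<in> Q" for w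
    using that by fastforce
  show ?thesis
  proof (rule that)
    fix w h assume w: "w \<in> Q"
    have "norm (field_deriv g w h) \<le> \<bar>grad (g 1) w \<bullet> h\<bar> + \<bar>grad (g 2) w \<bullet> h\<bar>"
      using norm_le_l1_cart[of "field_deriv g w h"] by (simp add: field_deriv_def sum_2)
    also have "\<dots> \<le> norm (grad (g 1) w) * norm h + norm (grad (g 2) w) * norm h"
      by (intro add_mono Cauchy_Schwarz_ineq2)
    also have "\<dots> \<le> M * norm h"
      using mult_right_mono[OF M[OF w], of "norm h"] by (simp add: algebra_simps)
    finally show "norm (field_deriv g w h) \<le> M * norm h" .
  qed
qed


section \<open>Second derivatives as the derivative of the gradient\<close>

definition hess :: "(real^'n \<Rightarrow> real) \<Rightarrow> real^'n \<Rightarrow> real^'n \<Rightarrow> real^'n" where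
  "hess f x \<xi> = (\<chi> m. grad (partial_deriv f m) x \<bullet> \<xi>)"

lemma grad_has_derivative:
  assumes "smooth_on S f" "open S" "x \<in> S"
  shows "(grad f has_derivative hess f x) (at x)"
proof -
  have "((\<lambda>y. \<chi> m. partial_deriv f m y) has_derivative (\<lambda>h. \<chi> m. grad (partial_deriv f m) x \<bullet> h)) (at x)"
    by (subst has_derivative_componentwise_within)
      (auto simp: Basis_vec_def inner_axis
        intro!: smooth_on_has_derivative[OF smooth_onD(2)[OF assms(1)] assms(2,3)])
  then show ?thesis by (simp add: grad_def[abs_def] hess_def[abs_def])
qed

lemma bounded_linear_hess: "bounded_linear (hess f x)"
  unfolding hess_def
  by (intro linear_conv_bounded_linear[THEN iffD1] linearI)
    (simp_all add: vec_eq_iff inner_add_right)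

lemmas hess_scale = linear_scale[OF bounded_linear.linear[OF bounded_linear_hess]]
  and hess_diff = linear_diff[OF bounded_linear.linear[OF bounded_linear_hess]]

section \<open>The equation in nondivergence form\<close>

text \<open>Since the square of \<open>W\<close> is
  \<open>1 + P\<^sub>1\<^sup>2 + P\<^sub>2\<^sup>2\<close>, the quotient rule loses one square in
  each numerator and leaves the common denominator \<open>W ^ 3\<close>. The coefficients are the
  entries of the identity plus the square of the vector \<open>(P\<^sub>2, -P\<^sub>1)\<close>,
  which is where the third direction of the contact argument comes from.\<close>

lemma quotient_derivatives:
  fixes P\<^sub>1 P\<^sub>2 :: "'a::real_normed_vector \<Rightarrow> real"
  assumes P1: "(P\<^sub>1 has_derivative D\<^sub>1) (at x)" and P2: "(P\<^sub>2 has_derivative D\<^sub>2) (at x)"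
  defines "W \<equiv> \<lambda>y. sqrt (1 + ((P\<^sub>1 y)\<^sup>2 + (P\<^sub>2 y)\<^sup>2))"
  shows "((\<lambda>y. P\<^sub>1 y / W y) has_derivative
           (\<lambda>h. ((1 + (P\<^sub>2 x)\<^sup>2) * D\<^sub>1 h - P\<^sub>1 x * P\<^sub>2 x * D\<^sub>2 h) / W x ^ 3)) (at x)"
    and "((\<lambda>y. P\<^sub>2 y / W y) has_derivative
           (\<lambda>h. ((1 + (P\<^sub>1 x)\<^sup>2) * D\<^sub>2 h - P\<^sub>1 x * P\<^sub>2 x * D\<^sub>1 h) / W x ^ 3)) (at x)"
proof -
  have pos: "1 + ((P\<^sub>1 y)\<^sup>2 + (P\<^sub>2 y)\<^sup>2) > 0" for y
    by (simp add: add_pos_nonneg)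
  then have Wpos: "W y > 0" for y by (simp add: W_def)
  have W2: "W y * W y = 1 + ((P\<^sub>1 y)\<^sup>2 + (P\<^sub>2 y)\<^sup>2)" for y
    unfolding W_def using pos[of y] by simp
  have DW: "(W has_derivative (\<lambda>h. (P\<^sub>1 x * D\<^sub>1 h + P\<^sub>2 x * D\<^sub>2 h) / W x)) (at x)"
  proof -
    have "((\<lambda>y. 1 + ((P\<^sub>1 y)\<^sup>2 + (P\<^sub>2 y)\<^sup>2)) has_derivative
        (\<lambda>h. 2 * (P\<^sub>1 x * D\<^sub>1 h + P\<^sub>2 x * D\<^sub>2 h))) (at x)"
      using P1 P2 by (auto intro!: derivative_eq_intros simp: algebra_simps)
    from has_derivative_real_sqrt[OF pos this]
    have "(W has_derivative (\<lambda>h. 2 * (P\<^sub>1 x * D\<^sub>1 h + P\<^sub>2 x * D\<^sub>2 h) * (inverse (W x) / 2))) (at x)"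
      unfolding W_def by (rule has_derivative_eq_rhs) (simp add: fun_eq_iff mult.assoc)
    then show ?thesis
    proof (rule has_derivative_eq_rhs)
      show "(\<lambda>h. 2 * (P\<^sub>1 x * D\<^sub>1 h + P\<^sub>2 x * D\<^sub>2 h) * (inverse (W x) / 2))
        = (\<lambda>h. (P\<^sub>1 x * D\<^sub>1 h + P\<^sub>2 x * D\<^sub>2 h) / W x)"
        using Wpos[of x] by (simp add: fun_eq_iff field_simps)
    qed
  qed
  show "((\<lambda>y. P\<^sub>1 y / W y) has_derivative
           (\<lambda>h. ((1 + (P\<^sub>2 x)\<^sup>2) * D\<^sub>1 h - P\<^sub>1 x * P\<^sub>2 x * D\<^sub>2 h) / W x ^ 3)) (at x)"
  proof (rule has_derivative_eq_rhs[OF has_derivative_divide'[OF P1 DW]])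
    show "(\<lambda>h. (D\<^sub>1 h * W x - P\<^sub>1 x * ((P\<^sub>1 x * D\<^sub>1 h + P\<^sub>2 x * D\<^sub>2 h) / W x)) / (W x * W x))
      = (\<lambda>h. ((1 + (P\<^sub>2 x)\<^sup>2) * D\<^sub>1 h - P\<^sub>1 x * P\<^sub>2 x * D\<^sub>2 h) / W x ^ 3)"
    proof
      fix h
      have "D\<^sub>1 h * (W x * W x) = D\<^sub>1 h * (1 + ((P\<^sub>1 x)\<^sup>2 + (P\<^sub>2 x)\<^sup>2))"
        by (simp add: W2)
      then show "(D\<^sub>1 h * W x - P\<^sub>1 x * ((P\<^sub>1 x * D\<^sub>1 h + P\<^sub>2 x * D\<^sub>2 h) / W x)) / (W x * W x)
        = ((1 + (P\<^sub>2 x)\<^sup>2) * D\<^sub>1 h - P\<^sub>1 x * P\<^sub>2 x * D\<^sub>2 h) / W x ^ 3"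
        using Wpos[of x] by (simp add: field_simps power2_eq_square power3_eq_cube)
    qed
  qed (use Wpos[of x] in simp)
  show "((\<lambda>y. P\<^sub>2 y / W y) has_derivative
           (\<lambda>h. ((1 + (P\<^sub>1 x)\<^sup>2) * D\<^sub>2 h - P\<^sub>1 x * P\<^sub>2 x * D\<^sub>1 h) / W x ^ 3)) (at x)"
  proof (rule has_derivative_eq_rhs[OF has_derivative_divide'[OF P2 DW]])
    show "(\<lambda>h. (D\<^sub>2 h * W x - P\<^sub>2 x * ((P\<^sub>1 x * D\<^sub>1 h + P\<^sub>2 x * D\<^sub>2 h) / W x)) / (W x * W x))
      = (\<lambda>h. ((1 + (P\<^sub>1 x)\<^sup>2) * D\<^sub>2 h - P\<^sub>1 x * P\<^sub>2 x * D\<^sub>1 h) / W x ^ 3)"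
    proof
      fix h
      have "D\<^sub>2 h * (W x * W x) = D\<^sub>2 h * (1 + ((P\<^sub>1 x)\<^sup>2 + (P\<^sub>2 x)\<^sup>2))"
        by (simp add: W2)
      then show "(D\<^sub>2 h * W x - P\<^sub>2 x * ((P\<^sub>1 x * D\<^sub>1 h + P\<^sub>2 x * D\<^sub>2 h) / W x)) / (W x * W x)
        = ((1 + (P\<^sub>1 x)\<^sup>2) * D\<^sub>2 h - P\<^sub>1 x * P\<^sub>2 x * D\<^sub>1 h) / W x ^ 3"
        using Wpos[of x] by (simp add: field_simps power2_eq_square power3_eq_cube)
    qed
  qed (use Wpos[of x] in simp)
qed

lemma field_along_graph_has_derivative:
  assumes "\<And>j. smooth_on UNIV (g j)" "smooth_on \<Omega> v" "open \<Omega>" "x \<in> \<Omega>"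
  shows "((\<lambda>y. field g (pt y (v y))) has_derivative
     (\<lambda>h. field_deriv g (pt x (v x)) (pt h (grad v x \<bullet> h)))) (at x)"
  by (rule has_derivative_compose[OF has_derivative_pt[OF has_derivative_ident
        smooth_on_has_derivative[OF assms(2-4)]] field_has_derivative[OF assms(1)]])

text \<open>The factor \<open>c\<close> is 1 for the first field and \<epsilon> for the
  second.\<close>

lemma apply_field_graph_has_derivative:
  assumes "\<And>j. smooth_on UNIV (g j)" "smooth_on \<Omega> v" "open \<Omega>" "x \<in> \<Omega>"
  shows "((\<lambda>y. grad v y \<bullet> (c *\<^sub>R field g (pt y (v y)))) has_derivative
     (\<lambda>h. hess v x h \<bullet> (c *\<^sub>R field g (pt x (v x)))
        + grad v x \<bullet> (c *\<^sub>R field_deriv g (pt x (v x)) (pt h (grad v x \<bullet> h))))) (at x)"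
  by (rule has_derivative_eq_rhs[OF has_derivative_inner[OF grad_has_derivative[OF assms(2-4)]
        has_derivative_scaleR_right[OF field_along_graph_has_derivative[OF assms]]]])
    (simp add: fun_eq_iff add.commute)

text \<open>The second order part is the quadratic form of \<open>I + (b, -a) \<otimes> (b, -a)\<close>, written as a sum of squares;
  in this form no symmetry of the second derivatives is needed.\<close>

lemma L_op_eq_0D:
  assumes \<sigma>: "\<And>j. smooth_on UNIV (\<sigma> j)" and v: "smooth_on \<Omega> v" "open \<Omega>" "x \<in> \<Omega>"
    and L: "L_op \<sigma> \<epsilon> v x = 0"
  defines "w \<equiv> pt x (v x)" and "p \<equiv> grad v x"
  defines "q\<^sub>1 \<equiv> field \<sigma> w" and "q\<^sub>2 \<equiv> \<epsilon> *\<^sub>R field (dz \<sigma>) w"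
  defines "J\<^sub>1 \<equiv> \<lambda>h. field_deriv \<sigma> w (pt h (p \<bullet> h))"
    and "J\<^sub>2 \<equiv> \<lambda>h. \<epsilon> *\<^sub>R field_deriv (dz \<sigma>) w (pt h (p \<bullet> h))"
  defines "a \<equiv> p \<bullet> q\<^sub>1" and "b \<equiv> p \<bullet> q\<^sub>2" and "\<zeta> \<equiv> (p \<bullet> q\<^sub>2) *\<^sub>R q\<^sub>1 - (p \<bullet> q\<^sub>1) *\<^sub>R q\<^sub>2"
  shows "hess v x q\<^sub>1 \<bullet> q\<^sub>1 + hess v x q\<^sub>2 \<bullet> q\<^sub>2 + hess v x \<zeta> \<bullet> \<zeta>
    + (1 + b\<^sup>2) * (p \<bullet> J\<^sub>1 q\<^sub>1) + (1 + a\<^sup>2) * (p \<bullet> J\<^sub>2 q\<^sub>2) - a * b * (p \<bullet> J\<^sub>2 q\<^sub>1 + p \<bullet> J\<^sub>1 q\<^sub>2) = 0"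
proof -
  have dz: "smooth_on UNIV (dz \<sigma> j)" for j
    unfolding dz_def by (rule smooth_onD(2)[OF \<sigma>])
  define P\<^sub>1 where "P\<^sub>1 = apply_field (X1 \<sigma> v) v"
  define P\<^sub>2 where "P\<^sub>2 = apply_field (X2 \<sigma> \<epsilon> v) v"
  define D\<^sub>1 where "D\<^sub>1 h = hess v x h \<bullet> q\<^sub>1 + p \<bullet> J\<^sub>1 h" for h
  define D\<^sub>2 where "D\<^sub>2 h = hess v x h \<bullet> q\<^sub>2 + p \<bullet> J\<^sub>2 h" for h
  have P1: "(P\<^sub>1 has_derivative D\<^sub>1) (at x)"
    using apply_field_graph_has_derivative[OF \<sigma> v, of 1]
    by (simp add: P\<^sub>1_def D\<^sub>1_def[abs_def] apply_field_eq[abs_def] X1_eq q\<^sub>1_def J\<^sub>1_def w_def p_def)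
  have P2: "(P\<^sub>2 has_derivative D\<^sub>2) (at x)"
    using apply_field_graph_has_derivative[OF dz v, of \<epsilon>]
    by (simp add: P\<^sub>2_def D\<^sub>2_def[abs_def] apply_field_eq[abs_def] X2_eq q\<^sub>2_def J\<^sub>2_def w_def p_def)
  have vals: "P\<^sub>1 x = a" "P\<^sub>2 x = b" "X1 \<sigma> v x = q\<^sub>1" "X2 \<sigma> \<epsilon> v x = q\<^sub>2"
    by (simp_all add: P\<^sub>1_def P\<^sub>2_def apply_field_eq X1_eq X2_eq a_def b_def p_def q\<^sub>1_def q\<^sub>2_def w_def)
  define W where "W = area_density \<sigma> \<epsilon> v x"
  have ad: "area_density \<sigma> \<epsilon> v = (\<lambda>y. sqrt (1 + ((P\<^sub>1 y)\<^sup>2 + (P\<^sub>2 y)\<^sup>2)))"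
    by (simp add: fun_eq_iff area_density_def P\<^sub>1_def P\<^sub>2_def)
  have "W > 0" unfolding W_def ad by (simp add: add_pos_nonneg)
  have "L_op \<sigma> \<epsilon> v x = ((1 + b\<^sup>2) * D\<^sub>1 q\<^sub>1 - a * b * D\<^sub>2 q\<^sub>1) / W ^ 3
      + ((1 + a\<^sup>2) * D\<^sub>2 q\<^sub>2 - a * b * D\<^sub>1 q\<^sub>2) / W ^ 3"
    using apply_field_has_derivative[OF quotient_derivatives(1)[OF P1 P2], of "X1 \<sigma> v"]
      apply_field_has_derivative[OF quotient_derivatives(2)[OF P1 P2], of "X2 \<sigma> \<epsilon> v"]
    unfolding L_op_def W_def ad by (simp add: vals P\<^sub>1_def[symmetric] P\<^sub>2_def[symmetric])
  with L \<open>W > 0\<close> have *: "(1 + b\<^sup>2) * D\<^sub>1 q\<^sub>1 - a * b * D\<^sub>2 q\<^sub>1 + ((1 + a\<^sup>2) * D\<^sub>2 q\<^sub>2 - a * b * D\<^sub>1 q\<^sub>2) = 0"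
    by (simp add: add_divide_distrib[symmetric])
  have "hess v x \<zeta> \<bullet> \<zeta> = b\<^sup>2 * (hess v x q\<^sub>1 \<bullet> q\<^sub>1) - a * b * (hess v x q\<^sub>1 \<bullet> q\<^sub>2 + hess v x q\<^sub>2 \<bullet> q\<^sub>1)
      + a\<^sup>2 * (hess v x q\<^sub>2 \<bullet> q\<^sub>2)"
    by (simp add: \<zeta>_def a_def[symmetric] b_def[symmetric] hess_diff hess_scale inner_diff_left
        inner_diff_right power2_eq_square algebra_simps)
  with * show ?thesis by (simp add: D\<^sub>1_def D\<^sub>2_def algebra_simps)
qed


section \<open>Contact with a lifted curve\<close>

text \<open>The second derivative is available at 0 only. If it were positive, \<open>f'\<close>
  would be positive just to the right of 0 and \<open>f\<close> would rise above
  \<open>f 0\<close>.\<close>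

lemma second_derivative_test_local_max:
  fixes f :: "real \<Rightarrow> real"
  assumes d: "d > 0" and f1: "\<And>r. \<bar>r\<bar> < d \<Longrightarrow> (f has_real_derivative f' r) (at r)"
    and f2: "(f' has_real_derivative c) (at 0)" and max: "\<And>r. \<bar>r\<bar> < d \<Longrightarrow> f r \<le> f 0"
  shows "f' 0 = 0" "c \<le> 0"
proof -
  show f0: "f' 0 = 0"
    using DERIV_local_max[OF f1[of 0] d] d max by simp
  show "c \<le> 0"
  proof (rule ccontr)
    assume "\<not> c \<le> 0"
    then obtain e where e: "e > 0" "\<And>h. h > 0 \<Longrightarrow> h < e \<Longrightarrow> f' 0 < f' (0 + h)"
      using DERIV_pos_inc_right[OF f2] by auto
    define h where "h = min d e / 2"
    have h: "h > 0" "h < d" "h < e" using d e(1) by (auto simp: h_def min_def)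
    have "f 0 < f h"
    proof (rule DERIV_pos_imp_increasing_open[OF h(1)])
      show "continuous_on {0..h} f"
        using h by (intro DERIV_continuous_on[of _ f f'] has_field_derivative_at_within[OF f1]) auto
      fix y assume "0 < y" "y < h"
      then show "\<exists>z. (f has_real_derivative z) (at y) \<and> 0 < z"
        using f1[of y] e(2)[of y] f0 h by auto
    qed
    with max[of h] h show False by simp
  qed
qed

text \<open>The maximum is tested along the lines
  \<open>(t\<^sub>0 + r * \<tau>, x\<^sub>0 + r *\<^sub>R \<xi>)\<close>. The first order condition
  with \<open>\<tau> = 0\<close> expresses
  \<open>K *\<^sub>R (x\<^sub>0 - \<Gamma> t\<^sub>0)\<close> through the gradient of
  \<open>v\<close>. This removes \<open>K\<close> from the acceleration term, so in the last
  inequality \<open>K\<close> multiplies only the mismatch between \<open>\<xi>\<close> and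
  \<open>\<tau> *\<^sub>R \<Gamma>\<^sub>1 t\<^sub>0\<close>.\<close>

lemma contact_conditions:
  fixes \<Gamma> :: "real \<Rightarrow> real^2"
  assumes t0: "t\<^sub>0 \<in> {a<..<b}" and v: "smooth_on \<Omega> v" "open \<Omega>"
    and G: "\<And>t. t \<in> {a<..<b} \<Longrightarrow> (\<Gamma> has_vector_derivative \<Gamma>\<^sub>1 t) (at t)"
    and G1: "(\<Gamma>\<^sub>1 has_vector_derivative \<Gamma>\<^sub>2) (at t\<^sub>0)"
    and B: "\<And>t. t \<in> {a<..<b} \<Longrightarrow> (B has_real_derivative B\<^sub>1 t) (at t)"
    and B1: "(B\<^sub>1 has_real_derivative B\<^sub>2) (at t\<^sub>0)"
    and e: "e > 0" "ball x\<^sub>0 e \<subseteq> \<Omega>"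
    and max: "\<And>t x. t \<in> {a<..<b} \<Longrightarrow> x \<in> ball x\<^sub>0 e \<Longrightarrow>
       s * (v x - B t) - K / 2 * (norm (x - \<Gamma> t))\<^sup>2 \<le> s * (v x\<^sub>0 - B t\<^sub>0) - K / 2 * (norm (x\<^sub>0 - \<Gamma> t\<^sub>0))\<^sup>2"
  shows "s *\<^sub>R grad v x\<^sub>0 = K *\<^sub>R (x\<^sub>0 - \<Gamma> t\<^sub>0)"
    and "s * B\<^sub>1 t\<^sub>0 = s * (grad v x\<^sub>0 \<bullet> \<Gamma>\<^sub>1 t\<^sub>0)"
    and "s * (hess v x\<^sub>0 \<xi> \<bullet> \<xi>) \<le> \<tau>\<^sup>2 * (s * B\<^sub>2 - s * (grad v x\<^sub>0 \<bullet> \<Gamma>\<^sub>2)) + K * (norm (\<xi> - \<tau> *\<^sub>R \<Gamma>\<^sub>1 t\<^sub>0))\<^sup>2"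
proof -
  have key: "s * (grad v x\<^sub>0 \<bullet> \<xi> - \<tau> * B\<^sub>1 t\<^sub>0) - K * ((x\<^sub>0 - \<Gamma> t\<^sub>0) \<bullet> (\<xi> - \<tau> *\<^sub>R \<Gamma>\<^sub>1 t\<^sub>0)) = 0 \<and>
     s * (hess v x\<^sub>0 \<xi> \<bullet> \<xi> - \<tau>\<^sup>2 * B\<^sub>2)
       - K * ((norm (\<xi> - \<tau> *\<^sub>R \<Gamma>\<^sub>1 t\<^sub>0))\<^sup>2 - \<tau>\<^sup>2 * ((x\<^sub>0 - \<Gamma> t\<^sub>0) \<bullet> \<Gamma>\<^sub>2)) \<le> 0" for \<xi> \<tau>
  proof -
    define f where "f r = s * (v (x\<^sub>0 + r *\<^sub>R \<xi>) - B (t\<^sub>0 + r * \<tau>))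
      - K / 2 * ((x\<^sub>0 + r *\<^sub>R \<xi> - \<Gamma> (t\<^sub>0 + r * \<tau>)) \<bullet> (x\<^sub>0 + r *\<^sub>R \<xi> - \<Gamma> (t\<^sub>0 + r * \<tau>)))" for r
    define f' where "f' r = s * (grad v (x\<^sub>0 + r *\<^sub>R \<xi>) \<bullet> \<xi> - \<tau> * B\<^sub>1 (t\<^sub>0 + r * \<tau>))
      - K * ((x\<^sub>0 + r *\<^sub>R \<xi> - \<Gamma> (t\<^sub>0 + r * \<tau>)) \<bullet> (\<xi> - \<tau> *\<^sub>R \<Gamma>\<^sub>1 (t\<^sub>0 + r * \<tau>)))" for r
    define c where "c = s * (hess v x\<^sub>0 \<xi> \<bullet> \<xi> - \<tau>\<^sup>2 * B\<^sub>2)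
       - K * ((norm (\<xi> - \<tau> *\<^sub>R \<Gamma>\<^sub>1 t\<^sub>0))\<^sup>2 - \<tau>\<^sup>2 * ((x\<^sub>0 - \<Gamma> t\<^sub>0) \<bullet> \<Gamma>\<^sub>2))"
    let ?U = "(\<lambda>r. t\<^sub>0 + r * \<tau>) -` {a<..<b} \<inter> (\<lambda>r. x\<^sub>0 + r *\<^sub>R \<xi>) -` ball x\<^sub>0 e"
    have "open ?U"
      by (intro open_Int open_vimage continuous_intros open_greaterThanLessThan open_ball)
    moreover have "0 \<in> ?U" using t0 e by simp
    ultimately obtain d where "d > 0" "ball 0 d \<subseteq> ?U"
      unfolding open_contains_ball by blast
    then have d: "d > 0" "\<And>r. \<bar>r\<bar> < d \<Longrightarrow> t\<^sub>0 + r * \<tau> \<in> {a<..<b} \<and> x\<^sub>0 + r *\<^sub>R \<xi> \<in> ball x\<^sub>0 e"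
      by (auto simp: subset_iff dist_norm)
    have vd: "((\<lambda>r. v (x\<^sub>0 + r *\<^sub>R \<xi>)) has_real_derivative grad v (x\<^sub>0 + r *\<^sub>R \<xi>) \<bullet> \<xi>) (at r)" if "\<bar>r\<bar> < d" for r
    proof -
      have "((\<lambda>r. x\<^sub>0 + r *\<^sub>R \<xi>) has_derivative (\<lambda>h. h *\<^sub>R \<xi>)) (at r)"
        by (auto intro!: derivative_eq_intros)
      moreover have "x\<^sub>0 + r *\<^sub>R \<xi> \<in> \<Omega>" using d(2)[OF that] e by auto
      ultimately have "((\<lambda>r. v (x\<^sub>0 + r *\<^sub>R \<xi>)) has_derivative (\<lambda>h. grad v (x\<^sub>0 + r *\<^sub>R \<xi>) \<bullet> (h *\<^sub>R \<xi>))) (at r)"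
        by (rule has_derivative_compose[OF _ smooth_on_has_derivative[OF v]])
      then show ?thesis
        unfolding has_field_derivative_def by (rule has_derivative_eq_rhs) (simp add: fun_eq_iff)
    qed
    have gd: "((\<lambda>r. grad v (x\<^sub>0 + r *\<^sub>R \<xi>)) has_vector_derivative hess v x\<^sub>0 \<xi>) (at 0)"
    proof -
      have "((\<lambda>r. x\<^sub>0 + r *\<^sub>R \<xi>) has_derivative (\<lambda>h. h *\<^sub>R \<xi>)) (at 0)"
        by (auto intro!: derivative_eq_intros)
      moreover have "x\<^sub>0 \<in> \<Omega>" using e by auto
      then have "(grad v has_derivative hess v x\<^sub>0) (at (x\<^sub>0 + 0 *\<^sub>R \<xi>))"
        using grad_has_derivative[OF v] by simp
      ultimately have "((\<lambda>r. grad v (x\<^sub>0 + r *\<^sub>R \<xi>)) has_derivative (\<lambda>h. hess v x\<^sub>0 (h *\<^sub>R \<xi>))) (at 0)"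
        by (rule has_derivative_compose)
      then show ?thesis
        unfolding has_vector_derivative_def hess_scale .
    qed
    have lin: "((\<lambda>r. t\<^sub>0 + r * \<tau>) has_real_derivative \<tau>) (at r)" for r
      by (auto intro!: derivative_eq_intros)
    have Bd: "((\<lambda>r. B (t\<^sub>0 + r * \<tau>)) has_real_derivative B\<^sub>1 (t\<^sub>0 + r * \<tau>) * \<tau>) (at r)" if "\<bar>r\<bar> < d" for r
      using DERIV_chain2[OF B lin] d(2)[OF that] by blast
    have B1d: "((\<lambda>r. B\<^sub>1 (t\<^sub>0 + r * \<tau>)) has_real_derivative B\<^sub>2 * \<tau>) (at 0)"
      using DERIV_chain2[OF _ lin, of B\<^sub>1 B\<^sub>2 0] B1 by simp
    have Gd: "((\<lambda>r. \<Gamma> (t\<^sub>0 + r * \<tau>)) has_vector_derivative \<tau> *\<^sub>R \<Gamma>\<^sub>1 (t\<^sub>0 + r * \<tau>)) (at r)" if "\<bar>r\<bar> < d" for r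
      using vector_diff_chain_at[OF lin[unfolded has_real_derivative_iff_has_vector_derivative] G] d(2)[OF that]
      by (auto simp: o_def)
    have G1d: "((\<lambda>r. \<Gamma>\<^sub>1 (t\<^sub>0 + r * \<tau>)) has_vector_derivative \<tau> *\<^sub>R \<Gamma>\<^sub>2) (at 0)"
      using vector_diff_chain_at[OF lin[of 0, unfolded has_real_derivative_iff_has_vector_derivative], of \<Gamma>\<^sub>1 \<Gamma>\<^sub>2] G1
      by (auto simp: o_def)
    have diffd: "((\<lambda>r. x\<^sub>0 + r *\<^sub>R \<xi> - \<Gamma> (t\<^sub>0 + r * \<tau>)) has_vector_derivative \<xi> - \<tau> *\<^sub>R \<Gamma>\<^sub>1 (t\<^sub>0 + r * \<tau>)) (at r)"
      if "\<bar>r\<bar> < d" for r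
      by (auto intro!: derivative_eq_intros Gd[OF that])
    have inner_d: "((\<lambda>r. g r \<bullet> h r) has_real_derivative g r \<bullet> h' + g' \<bullet> h r) (at r)"
      if "(g has_vector_derivative g') (at r)" "(h has_vector_derivative h') (at r)"
      for g h :: "real \<Rightarrow> real^2" and g' h' r
      using has_derivative_inner[OF that[unfolded has_vector_derivative_def]]
      unfolding has_field_derivative_def
      by (rule has_derivative_eq_rhs) (simp add: fun_eq_iff algebra_simps)
    have F1: "(f has_real_derivative f' r) (at r)" if "\<bar>r\<bar> < d" for r
      unfolding f_def f'_def
      by (rule derivative_eq_intros vd[OF that] Bd[OF that] inner_d[OF diffd[OF that] diffd[OF that]] refl)+
        (simp add: inner_commute algebra_simps)
    have "((\<lambda>r. \<xi> - \<tau> *\<^sub>R \<Gamma>\<^sub>1 (t\<^sub>0 + r * \<tau>)) has_vector_derivative - (\<tau>\<^sup>2 *\<^sub>R \<Gamma>\<^sub>2)) (at 0)"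
      by (auto intro!: derivative_eq_intros G1d simp: power2_eq_square)
    note i = inner_d[OF diffd[of 0] this] inner_d[OF gd has_vector_derivative_const[of \<xi>]]
    have F2: "(f' has_real_derivative c) (at 0)"
      unfolding f'_def c_def power2_norm_eq_inner
      by (rule DERIV_cong[OF DERIV_diff[OF DERIV_cmult[OF DERIV_diff[OF i(2) DERIV_cmult[OF B1d]]]
              DERIV_cmult[OF i(1)]]])
        (simp_all add: d(1) power2_eq_square inner_commute algebra_simps)
    have "f r \<le> f 0" if "\<bar>r\<bar> < d" for r
      using max[of "t\<^sub>0 + r * \<tau>" "x\<^sub>0 + r *\<^sub>R \<xi>"] d(2)[OF that] by (simp add: f_def power2_norm_eq_inner)
    from second_derivative_test_local_max[OF d(1) F1 F2 this]
    show ?thesis by (simp add: f'_def c_def)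
  qed
  show eq1: "s *\<^sub>R grad v x\<^sub>0 = K *\<^sub>R (x\<^sub>0 - \<Gamma> t\<^sub>0)"
  proof (rule vector_eq_ldot[THEN iffD1], intro allI)
    fix y show "y \<bullet> (s *\<^sub>R grad v x\<^sub>0) = y \<bullet> (K *\<^sub>R (x\<^sub>0 - \<Gamma> t\<^sub>0))"
      using key[of y 0] by (simp add: inner_commute)
  qed
  have G2: "K * ((x\<^sub>0 - \<Gamma> t\<^sub>0) \<bullet> y) = s * (grad v x\<^sub>0 \<bullet> y)" for y
    using arg_cong[OF eq1, of "\<lambda>z. z \<bullet> y"] by simp
  show "s * B\<^sub>1 t\<^sub>0 = s * (grad v x\<^sub>0 \<bullet> \<Gamma>\<^sub>1 t\<^sub>0)"
    using key[of 0 1] G2[of "\<Gamma>\<^sub>1 t\<^sub>0"] by (auto simp: algebra_simps)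
  show "s * (hess v x\<^sub>0 \<xi> \<bullet> \<xi>) \<le> \<tau>\<^sup>2 * (s * B\<^sub>2 - s * (grad v x\<^sub>0 \<bullet> \<Gamma>\<^sub>2)) + K * (norm (\<xi> - \<tau> *\<^sub>R \<Gamma>\<^sub>1 t\<^sub>0))\<^sup>2"
  proof -
    have e: "K * (\<tau>\<^sup>2 * ((x\<^sub>0 - \<Gamma> t\<^sub>0) \<bullet> \<Gamma>\<^sub>2)) = s * (\<tau>\<^sup>2 * (grad v x\<^sub>0 \<bullet> \<Gamma>\<^sub>2))"
      using G2[of "\<Gamma>\<^sub>2"] by algebra
    show ?thesis
      using conjunct2[OF key[of \<xi> \<tau>]] by (simp add: right_diff_distrib mult.left_commute[of "\<tau>\<^sup>2"] e)
  qed
qed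


text \<open>The contact inequality is inserted with \<open>(q\<^sub>1, 1)\<close>,
  \<open>(q\<^sub>2, 0)\<close> and \<open>(\<zeta>, b)\<close>. The time steps 1 and
  \<open>b\<close> give the terms in \<open>B\<^sub>2\<close> and \<open>\<Gamma>\<^sub>2\<close>
  the total weight \<open>1 + b\<^sup>2\<close>, the same as that of
  \<open>p \<bullet> J\<^sub>1 q\<^sub>1\<close> in the equation, so these combine into one bracket.
  Every other lower order term contains two factors among \<open>q\<^sub>2\<close>, \<open>b\<close>
  and \<open>J\<^sub>2\<close>, each of them O(\<epsilon>).\<close>

lemma contact_estimate:
  fixes p q\<^sub>1 q\<^sub>2 \<Gamma>\<^sub>1 \<Gamma>\<^sub>2 :: "real^2" and H J\<^sub>1 J\<^sub>2 :: "real^2 \<Rightarrow> real^2"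
  assumes s: "\<bar>s\<bar> = 1"
    and contact: "\<And>\<xi> \<tau>. s * (H \<xi> \<bullet> \<xi>) \<le> \<tau>\<^sup>2 * (s * B\<^sub>2 - s * (p \<bullet> \<Gamma>\<^sub>2)) + K * (norm (\<xi> - \<tau> *\<^sub>R \<Gamma>\<^sub>1))\<^sup>2"
  defines "a \<equiv> p \<bullet> q\<^sub>1" and "b \<equiv> p \<bullet> q\<^sub>2" and "\<zeta> \<equiv> (p \<bullet> q\<^sub>2) *\<^sub>R q\<^sub>1 - (p \<bullet> q\<^sub>1) *\<^sub>R q\<^sub>2"
  assumes eq: "H q\<^sub>1 \<bullet> q\<^sub>1 + H q\<^sub>2 \<bullet> q\<^sub>2 + H \<zeta> \<bullet> \<zeta>
    + (1 + b\<^sup>2) * (p \<bullet> J\<^sub>1 q\<^sub>1) + (1 + a\<^sup>2) * (p \<bullet> J\<^sub>2 q\<^sub>2) - a * b * (p \<bullet> J\<^sub>2 q\<^sub>1 + p \<bullet> J\<^sub>1 q\<^sub>2) = 0"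
    and bnd: "norm p \<le> l" "norm q\<^sub>1 \<le> M" "norm \<Gamma>\<^sub>1 \<le> M" "norm q\<^sub>2 \<le> \<epsilon> * M"
      "\<And>h. norm (J\<^sub>1 h) \<le> M * norm h" "\<And>h. norm (J\<^sub>2 h) \<le> \<epsilon> * M * norm h"
    and pos: "\<epsilon> \<ge> 0" "K \<ge> 0"
  shows "0 \<le> (1 + b\<^sup>2) * (s * B\<^sub>2 + s * (p \<bullet> (J\<^sub>1 q\<^sub>1 - \<Gamma>\<^sub>2))) + K * (norm (q\<^sub>1 - \<Gamma>\<^sub>1))\<^sup>2
    + \<epsilon>\<^sup>2 * (K * (M\<^sup>2 + 9 * l\<^sup>2 * M ^ 4) + (1 + l\<^sup>2 * M\<^sup>2) * l * M\<^sup>2 + 2 * l ^ 3 * M ^ 4)"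
proof -
  have l: "l \<ge> 0" and M: "M \<ge> 0"
    using bnd(1,2) norm_ge_zero order_trans by blast+
  have ip: "\<bar>p \<bullet> y\<bar> \<le> l * c" if "norm y \<le> c" for y c
    by (rule order_trans[OF Cauchy_Schwarz_ineq2 mult_mono[OF bnd(1) that l norm_ge_zero]])
  have a: "\<bar>a\<bar> \<le> l * M" and b: "\<bar>b\<bar> \<le> l * (\<epsilon> * M)"
    unfolding a_def b_def by (intro ip bnd)+
  have \<epsilon>M: "\<epsilon> * M \<ge> 0" and lM: "l * M \<ge> 0" using pos M l by simp_all
  \<comment> \<open>The mismatch is \<open>b\<close> times a vector of length at most
    \<open>2 * M\<close>, minus \<open>a *\<^sub>R q\<^sub>2\<close>; the resulting factor 3
    reappears squared as the 9 in the conclusion.\<close>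
  have "norm (\<zeta> - b *\<^sub>R \<Gamma>\<^sub>1) = norm (b *\<^sub>R (q\<^sub>1 - \<Gamma>\<^sub>1) - a *\<^sub>R q\<^sub>2)"
    by (simp add: \<zeta>_def a_def b_def algebra_simps)
  also have "\<dots> \<le> \<bar>b\<bar> * norm (q\<^sub>1 - \<Gamma>\<^sub>1) + \<bar>a\<bar> * norm q\<^sub>2"
    using norm_triangle_ineq4[of "b *\<^sub>R (q\<^sub>1 - \<Gamma>\<^sub>1)" "a *\<^sub>R q\<^sub>2"] by simp
  also have "\<dots> \<le> l * (\<epsilon> * M) * (2 * M) + l * M * (\<epsilon> * M)"
    using norm_triangle_ineq4[of q\<^sub>1 \<Gamma>\<^sub>1] bnd(2-4) a b l M \<epsilon>M lM
    by (intro add_mono mult_mono) auto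
  finally have "norm (\<zeta> - b *\<^sub>R \<Gamma>\<^sub>1) \<le> 3 * \<epsilon> * l * M\<^sup>2"
    by (simp add: power2_eq_square algebra_simps)
  then have z2: "(norm (\<zeta> - b *\<^sub>R \<Gamma>\<^sub>1))\<^sup>2 \<le> (3 * \<epsilon> * l * M\<^sup>2)\<^sup>2"
    by (rule power_mono) simp
  have q22: "(norm q\<^sub>2)\<^sup>2 \<le> (\<epsilon> * M)\<^sup>2"
    by (rule power_mono[OF bnd(4)]) simp
  have J22: "\<bar>p \<bullet> J\<^sub>2 q\<^sub>2\<bar> \<le> l * (\<epsilon> * M * (\<epsilon> * M))"
    using bnd(6)[of q\<^sub>2] mult_left_mono[OF bnd(4) \<epsilon>M] by (intro ip) simp
  have J21: "\<bar>p \<bullet> J\<^sub>2 q\<^sub>1\<bar> \<le> l * (\<epsilon> * M * M)"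
    using bnd(6)[of q\<^sub>1] mult_left_mono[OF bnd(2) \<epsilon>M] by (intro ip) simp
  have J12: "\<bar>p \<bullet> J\<^sub>1 q\<^sub>2\<bar> \<le> l * (M * (\<epsilon> * M))"
    using bnd(5)[of q\<^sub>2] mult_left_mono[OF bnd(4) M] by (intro ip) simp
  have a2: "a\<^sup>2 \<le> (l * M)\<^sup>2" using power_mono[OF a, of 2] by simp
  have r1: "\<bar>s * ((1 + a\<^sup>2) * (p \<bullet> J\<^sub>2 q\<^sub>2))\<bar> \<le> (1 + (l * M)\<^sup>2) * (l * (\<epsilon> * M * (\<epsilon> * M)))"
    unfolding abs_mult s mult_1 by (intro mult_mono J22) (use a2 in \<open>auto simp: abs_of_nonneg\<close>)
  have r2: "\<bar>s * (a * b * (p \<bullet> J\<^sub>2 q\<^sub>1 + p \<bullet> J\<^sub>1 q\<^sub>2))\<bar>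
      \<le> l * M * (l * (\<epsilon> * M)) * (l * (\<epsilon> * M * M) + l * (M * (\<epsilon> * M)))"
    unfolding abs_mult s mult_1
    by (intro mult_mono a b order_trans[OF abs_triangle_ineq] add_mono J21 J12)
      (use l M \<epsilon>M in auto)
  have "0 = s * (H q\<^sub>1 \<bullet> q\<^sub>1 + H q\<^sub>2 \<bullet> q\<^sub>2 + H \<zeta> \<bullet> \<zeta>
    + (1 + b\<^sup>2) * (p \<bullet> J\<^sub>1 q\<^sub>1) + (1 + a\<^sup>2) * (p \<bullet> J\<^sub>2 q\<^sub>2) - a * b * (p \<bullet> J\<^sub>2 q\<^sub>1 + p \<bullet> J\<^sub>1 q\<^sub>2))"
    by (simp add: eq)
  also have "\<dots> = s * (H q\<^sub>1 \<bullet> q\<^sub>1) + s * (H q\<^sub>2 \<bullet> q\<^sub>2) + s * (H \<zeta> \<bullet> \<zeta>) + (1 + b\<^sup>2) * (s * (p \<bullet> J\<^sub>1 q\<^sub>1))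
      + s * ((1 + a\<^sup>2) * (p \<bullet> J\<^sub>2 q\<^sub>2)) - s * (a * b * (p \<bullet> J\<^sub>2 q\<^sub>1 + p \<bullet> J\<^sub>1 q\<^sub>2))"
    by (simp only: distrib_left right_diff_distrib mult.left_commute[of s])
  also have "\<dots> \<le> ((s * B\<^sub>2 - s * (p \<bullet> \<Gamma>\<^sub>2)) + K * (norm (q\<^sub>1 - \<Gamma>\<^sub>1))\<^sup>2) + K * (\<epsilon> * M)\<^sup>2
      + (b\<^sup>2 * (s * B\<^sub>2 - s * (p \<bullet> \<Gamma>\<^sub>2)) + K * (3 * \<epsilon> * l * M\<^sup>2)\<^sup>2) + (1 + b\<^sup>2) * (s * (p \<bullet> J\<^sub>1 q\<^sub>1))
      + (1 + (l * M)\<^sup>2) * (l * (\<epsilon> * M * (\<epsilon> * M)))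
      + l * M * (l * (\<epsilon> * M)) * (l * (\<epsilon> * M * M) + l * (M * (\<epsilon> * M)))"
    using contact[of q\<^sub>1 1] contact[of q\<^sub>2 0] contact[of \<zeta> b] r1 r2
      mult_left_mono[OF z2 pos(2)] mult_left_mono[OF q22 pos(2)]
    unfolding abs_le_iff by (simp del: mult_le_cancel_left)
  also have "\<dots> = (1 + b\<^sup>2) * (s * B\<^sub>2 + s * (p \<bullet> (J\<^sub>1 q\<^sub>1 - \<Gamma>\<^sub>2))) + K * (norm (q\<^sub>1 - \<Gamma>\<^sub>1))\<^sup>2
    + \<epsilon>\<^sup>2 * (K * (M\<^sup>2 + 9 * l\<^sup>2 * M ^ 4) + (1 + l\<^sup>2 * M\<^sup>2) * l * M\<^sup>2 + 2 * l ^ 3 * M ^ 4)"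
    unfolding inner_diff_right by algebra
  finally show ?thesis .
qed

section \<open>Uniform bounds for the approximating sequence and its limit\<close>

lemma norm_grad_le:
  assumes f: "smooth_on S f" "open S" "x \<in> S"
    and lip: "\<And>y. y \<in> S \<Longrightarrow> \<bar>f y - f x\<bar> \<le> l * dist y x" and l: "l \<ge> 0"
  shows "norm (grad f x) \<le> l"
proof (rule ccontr)
  assume neg: "\<not> norm (grad f x) \<le> l"
  define e where "e = (norm (grad f x) - l) / 2"
  have e: "e > 0" using neg by (simp add: e_def)
  obtain d where d: "d > 0"
    "\<And>y. y \<in> ball x d \<Longrightarrow> norm (f y - f x - grad f x \<bullet> (y - x)) \<le> e * norm (y - x)"
    using smooth_on_has_derivative[OF f] e unfolding has_derivative_at_alt
    by (metis dist_commute dist_norm mem_ball)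
  obtain d' where d': "d' > 0" "ball x d' \<subseteq> S" using f(2,3) open_contains_ball by blast
  have nonzero: "grad f x \<noteq> 0" using neg l by auto
  let ?g = "norm (grad f x)"
  \<comment> \<open>A step in the direction of the gradient turns the linear part of the expansion
    into the norm of the gradient times the step length. The step length is half of
    \<open>min d d'\<close>, inside both balls.\<close>
  define r where "r = min d d' / (2 * ?g)"
  define y where "y = x + r *\<^sub>R grad f x"
  have r: "r > 0" using d(1) d'(1) nonzero by (simp add: r_def)
  have dy: "norm (y - x) = r * ?g" using r by (simp add: y_def)
  also have "\<dots> = min d d' / 2" using nonzero by (simp add: r_def)
  finally have "norm (y - x) < d" "norm (y - x) < d'" using d(1) d'(1) by auto
  then have "y \<in> ball x d" "y \<in> S" using d' by (auto simp: dist_norm norm_minus_commute)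
  then have "\<bar>f y - f x - r * ?g\<^sup>2\<bar> \<le> e * (r * ?g)" "\<bar>f y - f x\<bar> \<le> l * (r * ?g)"
    using d(2)[of y] lip[of y] dy r by (simp_all add: y_def dist_norm power2_norm_eq_inner)
  then have "r * ?g\<^sup>2 \<le> (e + l) * (r * ?g)" by (simp add: algebra_simps abs_le_iff)
  then have "(r * ?g) * ?g \<le> (r * ?g) * (e + l)" by (simp add: power2_eq_square algebra_simps)
  then have "?g \<le> e + l" using r nonzero by (simp add: mult_le_cancel_left_pos)
  then show False using neg by (simp add: e_def field_simps)
qed

lemma lip_norm_leD:
  assumes "lip_norm S f \<le> ennreal l" "l \<ge> 0" "x \<in> S" "y \<in> S"
  shows "\<bar>f x\<bar> \<le> l" "\<bar>f x - f y\<bar> \<le> l * dist x y"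
proof -
  let ?A = "SUP x\<in>S. ennreal \<bar>f x\<bar>"
    and ?B = "SUP x\<in>S. SUP y\<in>S - {x}. ennreal (\<bar>f x - f y\<bar> / dist x y)"
  have AB: "?A \<le> ennreal l" "?B \<le> ennreal l"
    using assms(1) unfolding lip_norm_def
    by (metis (no_types, lifting) add_increasing add_increasing2 order_trans order_refl zero_le)+
  have "ennreal \<bar>f x\<bar> \<le> ?A" using assms(3) by (rule SUP_upper)
  with AB(1) show "\<bar>f x\<bar> \<le> l" using assms(2) by (meson ennreal_le_iff order_trans)
  show "\<bar>f x - f y\<bar> \<le> l * dist x y"
  proof (cases "x = y")
    case False
    have "ennreal (\<bar>f x - f y\<bar> / dist x y) \<le> (SUP y\<in>S - {x}. ennreal (\<bar>f x - f y\<bar> / dist x y))"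
      using False assms(4) by (intro SUP_upper) auto
    also have "\<dots> \<le> ?B" using assms(3) by (rule SUP_upper)
    finally have "\<bar>f x - f y\<bar> / dist x y \<le> l"
      using AB(2) assms(2) by (meson ennreal_le_iff order_trans)
    then show ?thesis using False by (simp add: field_simps)
  qed simp
qed

text \<open>The Lipschitz norm is traded for pointwise bounds on values and gradients, the form in
  which the contact argument consumes it. The same \<open>l\<close> bounds the limit
  \<open>u\<close>.\<close>

definition regular_approximation ::
  "(2 \<Rightarrow> real^3 \<Rightarrow> real) \<Rightarrow> (real^2) set \<Rightarrow> (real^2 \<Rightarrow> real) \<Rightarrow> real \<Rightarrow> (nat \<Rightarrow> real) \<Rightarrow> (nat \<Rightarrow> real^2 \<Rightarrow> real) \<Rightarrow> bool" where
  "regular_approximation \<sigma> \<Omega> u l \<epsilon> v \<longleftrightarrow> l > 0 \<and>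
     (\<forall>n. \<epsilon> n > 0) \<and> \<epsilon> \<longlonglongrightarrow> 0 \<and>
     (\<forall>n. smooth_on \<Omega> (v n)) \<and>
     (\<forall>n. \<forall>x\<in>\<Omega>. L_op \<sigma> (\<epsilon> n) (v n) x = 0) \<and>
     (\<forall>n. \<forall>x\<in>\<Omega>. \<bar>v n x\<bar> \<le> l \<and> norm (grad (v n) x) \<le> l) \<and>
     (\<forall>x\<in>\<Omega>. \<bar>u x\<bar> \<le> l) \<and> (\<forall>x\<in>\<Omega>. \<forall>y\<in>\<Omega>. \<bar>u x - u y\<bar> \<le> l * dist x y) \<and>
     (\<forall>K. compact K \<and> K \<subseteq> \<Omega> \<longrightarrow> uniform_limit K v u sequentially)"

lemma vanishing_viscosity_solution_regular_approximation:
  assumes "vanishing_viscosity_solution \<sigma> \<Omega> u" "open \<Omega>"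
  obtains l \<epsilon> v where "regular_approximation \<sigma> \<Omega> u l \<epsilon> v"
proof -
  obtain \<epsilon> v l where "\<forall>n. \<epsilon> n > 0" "\<epsilon> \<longlonglongrightarrow> 0" "\<forall>n. smooth_on \<Omega> (v n)"
    "\<forall>n. \<forall>x\<in>\<Omega>. L_op \<sigma> (\<epsilon> n) (v n) x = 0" "l > 0" "\<forall>n. lip_norm \<Omega> (v n) \<le> ennreal l"
    "\<forall>K. compact K \<and> K \<subseteq> \<Omega> \<longrightarrow> uniform_limit K v u sequentially"
    using assms(1) unfolding vanishing_viscosity_solution_def
    by (elim conjE exE) (rule that; assumption)
  note * = this(1-5) spec[OF this(6)] this(7)
  note lip = lip_norm_leD[OF *(6) less_imp_le[OF *(5)]]
  \<comment> \<open>Singletons are compact, so locally uniform convergence gives pointwise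
    convergence, under which both bounds pass to \<open>u\<close>.\<close>
  have lim: "(\<lambda>n. v n x) \<longlonglongrightarrow> u x" if "x \<in> \<Omega>" for x
    using *(7)[rule_format, of "{x}"] that by (auto intro: tendsto_uniform_limitI)
  have "\<bar>u x\<bar> \<le> l" if "x \<in> \<Omega>" for x
    using that by (intro tendsto_upperbound[OF tendsto_rabs[OF lim]] always_eventually lip allI)
      (auto intro: that)
  moreover have "\<bar>u x - u y\<bar> \<le> l * dist x y" if "x \<in> \<Omega>" "y \<in> \<Omega>" for x y
    using that
    by (intro tendsto_upperbound[OF tendsto_rabs[OF tendsto_diff[OF lim lim]]] always_eventually lip allI)
      auto
  moreover have "norm (grad (v n) x) \<le> l" if "x \<in> \<Omega>" for x n
    using *(3) that by (intro norm_grad_le[OF _ assms(2) that] lip) (use *(5) in auto)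
  ultimately have "regular_approximation \<sigma> \<Omega> u l \<epsilon> v"
    unfolding regular_approximation_def using * lip by blast
  then show ?thesis by (rule that)
qed


section \<open>Bounds on compact slabs and exclusion of one-sided contact\<close>

lemma smooth_on_dz: "(\<And>j. smooth_on UNIV (g j)) \<Longrightarrow> smooth_on UNIV (dz g j)"
  unfolding dz_def by (rule smooth_onD(2))

text \<open>A solid cylinder in space. Its convexity lets the mean value inequality turn derivative
  bounds of a field into Lipschitz bounds.\<close>

definition slab :: "real^2 \<Rightarrow> real \<Rightarrow> real \<Rightarrow> (real^3) set" where
  "slab p\<^sub>0 \<rho> R = (\<lambda>w. pt (fst w) (snd w)) ` (cball p\<^sub>0 \<rho> \<times> {-R..R})"

lemma pt_in_slab: "x \<in> cball p\<^sub>0 \<rho> \<Longrightarrow> \<bar>z\<bar> \<le> R \<Longrightarrow> pt x z \<in> slab p\<^sub>0 \<rho> R"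
  unfolding slab_def by (rule image_eqI[where x = "(x, z)"]) (auto simp: abs_le_iff)

lemma compact_slab: "compact (slab p\<^sub>0 \<rho> R)"
  unfolding slab_def
  by (intro compact_continuous_image compact_Times compact_cball compact_Icc
      linear_continuous_on bounded_linear_pt)

lemma convex_slab: "convex (slab p\<^sub>0 \<rho> R)"
  unfolding slab_def
  by (intro convex_linear_image bounded_linear.linear[OF bounded_linear_pt] convex_Times
      convex_cball convex_real_interval)

lemma slab_bounds:
  fixes g :: "2 \<Rightarrow> real^3 \<Rightarrow> real"
  assumes g: "\<And>j. smooth_on UNIV (g j)"
  shows "\<exists>M>0. (\<forall>w\<in>slab p\<^sub>0 \<rho> R. norm (field g w) \<le> M) \<and>
    (\<forall>w\<in>slab p\<^sub>0 \<rho> R. \<forall>h. norm (field_deriv g w h) \<le> M * norm h) \<and>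
    (\<forall>w\<in>slab p\<^sub>0 \<rho> R. \<forall>w'\<in>slab p\<^sub>0 \<rho> R. norm (field g w - field g w') \<le> M * norm (w - w'))"
proof -
  let ?Q = "slab p\<^sub>0 \<rho> R"
  have "bounded (field g ` ?Q)"
    by (intro compact_imp_bounded compact_continuous_image continuous_on_field g compact_slab)
  then obtain M\<^sub>1 where M1: "M\<^sub>1 > 0" "\<And>w. w \<in> ?Q \<Longrightarrow> norm (field g w) \<le> M\<^sub>1"
    unfolding bounded_pos by blast
  obtain M\<^sub>2 where M2: "\<And>w h. w \<in> ?Q \<Longrightarrow> norm (field_deriv g w h) \<le> M\<^sub>2 * norm h"
    by (rule norm_field_deriv_bound[of g ?Q, OF g compact_slab]) (rule that)
  define M where "M = max M\<^sub>1 M\<^sub>2"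
  have D: "norm (field_deriv g w h) \<le> M * norm h" if "w \<in> ?Q" for w h
    using M2[OF that, of h] by (rule order_trans) (simp add: M_def mult_right_mono)
  have "M > 0" using M1(1) by (simp add: M_def)
  show ?thesis
  proof (intro exI[of _ M] conjI ballI allI)
    show "M > 0" by fact
    show "norm (field_deriv g w h) \<le> M * norm h" if "w \<in> ?Q" for w h
      using that by (rule D)
    show "norm (field g w) \<le> M" if "w \<in> ?Q" for w
      using M1(2)[OF that] by (simp add: M_def)
    show "norm (field g w - field g w') \<le> M * norm (w - w')" if "w \<in> ?Q" "w' \<in> ?Q" for w w'
      using convex_slab _ _ that
    proof (rule differentiable_bound)
      show "(field g has_derivative field_deriv g w) (at w within ?Q)" for w
        by (rule field_has_derivative[OF g])
      show "onorm (field_deriv g w) \<le> M" if "w \<in> ?Q" for w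
        using D[OF that] by (rule onorm_le)
    qed
  qed
qed

text \<open>The sign \<open>s = \<plusminus>1\<close> covers contact from above and from below.\<close>

lemma no_one_sided_contact:
  fixes \<Gamma> :: "real \<Rightarrow> real^2"
  assumes \<sigma>: "\<And>j. smooth_on UNIV (\<sigma> j)" and \<Omega>: "open \<Omega>"
    and reg: "regular_approximation \<sigma> \<Omega> u l \<epsilon> v"
    and \<rho>: "\<rho> > 0" "cball p\<^sub>0 \<rho> \<subseteq> \<Omega>" and s: "\<bar>s\<bar> = 1"
    and G_in: "\<And>t. t \<in> {a..b} \<Longrightarrow> \<Gamma> t \<in> cball p\<^sub>0 (\<rho> / 2)"
    and G: "\<And>t. t \<in> {a..b} \<Longrightarrow>
       (\<Gamma> has_vector_derivative field \<sigma> (pt (\<Gamma> t) (B t))) (at t within {a..b})"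
    and B: "\<And>t. (B has_real_derivative B\<^sub>1 t) (at t)"
    and B1: "\<And>t. (B\<^sub>1 has_real_derivative B\<^sub>2) (at t)" and neg: "s * B\<^sub>2 < 0"
    and D: "\<And>t. t \<in> {a..b} \<Longrightarrow> s * (B t - u (\<Gamma> t)) \<ge> 0"
    and ends: "s * (B a - u (\<Gamma> a)) > 0" "s * (B b - u (\<Gamma> b)) > 0"
    and t0: "t\<^sub>0 \<in> {a..b}" "B t\<^sub>0 = u (\<Gamma> t\<^sub>0)"
  shows False
proof -
  from reg have l: "l > 0" and \<epsilon>: "\<And>n. \<epsilon> n > 0" "\<epsilon> \<longlonglongrightarrow> 0" and v: "\<And>n. smooth_on \<Omega> (v n)"
    and L: "\<And>n x. x \<in> \<Omega> \<Longrightarrow> L_op \<sigma> (\<epsilon> n) (v n) x = 0"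
    and vb: "\<And>n x. x \<in> \<Omega> \<Longrightarrow> \<bar>v n x\<bar> \<le> l" "\<And>n x. x \<in> \<Omega> \<Longrightarrow> norm (grad (v n) x) \<le> l"
    and ul: "\<And>x y. x \<in> \<Omega> \<Longrightarrow> y \<in> \<Omega> \<Longrightarrow> \<bar>u x - u y\<bar> \<le> l * dist x y"
    and unif: "uniform_limit (cball p\<^sub>0 \<rho>) v u sequentially"
    unfolding regular_approximation_def using \<rho>(2) compact_cball by auto
  have ss: "s * s = 1" using s by (metis abs_mult_self_eq mult_1)
  have sle: "s * y \<le> \<bar>y\<bar>" "- \<bar>y\<bar> \<le> s * y" for y
    using s abs_le_iff[of "s * y" "\<bar>y\<bar>"] by (simp_all add: abs_mult)
  have G_in': "\<Gamma> t \<in> cball p\<^sub>0 \<rho>" "\<Gamma> t \<in> \<Omega>" if "t \<in> {a..b}" for t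
    using G_in[OF that] \<rho> by (auto simp: subset_iff)
  have contB: "continuous_on A B" for A
    using B by (meson DERIV_continuous_on has_field_derivative_at_within)
  have contG: "continuous_on {a..b} \<Gamma>"
    using G by (rule continuous_on_vector_derivative)
  have "bounded (B ` {a..b})"
    by (intro compact_imp_bounded compact_continuous_image contB compact_Icc)
  then obtain R\<^sub>0 where "\<forall>y\<in>B ` {a..b}. norm y \<le> R\<^sub>0"
    unfolding bounded_iff by blast
  then have R0: "\<bar>B t\<bar> \<le> R\<^sub>0" if "t \<in> {a..b}" for t
    using that by simp
  \<comment> \<open>The slab has to contain the graphs of all \<open>v n\<close>, of height at most
    \<open>l\<close>, as well as the lifted curve.\<close>
  define R where "R = max l R\<^sub>0"
  define Q where "Q = slab p\<^sub>0 \<rho> R"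
  have Q_G: "pt (\<Gamma> t) (B t) \<in> Q" if "t \<in> {a..b}" for t
    unfolding Q_def using G_in'(1)[OF that] R0[OF that] by (intro pt_in_slab) (auto simp: R_def)
  have Q_v: "pt x (v n x) \<in> Q" if "x \<in> cball p\<^sub>0 \<rho>" for x n
    unfolding Q_def using that vb(1)[of x n] \<rho>(2) by (intro pt_in_slab) (auto simp: R_def subset_iff)
  obtain M\<^sub>1 where "M\<^sub>1 > 0" "\<forall>w\<in>Q. norm (field \<sigma> w) \<le> M\<^sub>1"
    "\<forall>w\<in>Q. \<forall>h. norm (field_deriv \<sigma> w h) \<le> M\<^sub>1 * norm h"
    "\<forall>w\<in>Q. \<forall>w'\<in>Q. norm (field \<sigma> w - field \<sigma> w') \<le> M\<^sub>1 * norm (w - w')"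
    using slab_bounds[of \<sigma> p\<^sub>0 \<rho> R, OF \<sigma>] unfolding Q_def by blast
  note M1 = this(1) bspec[OF this(2)] spec[OF bspec[OF this(3)]] bspec[OF bspec[OF this(4)]]
  obtain M\<^sub>2 where "M\<^sub>2 > 0" "\<forall>w\<in>Q. norm (field (dz \<sigma>) w) \<le> M\<^sub>2"
    "\<forall>w\<in>Q. \<forall>h. norm (field_deriv (dz \<sigma>) w h) \<le> M\<^sub>2 * norm h"
    using slab_bounds[of "dz \<sigma>" p\<^sub>0 \<rho> R, OF smooth_on_dz[OF \<sigma>]] unfolding Q_def by blast
  note M2 = this(1) bspec[OF this(2)] spec[OF bspec[OF this(3)]]
  \<comment> \<open>The factor \<open>1 + l\<close> absorbs the passage from \<open>h\<close> to the
    tangent vector \<open>pt h (p \<bullet> h)\<close> of a graph of slope at most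
    \<open>l\<close>.\<close>
  define M where "M = max M\<^sub>1 M\<^sub>2 * (1 + l)"
  have M12: "M\<^sub>1 \<le> M" "M\<^sub>2 \<le> M" "M\<^sub>1 * (1 + l) \<le> M" "M\<^sub>2 * (1 + l) \<le> M"
    using l M1(1) M2(1) mult_left_mono[of 1 "1 + l" "max M\<^sub>1 M\<^sub>2"]
    by (auto simp: M_def intro!: mult_right_mono)
  have M: "M > 0" using M12 M1(1) by simp
  have J_bound: "norm (field_deriv g w (pt h (p \<bullet> h))) \<le> M * norm h"
    if g: "\<And>h. norm (field_deriv g w h) \<le> m * norm h" "m * (1 + l) \<le> M" "m > 0" and p: "norm p \<le> l"
    for g w h m and p :: "real^2"
  proof -
    have "norm (pt h (p \<bullet> h)) \<le> norm h + norm p * norm h"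
      using norm_pt_le[of h "p \<bullet> h"] Cauchy_Schwarz_ineq2[of p h] by simp
    also have "\<dots> \<le> (1 + l) * norm h"
      using mult_right_mono[OF p norm_ge_zero[of h]] by (simp add: algebra_simps)
    finally have "m * norm (pt h (p \<bullet> h)) \<le> m * ((1 + l) * norm h)"
      using \<open>m > 0\<close> by (intro mult_left_mono) auto
    also have "\<dots> \<le> M * norm h"
      using mult_right_mono[OF g(2) norm_ge_zero[of h]] by (simp add: mult.assoc)
    finally show ?thesis using g(1)[of "pt h (p \<bullet> h)"] by linarith
  qed
  \<comment> \<open>A quarter of the concavity: three error terms (variation of \<Psi>, penalty, and
    order \<epsilon>^2) will each cost at most \<eta>, which leaves a strictly negative
    rest.\<close>
  define \<eta> where "\<eta> = - (s * B\<^sub>2) / 4"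
  have \<eta>: "\<eta> > 0" using neg by (simp add: \<eta>_def)
  \<comment> \<open>Derivative of the field along itself, lifted with slope \<open>p\<close>. Both
    the derivative of the field along the graph of \<open>v n\<close> and the acceleration of
    \<Gamma> will be values of \<Psi> with the same \<open>p\<close>.\<close>
  define \<Psi> where "\<Psi> = (\<lambda>(w, p). field_deriv \<sigma> w (pt (field \<sigma> w) (p \<bullet> field \<sigma> w)))"
  have "continuous_on (Q \<times> cball 0 l) \<Psi>"
    unfolding \<Psi>_def split_beta
    by (intro continuous_intros \<sigma> continuous_on_compose2[OF continuous_on_field[OF \<sigma>, of UNIV]]) auto
  then have "uniformly_continuous_on (Q \<times> cball 0 l) \<Psi>"
    unfolding Q_def by (intro compact_uniformly_continuous compact_Times compact_slab compact_cball)
  moreover have "\<eta> / l > 0" using \<eta> l by simp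
  ultimately obtain d\<^sub>u where du: "d\<^sub>u > 0"
    "\<And>w w' p. w \<in> Q \<Longrightarrow> w' \<in> Q \<Longrightarrow> norm p \<le> l \<Longrightarrow> dist w w' < d\<^sub>u \<Longrightarrow> dist (\<Psi> (w, p)) (\<Psi> (w', p)) < \<eta> / l"
    unfolding uniformly_continuous_on_def by (force simp: dist_Pair_Pair)
  \<comment> \<open>At the maximum point, \<open>c\<^sub>0 / K\<close> will bound its distance from
    the curve, \<open>c\<^sub>1 / K\<close> the difference in height, and
    \<open>c\<^sub>2 / K\<close> the distance of the two points in space.\<close>
  define c\<^sub>0 where "c\<^sub>0 = 2 * l + 2"
  define c\<^sub>1 where "c\<^sub>1 = 1 + l * c\<^sub>0 + c\<^sub>0\<^sup>2"
  define c\<^sub>2 where "c\<^sub>2 = c\<^sub>0 + c\<^sub>1"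
  define \<delta> where "\<delta> = min (s * (B a - u (\<Gamma> a))) (s * (B b - u (\<Gamma> b)))"
  have \<delta>: "\<delta> > 0" using ends by (simp add: \<delta>_def)
  have c: "c\<^sub>0 > 0" "c\<^sub>1 > 0" "c\<^sub>2 > 0" using l by (simp_all add: c\<^sub>0_def c\<^sub>1_def c\<^sub>2_def add_pos_nonneg)
  have ev: "eventually (\<lambda>K. X / K < Y) at_top" if "Y > 0" for X Y :: real
    by (rule order_tendstoD(2)[OF tendsto_divide_0[OF tendsto_const filterlim_at_top_imp_at_infinity[OF filterlim_ident]] that])
  \<comment> \<open>In this order, the conditions keep the maximum point inside the ball, make
    \<Psi> vary by less than \<open>\<eta> / l\<close>, make the penalty term less than \<eta>, and
    keep the maximum away from the ends of the time interval.\<close>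
  have "eventually (\<lambda>K. K > 0 \<and> c\<^sub>0 / K < \<rho> / 2 \<and> c\<^sub>2 / K < d\<^sub>u \<and> M\<^sup>2 * c\<^sub>2\<^sup>2 / K < \<eta> \<and> (l * c\<^sub>0 + 2) / K < \<delta>) at_top"
    using \<rho> du \<eta> \<delta> by (intro eventually_conj ev eventually_gt_at_top) auto
  from eventually_happens'[OF trivial_limit_at_top_linorder this]
  obtain K where K: "K > 0" "c\<^sub>0 / K < \<rho> / 2" "c\<^sub>2 / K < d\<^sub>u" "M\<^sup>2 * c\<^sub>2\<^sup>2 / K < \<eta>" "(l * c\<^sub>0 + 2) / K < \<delta>"
    by blast
  \<comment> \<open>The coefficient of \<epsilon>^2 in \<open>contact_estimate\<close>; it contains
    \<open>K\<close>, so \<open>n\<close> can only be fixed now.\<close>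
  define C where "C = K * (M\<^sup>2 + 9 * l\<^sup>2 * M ^ 4) + (1 + l\<^sup>2 * M\<^sup>2) * l * M\<^sup>2 + 2 * l ^ 3 * M ^ 4"
  have "(\<lambda>n. (\<epsilon> n)\<^sup>2 * C) \<longlonglongrightarrow> 0"
    using tendsto_mult[OF tendsto_power[OF \<epsilon>(2), of 2] tendsto_const[of C]] by simp
  then have "eventually (\<lambda>n. (\<epsilon> n)\<^sup>2 * C < \<eta>) sequentially"
    using \<eta> by (rule order_tendstoD(2))
  moreover have "eventually (\<lambda>n. \<forall>x\<in>cball p\<^sub>0 \<rho>. dist (v n x) (u x) < 1 / K) sequentially"
    using unif K(1) unfolding uniform_limit_iff by simp
  ultimately have "eventually (\<lambda>n. (\<epsilon> n)\<^sup>2 * C < \<eta> \<and> (\<forall>x\<in>cball p\<^sub>0 \<rho>. dist (v n x) (u x) < 1 / K)) sequentially"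
    by (rule eventually_conj)
  from eventually_happens'[OF sequentially_bot this]
  obtain n where "(\<epsilon> n)\<^sup>2 * C < \<eta>" "\<forall>x\<in>cball p\<^sub>0 \<rho>. dist (v n x) (u x) < 1 / K"
    by blast
  note n = this(1) bspec[OF this(2), unfolded dist_real_def]
  define F where "F = (\<lambda>(t, x). s * (v n x - B t) - K / 2 * (norm (x - \<Gamma> t))\<^sup>2)"
  have "continuous_on ({a..b} \<times> cball p\<^sub>0 \<rho>) F"
    unfolding F_def split_beta
    by (intro continuous_intros continuous_on_compose2[OF smooth_onD(3)[OF v[of n]]]
        continuous_on_compose2[OF contB[of UNIV]] continuous_on_compose2[OF contG]) (use \<rho>(2) in auto)
  moreover have "compact ({a..b} \<times> cball p\<^sub>0 \<rho>)" by (intro compact_Times compact_Icc compact_cball)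
  moreover have "(t\<^sub>0, \<Gamma> t\<^sub>0) \<in> {a..b} \<times> cball p\<^sub>0 \<rho>" using t0 G_in' by simp
  ultimately obtain z where z: "z \<in> {a..b} \<times> cball p\<^sub>0 \<rho>" "\<And>y. y \<in> {a..b} \<times> cball p\<^sub>0 \<rho> \<Longrightarrow> F y \<le> F z"
    using continuous_attains_sup[of "{a..b} \<times> cball p\<^sub>0 \<rho>" F] by blast
  define ts where "ts = fst z"
  define xs where "xs = snd z"
  have ts: "ts \<in> {a..b}" and xs: "xs \<in> cball p\<^sub>0 \<rho>" and xs\<Omega>: "xs \<in> \<Omega>"
    using z(1) \<rho>(2) by (auto simp: ts_def xs_def subset_iff)
  have max: "s * (v n x - B t) - K / 2 * (norm (x - \<Gamma> t))\<^sup>2 \<le> s * (v n xs - B ts) - K / 2 * (norm (xs - \<Gamma> ts))\<^sup>2"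
    if "t \<in> {a..b}" "x \<in> cball p\<^sub>0 \<rho>" for t x
    using z(2)[of "(t, x)"] that by (simp add: F_def ts_def xs_def split_beta)
  define d where "d = norm (xs - \<Gamma> ts)"
  have d0: "d \<ge> 0" by (simp add: d_def)
  \<comment> \<open>Comparison with the pair \<open>(t\<^sub>0, \<Gamma> t\<^sub>0)\<close>: the
    penalty vanishes there and \<open>B\<close> equals \<open>u\<close>, so the value is at least
    \<open>- 1 / K\<close>.\<close>
  have low: "- 1 / K \<le> s * (v n xs - B ts) - K / 2 * d\<^sup>2"
    using max[OF t0(1) G_in'(1)[OF t0(1)]] n(2)[OF G_in'(1)[OF t0(1)]] sle(2)[of "v n (\<Gamma> t\<^sub>0) - u (\<Gamma> t\<^sub>0)"] t0(2)
    by (simp add: d_def)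
  have up: "s * (v n xs - B ts) \<le> 1 / K + l * d - s * (B ts - u (\<Gamma> ts))"
  proof -
    have "s * (v n xs - B ts) = s * (v n xs - u xs) + s * (u xs - u (\<Gamma> ts)) - s * (B ts - u (\<Gamma> ts))"
      by (simp add: algebra_simps)
    moreover have "s * (v n xs - u xs) \<le> 1 / K"
      using n(2)[OF xs] sle(1)[of "v n xs - u xs"] by simp
    moreover have "s * (u xs - u (\<Gamma> ts)) \<le> l * d"
      using ul[OF xs\<Omega> G_in'(2)[OF ts]] sle(1)[of "u xs - u (\<Gamma> ts)"] by (simp add: d_def dist_norm)
    ultimately show ?thesis by simp
  qed
  \<comment> \<open>Together, \<open>low\<close> and \<open>up\<close> give
    \<open>y\<^sup>2 \<le> 4 + 2 * l * y\<close> for \<open>y = K * d\<close>, which fails for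
    \<open>y > 2 * l + 2\<close>.\<close>
  have Kd: "K * d \<le> c\<^sub>0"
  proof (rule ccontr)
    assume "\<not> K * d \<le> c\<^sub>0"
    then have y: "K * d > 2 * l + 2" by (simp add: c\<^sub>0_def)
    have "K / 2 * d\<^sup>2 \<le> 2 / K + l * d" using low up D[OF ts] by simp
    then have "K * (K / 2 * d\<^sup>2) \<le> K * (2 / K + l * d)" using K(1) by simp
    then have "(K * d) * (K * d) \<le> 4 + 2 * l * (K * d)"
      using K(1) by (simp add: algebra_simps power2_eq_square)
    moreover have "(2 * l + 2) * (K * d) \<le> (K * d) * (K * d)"
      using y l by (intro mult_right_mono) auto
    ultimately have "2 * (K * d) \<le> 4" by (simp add: algebra_simps)
    then show False using y l by simp
  qed
  then have dK: "d \<le> c\<^sub>0 / K" using K(1) by (simp add: field_simps)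
  \<comment> \<open>At an endpoint the defect is at least \<delta>, more than the small defect that
    \<open>low\<close> and \<open>up\<close> permit.\<close>
  have ts': "ts \<in> {a<..<b}"
  proof (rule ccontr)
    assume "ts \<notin> {a<..<b}"
    then have "ts = a \<or> ts = b" using ts by auto
    then have "\<delta> \<le> s * (B ts - u (\<Gamma> ts))" by (auto simp: \<delta>_def)
    moreover have "0 \<le> K / 2 * d\<^sup>2" using K(1) by simp
    ultimately have "\<delta> \<le> 2 / K + l * d" using low up by simp
    also have "\<dots> \<le> 2 / K + l * (c\<^sub>0 / K)" using dK l by (intro add_mono mult_left_mono) auto
    also have "\<dots> = (l * c\<^sub>0 + 2) / K" by (simp add: add_divide_distrib)
    finally show False using K(5) by simp
  qed
  have "dist p\<^sub>0 xs \<le> dist p\<^sub>0 (\<Gamma> ts) + d"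
    using dist_triangle[of p\<^sub>0 xs "\<Gamma> ts"] by (simp add: d_def dist_norm norm_minus_commute)
  then have xs': "dist p\<^sub>0 xs < \<rho>" using G_in[OF ts] dK K(2) unfolding mem_cball by linarith
  define e where "e = \<rho> - dist p\<^sub>0 xs"
  have e: "e > 0" "ball xs e \<subseteq> cball p\<^sub>0 \<rho>"
  proof -
    show "e > 0" using xs' by (simp add: e_def)
    show "ball xs e \<subseteq> cball p\<^sub>0 \<rho>"
    proof
      fix y assume "y \<in> ball xs e"
      then show "y \<in> cball p\<^sub>0 \<rho>" using dist_triangle[of p\<^sub>0 y xs] by (simp add: e_def)
    qed
  qed
  define \<Gamma>\<^sub>1 where "\<Gamma>\<^sub>1 t = field \<sigma> (pt (\<Gamma> t) (B t))" for t
  define \<Gamma>\<^sub>2 where "\<Gamma>\<^sub>2 = field_deriv \<sigma> (pt (\<Gamma> ts) (B ts)) (pt (\<Gamma>\<^sub>1 ts) (B\<^sub>1 ts))"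
  have Gat: "(\<Gamma> has_vector_derivative \<Gamma>\<^sub>1 t) (at t)" if "t \<in> {a<..<b}" for t
    using G[of t] that at_within_Icc_at[of a t b] by (auto simp: \<Gamma>\<^sub>1_def)
  have G1at: "(\<Gamma>\<^sub>1 has_vector_derivative \<Gamma>\<^sub>2) (at ts)"
  proof -
    have "((\<lambda>t. field \<sigma> (pt (\<Gamma> t) (B t))) has_derivative
        (\<lambda>h. field_deriv \<sigma> (pt (\<Gamma> ts) (B ts)) (pt (h *\<^sub>R \<Gamma>\<^sub>1 ts) (B\<^sub>1 ts * h)))) (at ts)"
      by (rule has_derivative_compose[OF has_derivative_pt[OF Gat[OF ts', unfolded has_vector_derivative_def]
            B[unfolded has_field_derivative_def]] field_has_derivative[OF \<sigma>]])
    moreover have "field_deriv \<sigma> (pt (\<Gamma> ts) (B ts)) (pt (h *\<^sub>R \<Gamma>\<^sub>1 ts) (B\<^sub>1 ts * h)) = h *\<^sub>R \<Gamma>\<^sub>2" for h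
    proof -
      have "pt (h *\<^sub>R \<Gamma>\<^sub>1 ts) (B\<^sub>1 ts * h) = h *\<^sub>R pt (\<Gamma>\<^sub>1 ts) (B\<^sub>1 ts)"
        by (simp add: vec_eq_iff forall_3)
      then show ?thesis
        by (simp only: \<Gamma>\<^sub>2_def field_deriv_def) (simp add: vec_eq_iff del: pt_nth)
    qed
    ultimately show ?thesis
      unfolding has_vector_derivative_def \<Gamma>\<^sub>1_def[abs_def] by simp
  qed
  have maxl: "s * (v n x - B t) - K / 2 * (norm (x - \<Gamma> t))\<^sup>2 \<le> s * (v n xs - B ts) - K / 2 * (norm (xs - \<Gamma> ts))\<^sup>2"
    if "t \<in> {a<..<b}" "x \<in> ball xs e" for t x
    using that e(2) by (intro max) auto
  define p where "p = grad (v n) xs"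
  have e\<Omega>: "ball xs e \<subseteq> \<Omega>" using e(2) \<rho>(2) by blast
  note cc = contact_conditions[OF ts' v \<Omega> Gat G1at B B1 e(1) e\<Omega> maxl, folded p_def]
  \<comment> \<open>This is what makes the velocity of the lifted point equal to
    \<open>(\<Gamma>\<^sub>1 ts, p \<bullet> \<Gamma>\<^sub>1 ts)\<close>, hence
    \<open>\<Gamma>\<^sub>2\<close> a value of \<Psi>.\<close>
  have B1p: "B\<^sub>1 ts = p \<bullet> \<Gamma>\<^sub>1 ts" using cc(2) s by auto
  have pl: "norm p \<le> l" unfolding p_def by (rule vb(2)[OF xs\<Omega>])
  define w where "w = pt xs (v n xs)"
  define w' where "w' = pt (\<Gamma> ts) (B ts)"
  have wQ: "w \<in> Q" "w' \<in> Q" unfolding w_def w'_def using Q_v[OF xs] Q_G[OF ts] by auto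
  have vB: "\<bar>v n xs - B ts\<bar> \<le> c\<^sub>1 / K"
  proof -
    have "K / 2 * d\<^sup>2 = (K * d) * (K * d) / (2 * K)" using K(1) by (simp add: power2_eq_square)
    also have "\<dots> \<le> c\<^sub>0 * c\<^sub>0 / (2 * K)"
      using Kd K(1) d0 c by (intro divide_right_mono mult_mono) auto
    also have "\<dots> \<le> c\<^sub>0\<^sup>2 / K" using K(1) c by (simp add: power2_eq_square field_simps)
    finally have Kd2: "K / 2 * d\<^sup>2 \<le> c\<^sub>0\<^sup>2 / K" .
    have ld: "l * d \<le> l * c\<^sub>0 / K" using mult_left_mono[OF dK less_imp_le[OF l]] by simp
    have p0: "0 \<le> K / 2 * d\<^sup>2" "0 \<le> l * c\<^sub>0 / K" "0 \<le> c\<^sub>0\<^sup>2 / K" using K(1) l c by simp_all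
    have "c\<^sub>1 / K = 1 / K + l * c\<^sub>0 / K + c\<^sub>0\<^sup>2 / K" by (simp add: c\<^sub>1_def add_divide_distrib)
    then have "\<bar>s * (v n xs - B ts)\<bar> \<le> c\<^sub>1 / K"
      using low up D[OF ts] Kd2 ld p0 by (simp add: abs_le_iff)
    then show ?thesis using s by (simp add: abs_mult)
  qed
  have ww': "norm (w - w') \<le> c\<^sub>2 / K"
    using norm_pt_le[of "xs - \<Gamma> ts" "v n xs - B ts"] dK vB
    by (simp add: w_def w'_def pt_diff d_def[symmetric] c\<^sub>2_def add_divide_distrib)
  have \<epsilon>n: "\<epsilon> n \<ge> 0" using \<epsilon>(1)[of n] by simp
  let ?J\<^sub>1 = "\<lambda>h. field_deriv \<sigma> w (pt h (p \<bullet> h))"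
  let ?J\<^sub>2 = "\<lambda>h. \<epsilon> n *\<^sub>R field_deriv (dz \<sigma>) w (pt h (p \<bullet> h))"
  let ?b = "p \<bullet> (\<epsilon> n *\<^sub>R field (dz \<sigma>) w)"
  have est: "0 \<le> (1 + ?b\<^sup>2) * (s * B\<^sub>2 + s * (p \<bullet> (?J\<^sub>1 (field \<sigma> w) - \<Gamma>\<^sub>2)))
      + K * (norm (field \<sigma> w - \<Gamma>\<^sub>1 ts))\<^sup>2 + (\<epsilon> n)\<^sup>2 * C"
    unfolding C_def
  proof (rule contact_estimate[where J\<^sub>1 = ?J\<^sub>1 and J\<^sub>2 = ?J\<^sub>2 and H = "hess (v n) xs", OF s cc(3)
        L_op_eq_0D[of \<sigma> \<Omega> "v n" xs "\<epsilon> n", OF \<sigma> v \<Omega> xs\<Omega> L[OF xs\<Omega>], folded w_def p_def] pl])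
    show "norm (field \<sigma> w) \<le> M" "norm (\<Gamma>\<^sub>1 ts) \<le> M"
      using M1(2)[OF wQ(1)] M1(2)[OF wQ(2)] M12 by (auto simp: \<Gamma>\<^sub>1_def w'_def)
    show "norm (\<epsilon> n *\<^sub>R field (dz \<sigma>) w) \<le> \<epsilon> n * M"
      using M2(2)[OF wQ(1)] M12 \<epsilon>n by (auto intro!: mult_left_mono)
    show "norm (?J\<^sub>1 h) \<le> M * norm h" for h
      by (rule J_bound[OF M1(3)[OF wQ(1)] M12(3) M1(1) pl])
    show "norm (?J\<^sub>2 h) \<le> \<epsilon> n * M * norm h" for h
      using mult_left_mono[OF J_bound[OF M2(3)[OF wQ(1)] M12(4) M2(1) pl] \<epsilon>n]
      by (simp add: \<epsilon>n mult.assoc)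
  qed (use \<epsilon>n K(1) in auto)
  have "\<Gamma>\<^sub>2 = \<Psi> (w', p)" "?J\<^sub>1 (field \<sigma> w) = \<Psi> (w, p)"
    by (simp_all add: \<Gamma>\<^sub>2_def \<Psi>_def B1p \<Gamma>\<^sub>1_def w'_def)
  then have "norm (?J\<^sub>1 (field \<sigma> w) - \<Gamma>\<^sub>2) \<le> \<eta> / l"
    using du(2)[OF wQ pl] ww' K(3) by (simp add: dist_norm)
  then have "norm p * norm (?J\<^sub>1 (field \<sigma> w) - \<Gamma>\<^sub>2) \<le> l * (\<eta> / l)"
    using pl l by (intro mult_mono) auto
  then have "\<bar>p \<bullet> (?J\<^sub>1 (field \<sigma> w) - \<Gamma>\<^sub>2)\<bar> \<le> \<eta>"
    using Cauchy_Schwarz_ineq2[of p "?J\<^sub>1 (field \<sigma> w) - \<Gamma>\<^sub>2"] l by simp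
  then have "s * B\<^sub>2 + s * (p \<bullet> (?J\<^sub>1 (field \<sigma> w) - \<Gamma>\<^sub>2)) \<le> - 3 * \<eta>"
    using sle(1)[of "p \<bullet> (?J\<^sub>1 (field \<sigma> w) - \<Gamma>\<^sub>2)"] unfolding \<eta>_def by linarith
  then have "(1 + ?b\<^sup>2) * (s * B\<^sub>2 + s * (p \<bullet> (?J\<^sub>1 (field \<sigma> w) - \<Gamma>\<^sub>2))) \<le> (1 + ?b\<^sup>2) * (- 3 * \<eta>)"
    by (intro mult_left_mono) auto
  \<comment> \<open>The bracket is negative, so the weight, being at least 1, only helps.\<close>
  also have "\<dots> \<le> - 3 * \<eta>" using \<eta> by (simp add: algebra_simps)
  finally have 1: "(1 + ?b\<^sup>2) * (s * B\<^sub>2 + s * (p \<bullet> (?J\<^sub>1 (field \<sigma> w) - \<Gamma>\<^sub>2))) \<le> - 3 * \<eta>" .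
  have "norm (field \<sigma> w - \<Gamma>\<^sub>1 ts) \<le> M * (c\<^sub>2 / K)"
  proof -
    have "norm (field \<sigma> w - \<Gamma>\<^sub>1 ts) \<le> M\<^sub>1 * norm (w - w')"
      using M1(4)[OF wQ] by (simp add: \<Gamma>\<^sub>1_def w'_def)
    also have "\<dots> \<le> M * (c\<^sub>2 / K)" using M12(1) ww' M by (intro mult_mono) auto
    finally show ?thesis .
  qed
  then have "K * (norm (field \<sigma> w - \<Gamma>\<^sub>1 ts))\<^sup>2 \<le> K * (M * (c\<^sub>2 / K))\<^sup>2"
    using K(1) by (intro mult_left_mono power_mono) auto
  also have "\<dots> = M\<^sup>2 * c\<^sub>2\<^sup>2 / K" using K(1) by (simp add: power2_eq_square)
  finally show False using est 1 n(1) K(4) \<eta> by linarith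
qed


section \<open>Ordinary differential equations on short intervals\<close>

lemma vector_derivative_bound:
  fixes w :: "real \<Rightarrow> 'a::real_normed_vector"
  assumes w: "\<And>t. t \<in> {a..b} \<Longrightarrow> (w has_vector_derivative w' t) (at t within {a..b})"
    and K: "\<And>t. t \<in> {a..b} \<Longrightarrow> norm (w' t) \<le> K" and "s \<in> {a..b}" "t \<in> {a..b}"
  shows "norm (w t - w s) \<le> K * \<bar>t - s\<bar>"
proof -
  have "norm (w t - w s) \<le> K * norm (t - s)"
  proof (rule differentiable_bound[where S = "{a..b}"])
    show "(w has_derivative (\<lambda>h. h *\<^sub>R w' t)) (at t within {a..b})" if "t \<in> {a..b}" for t
      using w[OF that] by (simp add: has_vector_derivative_def)
    show "onorm (\<lambda>h. h *\<^sub>R w' t) \<le> K" if "t \<in> {a..b}" for t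
      using K[OF that] by (intro onorm_le) (metis abs_ge_zero mult.commute mult_left_mono norm_scaleR real_norm_def)
  qed (use assms in auto)
  then show ?thesis by simp
qed

text \<open>A substitute for the Gronwall inequality. The mean value estimate is applied at the time
  where the norm is largest; on an interval this short half of the maximum is absorbed. As
  \<open>c\<close> may be any time of the interval, the estimate works forwards and
  backwards.\<close>

lemma short_time_stability:
  fixes w :: "real \<Rightarrow> 'a::real_normed_vector"
  assumes w: "\<And>t. t \<in> {a..b} \<Longrightarrow> (w has_vector_derivative w' t) (at t within {a..b})"
    and w': "\<And>t. t \<in> {a..b} \<Longrightarrow> norm (w' t) \<le> \<Lambda> * (norm (w t) + \<Delta>)"
    and \<Lambda>: "\<Lambda> \<ge> 0" "\<Lambda> * (b - a) \<le> 1 / 2" and \<Delta>: "\<Delta> \<ge> 0" and c: "c \<in> {a..b}" and t: "t \<in> {a..b}"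
  shows "norm (w t) \<le> 2 * (norm (w c) + \<Lambda> * (b - a) * \<Delta>)"
proof -
  have "continuous_on {a..b} (\<lambda>t. norm (w t))"
    using w by (intro continuous_on_norm continuous_on_vector_derivative) auto
  then obtain m where m: "m \<in> {a..b}" "\<And>t. t \<in> {a..b} \<Longrightarrow> norm (w t) \<le> norm (w m)"
    using continuous_attains_sup[of "{a..b}" "\<lambda>t. norm (w t)"] c by auto
  have "norm (w m - w c) \<le> \<Lambda> * (norm (w m) + \<Delta>) * \<bar>m - c\<bar>"
    using m c \<Lambda>(1) by (intro vector_derivative_bound[OF w order_trans[OF w']] mult_left_mono) auto
  also have "\<dots> \<le> \<Lambda> * (norm (w m) + \<Delta>) * (b - a)"
    using m(1) c \<Lambda>(1) \<Delta> by (intro mult_left_mono) auto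
  also have "\<dots> = (\<Lambda> * (b - a)) * norm (w m) + \<Lambda> * (b - a) * \<Delta>"
    by (simp add: algebra_simps)
  also have "\<dots> \<le> 1 / 2 * norm (w m) + \<Lambda> * (b - a) * \<Delta>"
    using mult_right_mono[OF \<Lambda>(2) norm_ge_zero[of "w m"]] by simp
  finally have "norm (w m - w c) \<le> norm (w m) / 2 + \<Lambda> * (b - a) * \<Delta>" by simp
  then have "norm (w m) \<le> 2 * (norm (w c) + \<Lambda> * (b - a) * \<Delta>)"
    using norm_triangle_sub[of "w m" "w c"] by simp
  then show ?thesis using m(2)[OF t] by simp
qed

text \<open>The field is controlled on a ball only, so it is composed with the projection
  \<open>cl\<close> onto that ball, a nonexpansive map. Clamping time by \<open>k\<close> extends
  candidates to the whole line; there the integral operator contracts bounded continuous functions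
  by the factor 1/2. The bound on the travelled distance finally shows that the fixed point stays in
  the ball, where the projection is the identity.\<close>

lemma Picard_Lindelof:
  fixes f :: "real \<Rightarrow> 'a::euclidean_space \<Rightarrow> 'a"
  assumes t0: "t\<^sub>0 \<in> {a..b}" and cont: "continuous_on ({a..b} \<times> cball p \<rho>) (\<lambda>(t, x). f t x)"
    and M: "\<And>t x. t \<in> {a..b} \<Longrightarrow> x \<in> cball p \<rho> \<Longrightarrow> norm (f t x) \<le> M"
    and lip: "\<And>t x y. t \<in> {a..b} \<Longrightarrow> x \<in> cball p \<rho> \<Longrightarrow> y \<in> cball p \<rho> \<Longrightarrow> norm (f t x - f t y) \<le> \<Lambda> * norm (x - y)"
    and \<Lambda>: "\<Lambda> \<ge> 0" "\<Lambda> * (b - a) \<le> 1 / 2" and x0: "dist p x\<^sub>0 + M * (b - a) \<le> \<rho>" and \<rho>: "\<rho> \<ge> 0"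
  obtains g where "g t\<^sub>0 = x\<^sub>0" "\<And>t. t \<in> {a..b} \<Longrightarrow> g t \<in> cball p \<rho>"
    "\<And>t. t \<in> {a..b} \<Longrightarrow> (g has_vector_derivative f t (g t)) (at t within {a..b})"
proof -
  have ab: "a \<le> b" using t0 by simp
  have "norm (f t\<^sub>0 p) \<le> M" using \<rho> by (intro M t0) simp
  then have M0: "M \<ge> 0" using norm_ge_zero order_trans by blast
  define cl where "cl = closest_point (cball p \<rho>)"
  have cl: "cl x \<in> cball p \<rho>" for x
    unfolding cl_def using \<rho> by (intro closest_point_in_set) auto
  have cl_lip: "dist (cl x) (cl y) \<le> dist x y" for x y
    unfolding cl_def using \<rho> by (intro closest_point_lipschitz) auto
  have cl_cont: "continuous_on A cl" for A
    unfolding cl_def using \<rho> by (intro continuous_on_closest_point) auto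
  define k where "k t = max a (min b t)" for t
  have k: "k t \<in> {a..b}" "t \<in> {a..b} \<Longrightarrow> k t = t" for t
    using ab by (auto simp: k_def)
  define I where "I g t = integral {a..t} (\<lambda>s. f s (cl (g s)))" for g t
  have I: "(I g has_vector_derivative f t (cl (g t))) (at t within {a..b})"
    if "continuous_on {a..b} g" "t \<in> {a..b}" for g t
    unfolding I_def
  proof (rule integral_has_vector_derivative[OF _ that(2)])
    have "continuous_on {a..b} (\<lambda>s. (s, cl (g s)))"
      by (intro continuous_intros continuous_on_compose2[OF cl_cont that(1)]) auto
    from continuous_on_compose2[OF cont this] show "continuous_on {a..b} (\<lambda>s. f s (cl (g s)))"
      using cl by (simp add: image_subset_iff)
  qed
  have I_bound: "norm (I g t - I g s) \<le> M * \<bar>t - s\<bar>"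
    if "continuous_on {a..b} g" "t \<in> {a..b}" "s \<in> {a..b}" for g t s
    by (rule vector_derivative_bound[OF I[OF that(1)] M that(3,2)]) (auto intro: cl simp del: mem_cball)
  define T where "T g = Bcontfun (\<lambda>t. x\<^sub>0 + (I (apply_bcontfun g) (k t) - I (apply_bcontfun g) t\<^sub>0))" for g
  have T: "apply_bcontfun (T g) t = x\<^sub>0 + (I (apply_bcontfun g) (k t) - I (apply_bcontfun g) t\<^sub>0)" for g t
  proof -
    have "continuous_on {a..b} (I (apply_bcontfun g))"
      using I[OF continuous_on_apply_bcontfun] by (rule continuous_on_vector_derivative)
    then have "continuous_on UNIV (\<lambda>t. I (apply_bcontfun g) (k t))"
      by (rule continuous_on_compose2) (use k in \<open>auto simp: k_def intro!: continuous_intros\<close>)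
    moreover have "norm (x\<^sub>0 + (I (apply_bcontfun g) (k t) - I (apply_bcontfun g) t\<^sub>0)) \<le> norm x\<^sub>0 + M * (b - a)" for t
    proof -
      have "norm (I (apply_bcontfun g) (k t) - I (apply_bcontfun g) t\<^sub>0) \<le> M * \<bar>k t - t\<^sub>0\<bar>"
        by (rule I_bound[OF continuous_on_apply_bcontfun k(1) t0])
      also have "\<dots> \<le> M * (b - a)" using k(1)[of t] t0 M0 by (intro mult_left_mono) auto
      finally show ?thesis using norm_triangle_mono by blast
    qed
    ultimately show ?thesis
      unfolding T_def by (subst Bcontfun_inverse) (auto intro!: bcontfun_normI continuous_intros)
  qed
  have "dist (T g) (T g') \<le> 1 / 2 * dist g g'" for g g'
  proof (rule dist_bound)
    fix t
    let ?w = "\<lambda>t. I (apply_bcontfun g) t - I (apply_bcontfun g') t"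
    have "norm (?w (k t) - ?w t\<^sub>0) \<le> (\<Lambda> * dist g g') * \<bar>k t - t\<^sub>0\<bar>"
    proof (rule vector_derivative_bound[OF has_vector_derivative_diff[OF I I] _ t0 k(1)])
      fix s assume s: "s \<in> {a..b}"
      have "norm (f s (cl (apply_bcontfun g s)) - f s (cl (apply_bcontfun g' s)))
          \<le> \<Lambda> * norm (cl (apply_bcontfun g s) - cl (apply_bcontfun g' s))"
        by (rule lip[OF s cl cl])
      also have "\<dots> \<le> \<Lambda> * dist g g'"
        using cl_lip[of "apply_bcontfun g s" "apply_bcontfun g' s"] dist_bounded[of g s g']
        by (intro mult_left_mono \<Lambda>) (simp add: dist_norm)
      finally show "norm (f s (cl (apply_bcontfun g s)) - f s (cl (apply_bcontfun g' s))) \<le> \<Lambda> * dist g g'" .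
    qed auto
    also have "\<dots> \<le> (\<Lambda> * dist g g') * (b - a)"
      using k(1)[of t] t0 \<Lambda>(1) by (intro mult_left_mono) auto
    also have "\<dots> \<le> 1 / 2 * dist g g'"
      using mult_right_mono[OF \<Lambda>(2) zero_le_dist[of g g']] by (simp add: algebra_simps)
    finally show "dist (apply_bcontfun (T g) t) (apply_bcontfun (T g') t) \<le> 1 / 2 * dist g g'"
      by (simp add: T dist_norm algebra_simps)
  qed
  then obtain G where G: "T G = G"
    using banach_fix_type[of "1 / 2" T] by auto
  define g where "g = apply_bcontfun G"
  have gc: "continuous_on {a..b} g" by (simp add: g_def)
  have g: "g t = x\<^sub>0 + (I g t - I g t\<^sub>0)" if "t \<in> {a..b}" for t
    using T[of G t] k(2)[OF that] by (simp add: G g_def)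
  show ?thesis
  proof (rule that)
    show "g t\<^sub>0 = x\<^sub>0" using g[OF t0] by simp
    show g_in: "g t \<in> cball p \<rho>" if t: "t \<in> {a..b}" for t
    proof -
      have "norm (I g t - I g t\<^sub>0) \<le> M * (b - a)"
        by (intro order_trans[OF I_bound[OF gc t t0] mult_left_mono] M0) (use t t0 in auto)
      then have "dist x\<^sub>0 (g t) \<le> M * (b - a)"
        by (simp add: g[OF t] dist_norm norm_minus_commute)
      then show ?thesis using x0 dist_triangle[of p "g t" x\<^sub>0] by simp
    qed
    show "(g has_vector_derivative f t (g t)) (at t within {a..b})" if t: "t \<in> {a..b}" for t
    proof -
      have "((\<lambda>t. x\<^sub>0 + (I g t - I g t\<^sub>0)) has_vector_derivative f t (cl (g t))) (at t within {a..b})"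
        by (auto intro!: derivative_eq_intros I gc t)
      moreover have "cl (g t) = g t" unfolding cl_def by (rule closest_point_self[OF g_in[OF t]])
      ultimately show ?thesis
        using has_vector_derivative_transform[OF t g] by simp
    qed
  qed
qed


section \<open>Maximum principle and shooting\<close>

text \<open>Origin of the constants: affine heights will be at most \<open>2 * l\<close> and are
  perturbed by at most \<open>12 * l + 2\<close>, whence the bound on \<open>R\<close>. The
  conditions on \<open>r\<close> serve, in turn, contraction and stability, confinement of curves
  that start within \<open>\<rho> / 4\<close> to the ball of radius \<open>\<rho> / 2\<close>, and
  domination of the response of \<open>u\<close> by the perturbation of the height.\<close>

locale viscosity_patch =
  fixes \<sigma> :: "2 \<Rightarrow> real^3 \<Rightarrow> real" and \<Omega> :: "(real^2) set" and u :: "real^2 \<Rightarrow> real"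
    and l :: real and \<epsilon> :: "nat \<Rightarrow> real" and v :: "nat \<Rightarrow> real^2 \<Rightarrow> real"
    and p\<^sub>0 :: "real^2" and \<rho> R M r :: real
  assumes \<sigma>: "\<And>j. smooth_on UNIV (\<sigma> j)" and \<Omega>: "open \<Omega>"
    and reg: "regular_approximation \<sigma> \<Omega> u l \<epsilon> v"
    and \<rho>: "\<rho> > 0" "cball p\<^sub>0 \<rho> \<subseteq> \<Omega>"
    and R: "14 * l + 2 \<le> R" and M: "M > 0"
    and M_bound: "\<And>w. w \<in> slab p\<^sub>0 \<rho> R \<Longrightarrow> norm (field \<sigma> w) \<le> M"
    and M_lip: "\<And>w w'. w \<in> slab p\<^sub>0 \<rho> R \<Longrightarrow> w' \<in> slab p\<^sub>0 \<rho> R \<Longrightarrow>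
       norm (field \<sigma> w - field \<sigma> w') \<le> M * norm (w - w')"
    and r: "r > 0" "M * r \<le> 1 / 2" "M * r \<le> \<rho> / 4" "l * (M * r) \<le> 1 / 8"
begin

lemma l_pos: "l > 0"
  and u_bound: "x \<in> \<Omega> \<Longrightarrow> \<bar>u x\<bar> \<le> l"
  and u_lip: "x \<in> \<Omega> \<Longrightarrow> y \<in> \<Omega> \<Longrightarrow> \<bar>u x - u y\<bar> \<le> l * dist x y"
  using reg unfolding regular_approximation_def by auto

text \<open>The radius \<open>\<rho> / 2\<close> leaves a margin of width \<open>\<rho> / 2\<close>
  for the maximum point of the contact argument, which lies near the curve but not on it.\<close>

definition lifted_curve :: "(real \<Rightarrow> real) \<Rightarrow> real^2 \<Rightarrow> (real \<Rightarrow> real^2) \<Rightarrow> bool" where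
  "lifted_curve B x \<Gamma> \<longleftrightarrow> \<Gamma> 0 = x \<and> (\<forall>t\<in>{0..r}. \<Gamma> t \<in> cball p\<^sub>0 (\<rho> / 2) \<and>
     (\<Gamma> has_vector_derivative field \<sigma> (pt (\<Gamma> t) (B t))) (at t within {0..r}))"

lemma lifted_curveD:
  assumes "lifted_curve B x \<Gamma>"
  shows "\<Gamma> 0 = x" "t \<in> {0..r} \<Longrightarrow> \<Gamma> t \<in> cball p\<^sub>0 (\<rho> / 2)" "t \<in> {0..r} \<Longrightarrow> \<Gamma> t \<in> \<Omega>"
    "t \<in> {0..r} \<Longrightarrow> (\<Gamma> has_vector_derivative field \<sigma> (pt (\<Gamma> t) (B t))) (at t within {0..r})"
    "continuous_on {0..r} \<Gamma>"
proof -
  show *: "\<Gamma> 0 = x" "t \<in> {0..r} \<Longrightarrow> \<Gamma> t \<in> cball p\<^sub>0 (\<rho> / 2)"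
    "t \<in> {0..r} \<Longrightarrow> (\<Gamma> has_vector_derivative field \<sigma> (pt (\<Gamma> t) (B t))) (at t within {0..r})" for t
    using assms unfolding lifted_curve_def by auto
  show "continuous_on {0..r} \<Gamma>" using *(3) by (rule continuous_on_vector_derivative)
  show "t \<in> {0..r} \<Longrightarrow> \<Gamma> t \<in> \<Omega>" using *(2)[of t] \<rho> by (auto simp: subset_iff)
qed

lemma lifted_in_slab:
  assumes "lifted_curve B x \<Gamma>" "t \<in> {0..r}" "\<bar>B t\<bar> \<le> R"
  shows "pt (\<Gamma> t) (B t) \<in> slab p\<^sub>0 \<rho> R"
  using lifted_curveD(2)[OF assms(1,2)] \<rho>(1) assms(3) by (intro pt_in_slab) auto

lemma lifted_curve_exists:
  assumes B: "continuous_on {0..r} B" "\<And>t. t \<in> {0..r} \<Longrightarrow> \<bar>B t\<bar> \<le> R" and x: "x \<in> cball p\<^sub>0 (\<rho> / 4)"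
  obtains \<Gamma> where "lifted_curve B x \<Gamma>"
proof -
  have slab: "pt y (B t) \<in> slab p\<^sub>0 \<rho> R" if "t \<in> {0..r}" "y \<in> cball p\<^sub>0 (\<rho> / 2)" for t y
    using that \<rho>(1) B(2) by (intro pt_in_slab) auto
  obtain g where "g 0 = x" "\<And>t. t \<in> {0..r} \<Longrightarrow> g t \<in> cball p\<^sub>0 (\<rho> / 2)"
    "\<And>t. t \<in> {0..r} \<Longrightarrow> (g has_vector_derivative field \<sigma> (pt (g t) (B t))) (at t within {0..r})"
  proof (rule Picard_Lindelof[of 0 0 r p\<^sub>0 "\<rho> / 2" "\<lambda>t y. field \<sigma> (pt y (B t))" M M x])
    show "continuous_on ({0..r} \<times> cball p\<^sub>0 (\<rho> / 2)) (\<lambda>(t, y). field \<sigma> (pt y (B t)))"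
      unfolding split_beta
      by (intro continuous_on_compose2[OF continuous_on_field[of \<sigma> UNIV, OF \<sigma>]] continuous_intros
          continuous_on_compose2[OF B(1)]) auto
    show "norm (field \<sigma> (pt y (B t))) \<le> M" if "t \<in> {0..r}" "y \<in> cball p\<^sub>0 (\<rho> / 2)" for t y
      using that by (intro M_bound slab)
    show "norm (field \<sigma> (pt y (B t)) - field \<sigma> (pt z (B t))) \<le> M * norm (y - z)"
      if "t \<in> {0..r}" "y \<in> cball p\<^sub>0 (\<rho> / 2)" "z \<in> cball p\<^sub>0 (\<rho> / 2)" for t y z
    proof -
      have "norm (field \<sigma> (pt y (B t)) - field \<sigma> (pt z (B t))) \<le> M * norm (pt y (B t) - pt z (B t))"
        using that by (intro M_lip slab)
      also have "\<dots> \<le> M * norm (y - z)"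
        using norm_pt_le[of "y - z" 0] M by (intro mult_left_mono) (auto simp: pt_diff)
      finally show ?thesis .
    qed
    show "dist p\<^sub>0 x + M * (r - 0) \<le> \<rho> / 2" using x r(3) by simp
  qed (use r M \<rho> in auto)
  then show ?thesis by (intro that[of g]) (simp add: lifted_curve_def)
qed

text \<open>The factor 1/4 is the point: moving the height by \<Delta> moves \<open>u\<close> along
  the curve by much less, so the defect follows the height. It comes from stability (factor 2) and
  \<open>l * (M * r) \<le> 1 / 8\<close>.\<close>

lemma lifted_curve_dependence:
  assumes L: "lifted_curve B x \<Gamma>" "lifted_curve B' x \<Gamma>'"
    and b: "\<And>t. t \<in> {0..r} \<Longrightarrow> \<bar>B t\<bar> \<le> R" "\<And>t. t \<in> {0..r} \<Longrightarrow> \<bar>B' t\<bar> \<le> R"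
    and \<Delta>: "\<And>t. t \<in> {0..r} \<Longrightarrow> \<bar>B t - B' t\<bar> \<le> \<Delta>" and t: "t \<in> {0..r}"
  shows "norm (\<Gamma> t - \<Gamma>' t) \<le> 2 * (M * r * \<Delta>)" "\<bar>u (\<Gamma> t) - u (\<Gamma>' t)\<bar> \<le> \<Delta> / 4"
proof -
  have \<Delta>0: "\<Delta> \<ge> 0" using \<Delta>[OF t] by simp
  have "norm (\<Gamma> t - \<Gamma>' t) \<le> 2 * (norm (\<Gamma> 0 - \<Gamma>' 0) + M * (r - 0) * \<Delta>)"
  proof (rule short_time_stability[OF has_vector_derivative_diff[OF lifted_curveD(4)[OF L(1)] lifted_curveD(4)[OF L(2)]]])
    fix s assume s: "s \<in> {0..r}"
    have "norm (field \<sigma> (pt (\<Gamma> s) (B s)) - field \<sigma> (pt (\<Gamma>' s) (B' s)))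
        \<le> M * norm (pt (\<Gamma> s) (B s) - pt (\<Gamma>' s) (B' s))"
      by (intro M_lip lifted_in_slab[OF L(1) s b(1)[OF s]] lifted_in_slab[OF L(2) s b(2)[OF s]])
    also have "\<dots> \<le> M * (norm (\<Gamma> s - \<Gamma>' s) + \<Delta>)"
      using norm_pt_le[of "\<Gamma> s - \<Gamma>' s" "B s - B' s"] \<Delta>[OF s] M by (intro mult_left_mono) (auto simp: pt_diff)
    finally show "norm (field \<sigma> (pt (\<Gamma> s) (B s)) - field \<sigma> (pt (\<Gamma>' s) (B' s)))
        \<le> M * (norm (\<Gamma> s - \<Gamma>' s) + \<Delta>)" .
  qed (use r M \<Delta>0 t in auto)
  then show 1: "norm (\<Gamma> t - \<Gamma>' t) \<le> 2 * (M * r * \<Delta>)"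
    using lifted_curveD(1)[OF L(1)] lifted_curveD(1)[OF L(2)] by simp
  have "\<bar>u (\<Gamma> t) - u (\<Gamma>' t)\<bar> \<le> l * dist (\<Gamma> t) (\<Gamma>' t)"
    by (intro u_lip lifted_curveD(3)[OF L(1) t] lifted_curveD(3)[OF L(2) t])
  also have "\<dots> \<le> l * (2 * (M * r * \<Delta>))"
    using 1 l_pos by (intro mult_left_mono) (auto simp: dist_norm)
  also have "\<dots> = 2 * \<Delta> * (l * (M * r))" by simp
  also have "\<dots> \<le> 2 * \<Delta> * (1 / 8)" using r(4) \<Delta>0 by (intro mult_left_mono) auto
  finally show "\<bar>u (\<Gamma> t) - u (\<Gamma>' t)\<bar> \<le> \<Delta> / 4" by simp
qed

text \<open>If the defect were negative somewhere, raise \<open>B\<close> by \<open>\<theta> (2 - (t/r)\<^sup>2)\<close>, which is strictly concave and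
  dominates the induced change of \<open>u \<circ> \<Gamma>\<close> on a short interval. The largest \<open>\<theta>\<close> for which the
  defect still has a nonpositive value produces a one-sided contact.\<close>

lemma defect_nonneg:
  assumes s: "\<bar>s\<bar> = 1" and B: "\<And>t. B t = c\<^sub>0 + c\<^sub>1 * t" "\<And>t. t \<in> {0..r} \<Longrightarrow> \<bar>B t\<bar> \<le> 2 * l"
    and x: "x \<in> cball p\<^sub>0 (\<rho> / 4)" and L: "lifted_curve B x \<Gamma>"
    and ends: "s * (B 0 - u (\<Gamma> 0)) \<ge> 0" "s * (B r - u (\<Gamma> r)) \<ge> 0" and t: "t \<in> {0..r}"
  shows "s * (B t - u (\<Gamma> t)) \<ge> 0"
proof (rule ccontr)
  assume contr: "\<not> s * (B t - u (\<Gamma> t)) \<ge> 0"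
  have ss: "s * s = 1" using s by (metis abs_mult_self_eq mult_1)
  have sle: "s * y \<le> \<bar>y\<bar>" "- \<bar>y\<bar> \<le> s * y" for y
    using s abs_le_iff[of "s * y" "\<bar>y\<bar>"] by (simp_all add: abs_mult)
  \<comment> \<open>The defect is at least \<open>- 3 * l\<close> at \<open>\<theta> = 0\<close> and
    grows in \<theta> at rate at least 1/2, so it is positive everywhere once
    \<open>\<theta> = 6 * l + 1\<close>.\<close>
  define \<Theta> where "\<Theta> = 6 * l + 1"
  \<comment> \<open>This normalisation keeps the profile between 1 and 2 on the time
    interval.\<close>
  define \<kappa> where "\<kappa> = 1 / r\<^sup>2"
  have \<kappa>: "\<kappa> > 0" "\<kappa> * r\<^sup>2 = 1" using r(1) by (simp_all add: \<kappa>_def)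
  define \<eta> where "\<eta> t = 2 - \<kappa> * t\<^sup>2" for t
  define E where "E \<theta> t = B t + s * (\<theta> * \<eta> t)" for \<theta> t
  have \<eta>: "1 \<le> \<eta> t" "\<eta> t \<le> 2" if "t \<in> {0..r}" for t
  proof -
    have "\<kappa> * t\<^sup>2 \<le> \<kappa> * r\<^sup>2" using that \<kappa>(1) by (intro mult_left_mono power_mono) auto
    then show "1 \<le> \<eta> t" "\<eta> t \<le> 2" using \<kappa> by (auto simp: \<eta>_def)
  qed
  have E_bound: "\<bar>E \<theta> t\<bar> \<le> R" if "\<theta> \<in> {0..\<Theta>}" "t \<in> {0..r}" for \<theta> t
  proof -
    have "\<bar>s * (\<theta> * \<eta> t)\<bar> = \<theta> * \<eta> t" using s that \<eta>[OF that(2)] by (simp add: abs_mult)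
    also have "\<dots> \<le> \<Theta> * 2" using that \<eta>[OF that(2)] by (intro mult_mono) auto
    finally have "\<bar>s * (\<theta> * \<eta> t)\<bar> \<le> 12 * l + 2" by (simp add: \<Theta>_def)
    then show ?thesis
      using B(2)[OF that(2)] R abs_triangle_ineq[of "B t" "s * (\<theta> * \<eta> t)"] unfolding E_def by linarith
  qed
  have E_diff: "\<bar>E \<theta> t - E \<theta>' t\<bar> \<le> 2 * \<bar>\<theta> - \<theta>'\<bar>" if "t \<in> {0..r}" for \<theta> \<theta>' t
  proof -
    have "\<bar>E \<theta> t - E \<theta>' t\<bar> = \<bar>s * ((\<theta> - \<theta>') * \<eta> t)\<bar>" by (simp add: E_def algebra_simps)
    also have "\<dots> = \<bar>\<theta> - \<theta>'\<bar> * \<eta> t" using s \<eta>[OF that] by (simp add: abs_mult)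
    also have "\<dots> \<le> \<bar>\<theta> - \<theta>'\<bar> * 2" using \<eta>[OF that] by (intro mult_left_mono) auto
    finally show ?thesis by simp
  qed
  have E_cont: "continuous_on A (E \<theta>)" for A \<theta>
    unfolding E_def \<eta>_def B(1) by (intro continuous_intros)
  have "\<forall>\<theta>. \<exists>\<Gamma>. \<theta> \<in> {0..\<Theta>} \<longrightarrow> lifted_curve (E \<theta>) x \<Gamma>"
    using lifted_curve_exists[OF E_cont E_bound x] by metis
  then obtain G where G: "\<And>\<theta>. \<theta> \<in> {0..\<Theta>} \<Longrightarrow> lifted_curve (E \<theta>) x (G \<theta>)" by metis
  define D where "D \<theta> t = s * (E \<theta> t - u (G \<theta> t))" for \<theta> t
  have E0: "E 0 = B" by (simp add: E_def fun_eq_iff)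
  have \<Theta>: "0 \<le> \<Theta>" using l_pos by (simp add: \<Theta>_def)
  \<comment> \<open>\<open>G 0\<close> and \<Gamma> were obtained independently; the dependence
    estimate with difference 0 identifies \<open>u\<close> along them.\<close>
  have D0: "D 0 t = s * (B t - u (\<Gamma> t))" if "t \<in> {0..r}" for t
  proof -
    have "\<bar>u (G 0 t) - u (\<Gamma> t)\<bar> \<le> 0 / 4"
      using E_bound[of 0] \<Theta> E0
      by (intro lifted_curve_dependence(2)[OF G[of 0] L _ _ _ that]) auto
    then show ?thesis by (simp add: D_def E0)
  qed
  \<comment> \<open>The height contributes between 1 and 2 per unit of \<theta> and the response of
    \<open>u\<close> at most 1/2, so the rate lies between 1/2 and 5/2.\<close>
  have D_mono: "D \<theta>' t + (\<theta> - \<theta>') / 2 \<le> D \<theta> t" and D_lip: "D \<theta> t \<le> D \<theta>' t + 3 * (\<theta> - \<theta>')"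
    if "\<theta> \<in> {0..\<Theta>}" "\<theta>' \<in> {0..\<Theta>}" "\<theta>' \<le> \<theta>" "t \<in> {0..r}" for \<theta> \<theta>' t
  proof -
    have "\<bar>u (G \<theta> t) - u (G \<theta>' t)\<bar> \<le> 2 * \<bar>\<theta> - \<theta>'\<bar> / 4"
      using that by (intro lifted_curve_dependence(2)[OF G G E_bound E_bound E_diff]) auto
    then have 1: "\<bar>u (G \<theta> t) - u (G \<theta>' t)\<bar> \<le> (\<theta> - \<theta>') / 2" using that by simp
    have "D \<theta> t - D \<theta>' t = s * s * ((\<theta> - \<theta>') * \<eta> t) - s * (u (G \<theta> t) - u (G \<theta>' t))"
      by (simp add: D_def E_def algebra_simps)
    then have 2: "D \<theta> t - D \<theta>' t = (\<theta> - \<theta>') * \<eta> t - s * (u (G \<theta> t) - u (G \<theta>' t))"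
      by (simp add: ss)
    have "0 \<le> \<theta> - \<theta>'" using that(3) by simp
    note 3 = mult_left_mono[OF \<eta>(1)[OF that(4)] this] mult_left_mono[OF \<eta>(2)[OF that(4)] this]
    show "D \<theta>' t + (\<theta> - \<theta>') / 2 \<le> D \<theta> t"
      using 1 2 3(1) sle(1)[of "u (G \<theta> t) - u (G \<theta>' t)"] by argo
    show "D \<theta> t \<le> D \<theta>' t + 3 * (\<theta> - \<theta>')"
      using 1 2 3(2) sle(2)[of "u (G \<theta> t) - u (G \<theta>' t)"] that(3) by argo
  qed
  have D\<Theta>: "D \<Theta> t > 0" if "t \<in> {0..r}" for t
  proof -
    have "- (2 * l + l) \<le> D 0 t"
      using sle(2)[of "B t - u (\<Gamma> t)"] B(2)[OF that] u_bound[OF lifted_curveD(3)[OF L that]] D0[OF that]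
      by linarith
    moreover have "D 0 t + (\<Theta> - 0) / 2 \<le> D \<Theta> t" by (rule D_mono) (use \<Theta> that in auto)
    moreover have "(\<Theta> - 0) / 2 = 3 * l + 1 / 2" by (simp add: \<Theta>_def)
    ultimately show ?thesis by argo
  qed
  define S where "S = {\<theta>\<in>{0..\<Theta>}. \<exists>t\<in>{0..r}. D \<theta> t \<le> 0}"
  have S0: "0 \<in> S" using contr t D0[OF t] \<Theta> by (auto simp: S_def intro!: bexI[of _ t])
  have S_bdd: "bdd_above S" by (auto simp: S_def bdd_above_def)
  define \<theta> where "\<theta> = Sup S"
  have "0 \<le> \<theta>" unfolding \<theta>_def by (rule cSup_upper[OF S0 S_bdd])
  moreover have "\<theta> \<le> \<Theta>" unfolding \<theta>_def by (rule cSup_least) (use S0 in \<open>auto simp: S_def\<close>)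
  ultimately have \<theta>: "\<theta> \<in> {0..\<Theta>}" by simp
  \<comment> \<open>By \<open>D_lip\<close> a negative value would persist for a slightly larger
    parameter, beyond the supremum. Conversely, a strictly positive minimum would keep parameters
    just below the supremum out of \<open>S\<close>; so the minimum is exactly 0.\<close>
  have D_nonneg: "D \<theta> t \<ge> 0" if "t \<in> {0..r}" for t
  proof (rule ccontr)
    assume neg: "\<not> D \<theta> t \<ge> 0"
    with D\<Theta>[OF that] have "\<theta> \<noteq> \<Theta>" by auto
    define \<theta>' where "\<theta>' = min \<Theta> (\<theta> - D \<theta> t / 3)"
    have \<theta>': "\<theta>' \<in> {0..\<Theta>}" "\<theta> < \<theta>'" "3 * (\<theta>' - \<theta>) \<le> - D \<theta> t"
      using \<theta> \<open>\<theta> \<noteq> \<Theta>\<close> neg by (auto simp: \<theta>'_def min_def)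
    then have "D \<theta>' t \<le> 0" using D_lip[of \<theta>' \<theta> t] \<theta> that by simp
    then have "\<theta>' \<in> S" using \<theta>'(1) that by (auto simp: S_def)
    then show False using cSup_upper[OF _ S_bdd] \<theta>'(2) by (fastforce simp: \<theta>_def)
  qed
  have D_cont: "continuous_on {0..r} (D \<theta>)"
  proof -
    have "continuous_on \<Omega> u"
      by (rule lipschitz_on_continuous_on[of l]) (use u_lip l_pos in \<open>auto simp: lipschitz_on_def dist_real_def\<close>)
    then show ?thesis
      unfolding D_def
      by (intro continuous_intros E_cont continuous_on_compose2[OF _ lifted_curveD(5)[OF G[OF \<theta>]]])
        (use lifted_curveD(3)[OF G[OF \<theta>]] in auto)
  qed
  obtain t\<^sub>0 where t0: "t\<^sub>0 \<in> {0..r}" "\<And>t. t \<in> {0..r} \<Longrightarrow> D \<theta> t\<^sub>0 \<le> D \<theta> t"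
    using continuous_attains_inf[OF compact_Icc _ D_cont] r(1) by auto
  have "D \<theta> t\<^sub>0 \<le> 0"
  proof (rule ccontr)
    assume pos: "\<not> D \<theta> t\<^sub>0 \<le> 0"
    have "\<exists>\<theta>'\<in>S. \<theta> - D \<theta> t\<^sub>0 / 3 < \<theta>'"
      using less_cSup_iff[OF _ S_bdd, of "\<theta> - D \<theta> t\<^sub>0 / 3"] S0 pos by (auto simp: \<theta>_def)
    then obtain \<theta>' where \<theta>': "\<theta>' \<in> S" "\<theta> - D \<theta> t\<^sub>0 / 3 < \<theta>'" by blast
    then obtain t where t: "t \<in> {0..r}" "D \<theta>' t \<le> 0" "\<theta>' \<in> {0..\<Theta>}" by (auto simp: S_def)
    have "\<theta>' \<le> \<theta>" unfolding \<theta>_def by (rule cSup_upper[OF \<theta>'(1) S_bdd])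
    then show False using D_lip[OF \<theta> t(3) _ t(1)] t0(2)[OF t(1)] t(2) \<theta>'(2) by simp
  qed
  then have Dt0: "D \<theta> t\<^sub>0 = 0" using D_nonneg[OF t0(1)] by simp
  have "\<theta> \<noteq> 0" using D_nonneg[OF t] D0[OF t] contr by auto
  then have \<theta>pos: "\<theta> > 0" using \<theta> by simp
  \<comment> \<open>Contact is thereby excluded at the ends: nonnegative defects become strictly
    positive as soon as \<theta> is.\<close>
  have end0: "D \<theta> t > 0" if "t \<in> {0..r}" "D 0 t \<ge> 0" for t
    using D_mono[OF \<theta> _ _ that(1), of 0] \<theta> \<Theta> \<theta>pos that(2) by simp
  show False
  proof (rule no_one_sided_contact[OF \<sigma> \<Omega> reg \<rho> s])
    show "(E \<theta> has_real_derivative c\<^sub>1 - s * \<theta> * \<kappa> * 2 * t) (at t)" for t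
      unfolding E_def \<eta>_def B(1) by (auto intro!: derivative_eq_intros simp: algebra_simps)
    show "((\<lambda>t. c\<^sub>1 - s * \<theta> * \<kappa> * 2 * t) has_real_derivative - (s * \<theta> * \<kappa> * 2)) (at t)" for t
      by (auto intro!: derivative_eq_intros)
    have "s * - (s * \<theta> * \<kappa> * 2) = - ((s * s) * \<theta> * \<kappa> * 2)" by simp
    then show "s * - (s * \<theta> * \<kappa> * 2) < 0" using \<theta>pos \<kappa> by (simp add: ss)
    show "G \<theta> t \<in> cball p\<^sub>0 (\<rho> / 2)" if "t \<in> {0..r}" for t
      by (rule lifted_curveD(2)[OF G[OF \<theta>] that])
    show "(G \<theta> has_vector_derivative field \<sigma> (pt (G \<theta> t) (E \<theta> t))) (at t within {0..r})" if "t \<in> {0..r}" for t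
      by (rule lifted_curveD(4)[OF G[OF \<theta>] that])
    show "0 \<le> s * (E \<theta> t - u (G \<theta> t))" if "t \<in> {0..r}" for t
      using D_nonneg[OF that] by (simp add: D_def)
    show "0 < s * (E \<theta> 0 - u (G \<theta> 0))" "0 < s * (E \<theta> r - u (G \<theta> r))"
      using end0[of 0] end0[of r] D0[of 0] D0[of r] ends r(1) by (auto simp: D_def)
    show "t\<^sub>0 \<in> {0..r}" "E \<theta> t\<^sub>0 = u (G \<theta> t\<^sub>0)"
      using t0 Dt0 s by (auto simp: D_def)
  qed
qed

text \<open>Shooting in the slope \<open>c\<close>. Lifted curves have speed at most
  \<open>M\<close>, so \<open>u\<close> changes by at most \<open>l * M * r\<close> along them, and
  the slopes \<open>- (l * M)\<close> and \<open>l * M\<close> give end defects of opposite sign.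
  The end defect is Lipschitz in \<open>c\<close>, so it has a zero. There
  \<open>defect_nonneg\<close> applies with both signs and forces \<open>B\<close> to equal
  \<open>u\<close> along the whole curve.\<close>

lemma affine_characteristic:
  assumes x: "x \<in> cball p\<^sub>0 (\<rho> / 4)"
  obtains \<Gamma> c where "\<Gamma> 0 = x" "\<And>t. t \<in> {0..r} \<Longrightarrow> \<Gamma> t \<in> \<Omega>"
    "\<And>t. t \<in> {0..r} \<Longrightarrow> (\<Gamma> has_vector_derivative X1 \<sigma> u (\<Gamma> t)) (at t within {0..r})"
    "\<And>t. t \<in> {0..r} \<Longrightarrow> u (\<Gamma> t) = u x + c * t"
proof -
  define B where "B c t = u x + c * t" for c t
  have x\<Omega>: "x \<in> \<Omega>" using x \<rho> by (auto simp: subset_iff)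
  have lM: "l * M \<ge> 0" using l_pos M by simp
  have B_bound: "\<bar>B c t\<bar> \<le> 2 * l" if "\<bar>c\<bar> \<le> l * M" "t \<in> {0..r}" for c t
  proof -
    have "\<bar>c * t\<bar> \<le> l * M * r" unfolding abs_mult using that lM by (intro mult_mono) auto
    also have "\<dots> \<le> l" using mult_left_mono[OF r(2) less_imp_le[OF l_pos]] l_pos by (simp add: mult.assoc)
    finally show ?thesis using u_bound[OF x\<Omega>] unfolding B_def by linarith
  qed
  have B_bound': "\<bar>B c t\<bar> \<le> R" if "\<bar>c\<bar> \<le> l * M" "t \<in> {0..r}" for c t
    using B_bound[OF that] R l_pos by linarith
  have "continuous_on A (B c)" for A c
    unfolding B_def by (intro continuous_intros)
  from lifted_curve_exists[OF this B_bound' x]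
  have "\<forall>c. \<exists>\<Gamma>. \<bar>c\<bar> \<le> l * M \<longrightarrow> lifted_curve (B c) x \<Gamma>" by metis
  then obtain G where G: "\<And>c. \<bar>c\<bar> \<le> l * M \<Longrightarrow> lifted_curve (B c) x (G c)" by metis
  define g where "g c = B c r - u (G c r)" for c
  have rr: "r \<in> {0..r}" "0 \<in> {0..r}" using r(1) by auto
  have "\<bar>g c - g c'\<bar> \<le> 2 * r * \<bar>c - c'\<bar>" if "\<bar>c\<bar> \<le> l * M" "\<bar>c'\<bar> \<le> l * M" for c c'
  proof -
    have "\<bar>B c t - B c' t\<bar> \<le> \<bar>c - c'\<bar> * r" if "t \<in> {0..r}" for t
    proof -
      have "\<bar>B c t - B c' t\<bar> = \<bar>c - c'\<bar> * t" using that by (simp add: B_def abs_mult flip: left_diff_distrib)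
      then show ?thesis using that by (simp add: mult_left_mono)
    qed
    from lifted_curve_dependence(2)[OF G[OF that(1)] G[OF that(2)] B_bound'[OF that(1)] B_bound'[OF that(2)] this rr(1)]
      this[OF rr(1)]
    show ?thesis unfolding g_def by (simp add: algebra_simps) argo
  qed
  then have "(2 * r)-lipschitz_on {- (l * M)..l * M} g"
    using r(1) by (intro lipschitz_onI) (auto simp: dist_real_def)
  then have g_cont: "continuous_on {- (l * M)..l * M} g" by (rule lipschitz_on_continuous_on)
  have incr: "\<bar>u (G c r) - u x\<bar> \<le> l * M * r" if "\<bar>c\<bar> \<le> l * M" for c
  proof -
    have "norm (G c r - G c 0) \<le> M * \<bar>r - 0\<bar>"
      by (rule vector_derivative_bound[OF lifted_curveD(4)[OF G[OF that]]
            M_bound[OF lifted_in_slab[OF G[OF that] _ B_bound'[OF that]]] rr(2,1)])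
    then have "dist (G c r) x \<le> M * r" using lifted_curveD(1)[OF G[OF that]] r(1) by (simp add: dist_norm)
    then have "l * dist (G c r) x \<le> l * M * r" using l_pos by (simp add: mult.assoc mult_left_mono)
    then show ?thesis using u_lip[OF lifted_curveD(3)[OF G[OF that] rr(1)] x\<Omega>] by linarith
  qed
  have "g (- (l * M)) \<le> 0" "0 \<le> g (l * M)"
    using incr[of "- (l * M)"] incr[of "l * M"] lM by (simp_all add: g_def B_def abs_le_iff)
  moreover have "- (l * M) \<le> l * M" using lM by simp
  ultimately obtain c where "- (l * M) \<le> c" "c \<le> l * M" "g c = 0"
    using IVT'[of g "- (l * M)" 0 "l * M"] g_cont by blast
  then have c: "\<bar>c\<bar> \<le> l * M" "g c = 0" by auto
  note L = G[OF c(1)]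
  have ends: "B c 0 = u (G c 0)" "B c r = u (G c r)"
    using c(2) lifted_curveD(1)[OF L] by (simp_all add: g_def B_def)
  have eq: "B c t = u (G c t)" if "t \<in> {0..r}" for t
    using defect_nonneg[of 1 "B c" "u x" c x "G c" t] defect_nonneg[of "-1" "B c" "u x" c x "G c" t]
      B_bound[OF c(1)] x L ends that by (simp add: B_def)
  show ?thesis
  proof (rule that[of "G c" c])
    show "(G c has_vector_derivative X1 \<sigma> u (G c t)) (at t within {0..r})" if "t \<in> {0..r}" for t
      using lifted_curveD(4)[OF L that] by (simp add: X1_eq eq[OF that])
    show "u (G c t) = u x + c * t" if "t \<in> {0..r}" for t
      using eq[OF that] by (simp add: B_def)
  qed (use lifted_curveD[OF L] in auto)
qed

end

text \<open>The time \<open>r\<close> is common to all starting points near \<open>p\<close>. This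
  matters because characteristics run forwards only, so the one that crosses a given point in its
  interior has to start at a neighbouring point.\<close>

lemma local_affine_characteristics:
  assumes \<sigma>: "\<And>j. smooth_on UNIV (\<sigma> j)" and \<Omega>: "open \<Omega>"
    and u: "vanishing_viscosity_solution \<sigma> \<Omega> u" and p: "p \<in> \<Omega>"
  shows "\<exists>d>0. \<exists>r>0. \<forall>x\<in>cball p d. \<exists>\<Gamma> c. \<Gamma> 0 = x \<and> (\<forall>t\<in>{0..r}. \<Gamma> t \<in> \<Omega> \<and>
    (\<Gamma> has_vector_derivative X1 \<sigma> u (\<Gamma> t)) (at t within {0..r}) \<and> u (\<Gamma> t) = u x + c * t)"
proof -
  obtain l \<epsilon> v where reg: "regular_approximation \<sigma> \<Omega> u l \<epsilon> v"
    by (rule vanishing_viscosity_solution_regular_approximation[OF u \<Omega>])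
  then have l: "l > 0" unfolding regular_approximation_def by blast
  obtain \<rho> where \<rho>: "\<rho> > 0" "cball p \<rho> \<subseteq> \<Omega>"
    using \<Omega> p open_contains_cball by blast
  obtain M where M: "M > 0" "\<forall>w\<in>slab p \<rho> (14 * l + 2). norm (field \<sigma> w) \<le> M"
    "\<forall>w\<in>slab p \<rho> (14 * l + 2). \<forall>w'\<in>slab p \<rho> (14 * l + 2). norm (field \<sigma> w - field \<sigma> w') \<le> M * norm (w - w')"
    using slab_bounds[of \<sigma> p \<rho> "14 * l + 2", OF \<sigma>] by blast
  \<comment> \<open>The three entries are the bounds on \<open>M * r\<close> required by the
    locale.\<close>
  define r where "r = min (1 / 2) (min (\<rho> / 4) (1 / (8 * l))) / M"
  have Mr: "M * r = min (1 / 2) (min (\<rho> / 4) (1 / (8 * l)))" using M(1) by (simp add: r_def)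
  have "r > 0" using M(1) \<rho>(1) l by (simp add: r_def)
  have "l * (M * r) \<le> l * (1 / (8 * l))" using l unfolding Mr by (intro mult_left_mono) auto
  then have Mr': "l * (M * r) \<le> 1 / 8" "M * r \<le> 1 / 2" "M * r \<le> \<rho> / 4"
    using l by (simp_all add: Mr)
  interpret viscosity_patch \<sigma> \<Omega> u l \<epsilon> v p \<rho> "14 * l + 2" M r
  proof unfold_locales
    show "norm (field \<sigma> w) \<le> M" if "w \<in> slab p \<rho> (14 * l + 2)" for w
      using M(2) that by blast
    show "norm (field \<sigma> w - field \<sigma> w') \<le> M * norm (w - w')"
      if "w \<in> slab p \<rho> (14 * l + 2)" "w' \<in> slab p \<rho> (14 * l + 2)" for w w'
      using M(3) that by blast
  qed (rule \<sigma> \<Omega> reg \<rho> M(1) \<open>r > 0\<close> order_refl Mr')+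
  show ?thesis
  proof (rule exI[of _ "\<rho> / 4"], rule conjI)
    show "\<exists>r>0. \<forall>x\<in>cball p (\<rho> / 4). \<exists>\<Gamma> c. \<Gamma> 0 = x \<and> (\<forall>t\<in>{0..r}. \<Gamma> t \<in> \<Omega> \<and>
      (\<Gamma> has_vector_derivative X1 \<sigma> u (\<Gamma> t)) (at t within {0..r}) \<and> u (\<Gamma> t) = u x + c * t)"
    proof (rule exI[of _ r], intro conjI ballI)
      fix x assume x: "x \<in> cball p (\<rho> / 4)"
      obtain \<Gamma> c where "\<Gamma> 0 = x" "\<And>t. t \<in> {0..r} \<Longrightarrow> \<Gamma> t \<in> \<Omega>"
        "\<And>t. t \<in> {0..r} \<Longrightarrow> (\<Gamma> has_vector_derivative X1 \<sigma> u (\<Gamma> t)) (at t within {0..r})"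
        "\<And>t. t \<in> {0..r} \<Longrightarrow> u (\<Gamma> t) = u x + c * t"
        by (rule affine_characteristic[OF x]) blast
      then show "\<exists>\<Gamma> c. \<Gamma> 0 = x \<and> (\<forall>t\<in>{0..r}. \<Gamma> t \<in> \<Omega> \<and>
        (\<Gamma> has_vector_derivative X1 \<sigma> u (\<Gamma> t)) (at t within {0..r}) \<and> u (\<Gamma> t) = u x + c * t)"
        by blast
    qed (fact \<open>r > 0\<close>)
  qed (use \<rho>(1) in simp)
qed


section \<open>Integral curves and their foliation\<close>

locale lipschitz_field =
  fixes V :: "real^2 \<Rightarrow> real^2" and \<Omega> :: "(real^2) set"
  assumes open_\<Omega>: "open \<Omega>"
    and locally_lipschitz: "\<And>p. p \<in> \<Omega> \<Longrightarrow>
      \<exists>\<rho>>0. \<exists>\<Lambda>\<ge>0. cball p \<rho> \<subseteq> \<Omega> \<and> (\<forall>x\<in>cball p \<rho>. \<forall>y\<in>cball p \<rho>. norm (V x - V y) \<le> \<Lambda> * norm (x - y))"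
begin

text \<open>The derivative is taken within \<open>J\<close>, so that closed intervals from
  \<open>Picard_Lindelof\<close> and open intervals of integral curves are treated alike.\<close>

definition solution_on :: "real set \<Rightarrow> (real \<Rightarrow> real^2) \<Rightarrow> bool" where
  "solution_on J \<gamma> \<longleftrightarrow> (\<forall>t\<in>J. \<gamma> t \<in> \<Omega> \<and> (\<gamma> has_vector_derivative V (\<gamma> t)) (at t within J))"

lemma solution_onD:
  assumes "solution_on J \<gamma>"
  shows "t \<in> J \<Longrightarrow> \<gamma> t \<in> \<Omega>" "t \<in> J \<Longrightarrow> (\<gamma> has_vector_derivative V (\<gamma> t)) (at t within J)"
    "continuous_on J \<gamma>"
  using assms unfolding solution_on_def by (auto intro: continuous_on_vector_derivative)

lemma solution_on_subset: "solution_on J \<gamma> \<Longrightarrow> K \<subseteq> J \<Longrightarrow> solution_on K \<gamma>"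
  unfolding solution_on_def by (blast intro: has_vector_derivative_within_subset)

lemma solution_on_shift:
  assumes "solution_on J \<gamma>"
  shows "solution_on {t. t + c \<in> J} (\<lambda>t. \<gamma> (t + c))"
  unfolding solution_on_def
proof (intro ballI conjI)
  fix t assume t: "t \<in> {t. t + c \<in> J}"
  then show "\<gamma> (t + c) \<in> \<Omega>" using solution_onD(1)[OF assms] by simp
  have "((\<lambda>t. t + c) has_vector_derivative 1) (at t within {t. t + c \<in> J})"
    by (auto intro!: derivative_eq_intros)
  moreover have "(\<gamma> has_vector_derivative V (\<gamma> (t + c))) (at (t + c) within (\<lambda>t. t + c) ` {t. t + c \<in> J})"
    using solution_onD(2)[OF assms, of "t + c"] t by (auto intro: has_vector_derivative_within_subset)
  ultimately show "((\<lambda>t. \<gamma> (t + c)) has_vector_derivative V (\<gamma> (t + c))) (at t within {t. t + c \<in> J})"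
    using vector_diff_chain_within[of "\<lambda>t. t + c" 1 t "{t. t + c \<in> J}" \<gamma>] by (simp add: o_def)
qed

lemma integral_curve_iff:
  "integral_curve V \<Omega> J \<gamma> \<longleftrightarrow> open J \<and> is_interval J \<and> J \<noteq> {} \<and> solution_on J \<gamma>"
proof -
  have "open J \<Longrightarrow> t \<in> J \<Longrightarrow> at t within J = at t" for t by (rule at_within_open)
  then show ?thesis unfolding integral_curve_def solution_on_def by auto
qed

text \<open>The set of agreement is closed by continuity. It is open because
  \<open>short_time_stability\<close> with initial difference 0 and no forcing gives agreement near
  each of its points; the interval is connected.\<close>

lemma solution_unique:
  assumes J: "is_interval J" and sol: "solution_on J \<gamma>" "solution_on J \<delta>"
    and s: "s \<in> J" "\<gamma> s = \<delta> s" and t: "t \<in> J"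
  shows "\<gamma> t = \<delta> t"
proof -
  let ?A = "{t \<in> J. \<gamma> t - \<delta> t = 0}"
  have "closedin (top_of_set J) ?A"
    by (intro continuous_closedin_preimage_constant continuous_intros solution_onD(3) sol)
  moreover have "openin (top_of_set J) ?A"
    unfolding openin_euclidean_subtopology_iff
  proof (intro conjI ballI)
    fix t assume "t \<in> ?A"
    then have t: "t \<in> J" "\<gamma> t = \<delta> t" by auto
    obtain \<rho> \<Lambda> where \<rho>: "\<rho> > 0" "\<Lambda> \<ge> 0"
      and lip: "\<forall>x\<in>cball (\<gamma> t) \<rho>. \<forall>y\<in>cball (\<gamma> t) \<rho>. norm (V x - V y) \<le> \<Lambda> * norm (x - y)"
      using locally_lipschitz[OF solution_onD(1)[OF sol(1) t(1)]] by blast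
    obtain d\<^sub>1 where d1: "d\<^sub>1 > 0" "\<forall>s\<in>J. dist s t < d\<^sub>1 \<longrightarrow> dist (\<gamma> s) (\<gamma> t) < \<rho>"
      using solution_onD(3)[OF sol(1)] t(1) \<rho>(1) unfolding continuous_on_iff by blast
    obtain d\<^sub>2 where d2: "d\<^sub>2 > 0" "\<forall>s\<in>J. dist s t < d\<^sub>2 \<longrightarrow> dist (\<delta> s) (\<delta> t) < \<rho>"
      using solution_onD(3)[OF sol(2)] t(1) \<rho>(1) unfolding continuous_on_iff by blast
    define h where "h = min (min d\<^sub>1 d\<^sub>2) (1 / (2 * (\<Lambda> + 1)))"
    have h: "h > 0" "h \<le> d\<^sub>1" "h \<le> d\<^sub>2" using d1(1) d2(1) \<rho>(2) by (auto simp: h_def)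
    have "\<Lambda> * h \<le> \<Lambda> * (1 / (2 * (\<Lambda> + 1)))" using \<rho>(2) by (intro mult_left_mono) (auto simp: h_def)
    also have "\<dots> \<le> 1 / 2" using \<rho>(2) by (simp add: field_simps)
    finally have \<Lambda>h: "\<Lambda> * h \<le> 1 / 2" .
    have "\<gamma> s = \<delta> s" if s: "s \<in> J" "dist s t < h" for s
    proof -
      define a where "a = min s t"
      define b where "b = max s t"
      have ab: "{a..b} \<subseteq> J"
      proof -
        have "{a..b} = closed_segment s t" by (auto simp: a_def b_def closed_segment_eq_real_ivl)
        then show ?thesis using is_interval_convex[OF J] s(1) t(1) by (simp add: closed_segment_subset)
      qed
      have near: "dist x t < h" if "x \<in> {a..b}" for x
        using that s(2) by (auto simp: a_def b_def dist_real_def min_def max_def split: if_splits)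
      note K = solution_on_subset[OF sol(1) ab] solution_on_subset[OF sol(2) ab]
      have "norm (\<gamma> s - \<delta> s) \<le> 2 * (norm (\<gamma> t - \<delta> t) + \<Lambda> * (b - a) * 0)"
      proof (rule short_time_stability[OF has_vector_derivative_diff[OF solution_onD(2)[OF K(1)] solution_onD(2)[OF K(2)]]])
        fix x assume x: "x \<in> {a..b}"
        then have "x \<in> J" "dist x t < d\<^sub>1" "dist x t < d\<^sub>2" using ab near[OF x] h by auto
        then have "\<gamma> x \<in> cball (\<gamma> t) \<rho>" "\<delta> x \<in> cball (\<gamma> t) \<rho>"
          using d1(2) d2(2) t(2) by (auto simp: dist_commute less_imp_le)
        then show "norm (V (\<gamma> x) - V (\<delta> x)) \<le> \<Lambda> * (norm (\<gamma> x - \<delta> x) + 0)"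
          using lip by simp
      next
        have "b - a \<le> h" using near[of s] by (auto simp: a_def b_def dist_real_def min_def max_def split: if_splits)
        then show "\<Lambda> * (b - a) \<le> 1 / 2" using \<Lambda>h mult_left_mono[OF _ \<rho>(2)] order_trans by blast
      qed (auto simp: a_def b_def \<rho>)
      then show ?thesis using t(2) by simp
    qed
    then show "\<exists>e>0. \<forall>x'\<in>J. dist x' t < e \<longrightarrow> x' \<in> ?A" using h(1) by auto
  qed auto
  ultimately have "?A = {} \<or> ?A = J"
    using is_interval_connected[OF J] unfolding connected_clopen by blast
  then show ?thesis using s t by auto
qed

text \<open>Stability gives the Lipschitz constant 2 in the starting point and the speed bound gives
  \<open>M\<close> in time; together these yield joint continuity, as the chart of a flow box
  requires. The radius \<open>e\<close> confines the flow to a ball where the field keeps its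
  direction.\<close>

lemma local_flow:
  assumes p: "p \<in> \<Omega>" and e: "e > 0"
  obtains d r :: real and \<Phi> where "d > 0" "r > 0"
    "\<And>x. x \<in> cball p d \<Longrightarrow> \<Phi> x 0 = x" "\<And>x. x \<in> cball p d \<Longrightarrow> solution_on {- r..r} (\<Phi> x)"
    "\<And>x t. x \<in> cball p d \<Longrightarrow> t \<in> {- r..r} \<Longrightarrow> \<Phi> x t \<in> cball p e"
    "continuous_on (cball p d \<times> {- r..r}) (\<lambda>(x, t). \<Phi> x t)"
proof -
  obtain \<rho>\<^sub>0 \<Lambda> where \<rho>0: "\<rho>\<^sub>0 > 0" "\<Lambda> \<ge> 0" "cball p \<rho>\<^sub>0 \<subseteq> \<Omega>"
    and lip0: "\<forall>x\<in>cball p \<rho>\<^sub>0. \<forall>y\<in>cball p \<rho>\<^sub>0. norm (V x - V y) \<le> \<Lambda> * norm (x - y)"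
    using locally_lipschitz[OF p] by blast
  define \<rho> where "\<rho> = min \<rho>\<^sub>0 e"
  have \<rho>: "\<rho> > 0" "\<rho> \<le> e" "cball p \<rho> \<subseteq> cball p \<rho>\<^sub>0" "cball p \<rho> \<subseteq> \<Omega>"
    using \<rho>0 e by (auto simp: \<rho>_def)
  have lip: "norm (V x - V y) \<le> \<Lambda> * norm (x - y)" if "x \<in> cball p \<rho>" "y \<in> cball p \<rho>" for x y
    using lip0 \<rho>(3) that by blast
  define M where "M = norm (V p) + \<Lambda> * \<rho> + 1"
  have M: "norm (V x) \<le> M" if x: "x \<in> cball p \<rho>" for x
  proof -
    have "norm (V x - V p) \<le> \<Lambda> * norm (x - p)" using x \<rho>(1) by (intro lip) auto
    also have "\<dots> \<le> \<Lambda> * \<rho>" using x \<rho>0(2) by (intro mult_left_mono) (auto simp: dist_norm norm_minus_commute)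
    finally show ?thesis using norm_triangle_sub[of "V x" "V p"] by (simp add: M_def)
  qed
  have M0: "M > 0" using \<rho>(1) \<rho>0(2) by (simp add: M_def add_nonneg_pos)
  define r where "r = min (1 / (4 * (\<Lambda> + 1))) (\<rho> / (4 * M))"
  have r: "r > 0" using \<rho>(1) \<rho>0(2) M0 by (auto simp: r_def)
  have "M * (2 * r) \<le> M * (2 * (\<rho> / (4 * M)))" using M0 by (intro mult_left_mono) (auto simp: r_def)
  then have Mr: "M * (2 * r) \<le> \<rho> / 2" using M0 by simp
  have "\<Lambda> * (2 * r) \<le> \<Lambda> * (2 * (1 / (4 * (\<Lambda> + 1))))" using \<rho>0(2) by (intro mult_left_mono) (auto simp: r_def)
  also have "\<dots> \<le> 1 / 2" using \<rho>0(2) by (simp add: field_simps)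
  finally have \<Lambda>r: "\<Lambda> * (2 * r) \<le> 1 / 2" .
  have r2: "r - - r = 2 * r" by simp
  have V_cont: "continuous_on (cball p \<rho>) V"
    by (rule lipschitz_on_continuous_on[of \<Lambda>], rule lipschitz_onI) (use lip \<rho>0(2) in \<open>auto simp: dist_norm\<close>)
  have "\<forall>x. \<exists>g. x \<in> cball p (\<rho> / 2) \<longrightarrow> g 0 = x \<and> (\<forall>t\<in>{- r..r}. g t \<in> cball p \<rho> \<and>
      (g has_vector_derivative V (g t)) (at t within {- r..r}))"
  proof (intro allI)
    fix x
    show "\<exists>g. x \<in> cball p (\<rho> / 2) \<longrightarrow> g 0 = x \<and> (\<forall>t\<in>{- r..r}. g t \<in> cball p \<rho> \<and>
      (g has_vector_derivative V (g t)) (at t within {- r..r}))"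
    proof (cases "x \<in> cball p (\<rho> / 2)")
      case True
      have "continuous_on ({- r..r} \<times> cball p \<rho>) (\<lambda>(t, x). V x)"
        unfolding split_beta by (rule continuous_on_compose2[OF V_cont continuous_on_snd]) auto
      moreover have "0 \<in> {- r..r}" using r by simp
      moreover have "\<Lambda> * (r - - r) \<le> 1 / 2" "dist p x + M * (r - - r) \<le> \<rho>"
        using \<Lambda>r Mr True unfolding r2 by auto
      ultimately obtain g where "g 0 = x" "\<And>t. t \<in> {- r..r} \<Longrightarrow> g t \<in> cball p \<rho>"
          "\<And>t. t \<in> {- r..r} \<Longrightarrow> (g has_vector_derivative V (g t)) (at t within {- r..r})"
        using Picard_Lindelof[of 0 "- r" r p \<rho> "\<lambda>t. V" M \<Lambda> x] M lip \<rho>0(2) \<rho>(1) by (metis less_imp_le)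
      then show ?thesis by blast
    qed auto
  qed
  then obtain \<Phi> where \<Phi>: "\<And>x. x \<in> cball p (\<rho> / 2) \<Longrightarrow> \<Phi> x 0 = x"
    "\<And>x t. x \<in> cball p (\<rho> / 2) \<Longrightarrow> t \<in> {- r..r} \<Longrightarrow> \<Phi> x t \<in> cball p \<rho>"
    "\<And>x t. x \<in> cball p (\<rho> / 2) \<Longrightarrow> t \<in> {- r..r} \<Longrightarrow>
      (\<Phi> x has_vector_derivative V (\<Phi> x t)) (at t within {- r..r})"
    by metis
  have r0: "0 \<in> {- r..r}" using r by simp
  have dep: "norm (\<Phi> x t - \<Phi> y t) \<le> 2 * norm (x - y)"
    if x: "x \<in> cball p (\<rho> / 2)" and y: "y \<in> cball p (\<rho> / 2)" and t: "t \<in> {- r..r}" for x y t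
  proof -
    have "norm (\<Phi> x t - \<Phi> y t) \<le> 2 * (norm (\<Phi> x 0 - \<Phi> y 0) + \<Lambda> * (r - - r) * 0)"
      by (rule short_time_stability[OF has_vector_derivative_diff[OF \<Phi>(3)[OF x] \<Phi>(3)[OF y]] _ \<rho>0(2) _ _ r0 t])
        (use lip \<Phi>(2)[OF x] \<Phi>(2)[OF y] \<Lambda>r r2 in auto)
    then show ?thesis by (simp add: \<Phi>(1) x y del: mem_cball)
  qed
  have speed: "norm (\<Phi> x t - \<Phi> x s) \<le> M * \<bar>t - s\<bar>"
    if x: "x \<in> cball p (\<rho> / 2)" and t: "s \<in> {- r..r}" "t \<in> {- r..r}" for x s t
    by (rule vector_derivative_bound[OF \<Phi>(3)[OF x] M[OF \<Phi>(2)[OF x]] t])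
  show ?thesis
  proof (rule that[of "\<rho> / 2" r \<Phi>])
    show "solution_on {- r..r} (\<Phi> x)" if "x \<in> cball p (\<rho> / 2)" for x
      unfolding solution_on_def using \<Phi>(2,3)[OF that] \<rho>(4) by blast
    show "\<Phi> x t \<in> cball p e" if "x \<in> cball p (\<rho> / 2)" "t \<in> {- r..r}" for x t
      using \<Phi>(2)[OF that] \<rho>(2) by simp
    show "continuous_on (cball p (\<rho> / 2) \<times> {- r..r}) (\<lambda>(x, t). \<Phi> x t)"
    proof (rule lipschitz_on_continuous_on[of "2 + M"], rule lipschitz_onI)
      fix z z' assume z: "z \<in> cball p (\<rho> / 2) \<times> {- r..r}" "z' \<in> cball p (\<rho> / 2) \<times> {- r..r}"
      have m: "fst z \<in> cball p (\<rho> / 2)" "snd z \<in> {- r..r}" "fst z' \<in> cball p (\<rho> / 2)" "snd z' \<in> {- r..r}"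
        using z by (auto simp: mem_Times_iff)
      have "dist (\<Phi> (fst z) (snd z)) (\<Phi> (fst z') (snd z'))
        \<le> norm (\<Phi> (fst z) (snd z) - \<Phi> (fst z') (snd z)) + norm (\<Phi> (fst z') (snd z) - \<Phi> (fst z') (snd z'))"
        by (metis dist_norm dist_triangle)
      also have "\<dots> \<le> 2 * dist (fst z) (fst z') + M * dist (snd z) (snd z')"
        using dep[OF m(1,3,2)] speed[OF m(3,4,2)] by (simp add: dist_norm)
      also have "\<dots> \<le> 2 * dist z z' + M * dist z z'"
        using M0 dist_fst_le[of z z'] dist_snd_le[of z z'] by (intro add_mono mult_left_mono) auto
      finally show "dist (case z of (x, t) \<Rightarrow> \<Phi> x t) (case z' of (x, t) \<Rightarrow> \<Phi> x t) \<le> (2 + M) * dist z z'"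
        by (simp add: split_beta algebra_simps)
    qed (use M0 in simp)
  qed (use \<rho>(1) r \<Phi>(1) in auto)
qed

text \<open>Two curves with value \<open>p\<close> at time 0 agree on the intersection of their
  domains, again an interval. Hence all of them glue to one curve on the union, the choice in
  \<gamma> being independent of the representative; \<open>local_flow\<close> shows that there is at
  least one.\<close>

lemma maximal_integral_curve_through:
  assumes p: "p \<in> \<Omega>"
  shows "\<exists>I \<gamma>. maximal_integral_curve V \<Omega> I \<gamma> \<and> 0 \<in> I \<and> \<gamma> 0 = p \<and>
    (\<forall>J \<delta>. integral_curve V \<Omega> J \<delta> \<and> 0 \<in> J \<and> \<delta> 0 = p \<longrightarrow> J \<subseteq> I \<and> (\<forall>t\<in>J. \<delta> t = \<gamma> t))"
proof -
  define C where "C = {(J, \<delta>). integral_curve V \<Omega> J \<delta> \<and> 0 \<in> J \<and> \<delta> 0 = p}"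
  define I where "I = \<Union> (fst ` C)"
  define \<gamma> where "\<gamma> t = (SOME y. \<exists>J \<delta>. (J, \<delta>) \<in> C \<and> t \<in> J \<and> y = \<delta> t)" for t
  have agree: "\<delta> t = \<delta>' t" if "(J, \<delta>) \<in> C" "(J', \<delta>') \<in> C" "t \<in> J" "t \<in> J'" for J J' \<delta> \<delta>' t
    using that solution_on_subset[of J \<delta> "J \<inter> J'"] solution_on_subset[of J' \<delta>' "J \<inter> J'"]
    by (intro solution_unique[of "J \<inter> J'" \<delta> \<delta>' 0 t]) (auto simp: C_def integral_curve_iff is_interval_Int)
  have \<gamma>: "\<delta> t = \<gamma> t" if "(J, \<delta>) \<in> C" "t \<in> J" for J \<delta> t
  proof -
    have "\<exists>J \<delta>. (J, \<delta>) \<in> C \<and> t \<in> J \<and> \<gamma> t = \<delta> t"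
      unfolding \<gamma>_def by (rule someI_ex) (use that in blast)
    then obtain J' \<delta>' where J': "(J', \<delta>') \<in> C" "t \<in> J'" "\<gamma> t = \<delta>' t" by blast
    show ?thesis unfolding J'(3) by (rule agree[OF that(1) J'(1) that(2) J'(2)])
  qed
  obtain d r \<Phi> where d: "d > 0" and r: "r > 0" and \<Phi>: "\<And>x. x \<in> cball p d \<Longrightarrow> \<Phi> x 0 = x"
    "\<And>x. x \<in> cball p d \<Longrightarrow> solution_on {- r..r} (\<Phi> x)"
    by (rule local_flow[OF p zero_less_one]) blast
  have pd: "p \<in> cball p d" using d by simp
  have "solution_on {- r<..<r} (\<Phi> p)"
    by (rule solution_on_subset[OF \<Phi>(2)[OF pd] greaterThanLessThan_subseteq_atLeastAtMost_iff[THEN iffD2]]) simp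
  then have in_C: "({- r<..<r}, \<Phi> p) \<in> C"
    using r \<Phi>(1)[OF pd] by (simp add: C_def integral_curve_iff is_interval_oo)
  have I0: "0 \<in> I" "\<gamma> 0 = p"
    using in_C r \<gamma>[OF in_C, of 0] \<Phi>(1)[OF pd] by (force simp: I_def)+
  have J_sub: "J \<subseteq> I" if "(J, \<delta>) \<in> C" for J \<delta>
    using that by (force simp: I_def)
  have curve: "integral_curve V \<Omega> I \<gamma>"
    unfolding integral_curve_def
  proof (intro conjI ballI)
    show "open I" unfolding I_def by (intro open_Union) (auto simp: C_def integral_curve_def)
    show "I \<noteq> {}" using I0 by auto
    have "connected I" unfolding I_def
    proof (rule connected_Union)
      show "\<And>S. S \<in> fst ` C \<Longrightarrow> connected S"
        by (auto simp: C_def integral_curve_def is_interval_connected)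
      show "\<Inter> (fst ` C) \<noteq> {}" by (auto simp: C_def)
    qed
    then show "is_interval I" by (simp add: is_interval_connected_1)
    fix t assume "t \<in> I"
    then obtain J \<delta> where J: "(J, \<delta>) \<in> C" "t \<in> J" by (auto simp: I_def)
    then have d: "\<delta> t \<in> \<Omega>" "(\<delta> has_vector_derivative V (\<delta> t)) (at t)" "open J"
      by (auto simp: C_def integral_curve_def)
    show "\<gamma> t \<in> \<Omega>" using \<gamma>[OF J] d(1) by simp
    show "(\<gamma> has_vector_derivative V (\<gamma> t)) (at t)"
      using has_vector_derivative_transform_within_open[OF d(2,3) J(2) \<gamma>[OF J(1)]] \<gamma>[OF J] by simp
  qed
  moreover have "J = I" if "integral_curve V \<Omega> J \<delta>" "I \<subseteq> J" "\<forall>t\<in>I. \<delta> t = \<gamma> t" for J \<delta>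
  proof -
    have "(J, \<delta>) \<in> C" using that I0 by (auto simp: C_def)
    then show ?thesis using J_sub that(2) by blast
  qed
  ultimately have "maximal_integral_curve V \<Omega> I \<gamma>"
    unfolding maximal_integral_curve_def by blast
  moreover have "J \<subseteq> I \<and> (\<forall>t\<in>J. \<delta> t = \<gamma> t)" if "integral_curve V \<Omega> J \<delta>" "0 \<in> J" "\<delta> 0 = p" for J \<delta>
    using that J_sub[of J \<delta>] \<gamma>[of J \<delta>] by (auto simp: C_def)
  ultimately show ?thesis using I0 by blast
qed

lemma integral_curve_shift:
  assumes "integral_curve V \<Omega> J \<gamma>"
  shows "integral_curve V \<Omega> {t. t + c \<in> J} (\<lambda>t. \<gamma> (t + c))"
proof -
  have J: "open J" "is_interval J" "J \<noteq> {}" "solution_on J \<gamma>"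
    using assms by (auto simp: integral_curve_iff)
  have "open ((\<lambda>t. t + c) -` J)" by (intro open_vimage J continuous_intros)
  moreover have "is_interval {t. t + c \<in> J}"
    unfolding is_interval_1
  proof (intro ballI allI impI)
    fix x y z assume "x \<in> {t. t + c \<in> J}" "y \<in> {t. t + c \<in> J}" "x \<le> z \<and> z \<le> y"
    then show "z \<in> {t. t + c \<in> J}"
      using J(2)[unfolded is_interval_1, rule_format, of "x + c" "y + c" "z + c"] by simp
  qed
  moreover obtain s where "s \<in> J" using J(3) by blast
  then have "s - c \<in> {t. t + c \<in> J}" by simp
  then have "{t. t + c \<in> J} \<noteq> {}" by blast
  ultimately show ?thesis
    using solution_on_shift[OF J(4), of c] unfolding integral_curve_iff vimage_def by blast
qed

text \<open>Both curves are shifted so that the common point is reached at time 0 and compared with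
  the largest curve \<gamma>' there. Maximality of \<gamma> makes it a time translate of \<gamma>',
  which extends the shifted \<delta>.\<close>

lemma maximal_integral_curve_absorbs:
  assumes max: "maximal_integral_curve V \<Omega> I \<gamma>" and s: "s \<in> I"
    and \<delta>: "integral_curve V \<Omega> J \<delta>" "t \<in> J" "\<delta> t = \<gamma> s"
  shows "\<delta> ` J \<subseteq> \<gamma> ` I"
proof -
  have I: "integral_curve V \<Omega> I \<gamma>"
    and max': "\<And>J \<delta>. integral_curve V \<Omega> J \<delta> \<Longrightarrow> I \<subseteq> J \<Longrightarrow> \<forall>t\<in>I. \<delta> t = \<gamma> t \<Longrightarrow> J = I"
    using max unfolding maximal_integral_curve_def by blast+
  have "\<gamma> s \<in> \<Omega>" using I s by (auto simp: integral_curve_def)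
  then obtain I' \<gamma>' where I': "integral_curve V \<Omega> I' \<gamma>'" "0 \<in> I'" "\<gamma>' 0 = \<gamma> s"
    and univ: "\<And>J \<delta>. integral_curve V \<Omega> J \<delta> \<Longrightarrow> 0 \<in> J \<Longrightarrow> \<delta> 0 = \<gamma> s \<Longrightarrow> J \<subseteq> I' \<and> (\<forall>t\<in>J. \<delta> t = \<gamma>' t)"
    using maximal_integral_curve_through unfolding maximal_integral_curve_def by metis
  have 1: "{t. t + s \<in> I} \<subseteq> I'" "\<forall>t\<in>{t. t + s \<in> I}. \<gamma> (t + s) = \<gamma>' t"
    using univ[OF integral_curve_shift[OF I, of s]] s by auto
  have "{t. t + - s \<in> I'} = I"
  proof (rule max'[OF integral_curve_shift[OF I'(1)]])
    show "I \<subseteq> {t. t + - s \<in> I'}"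
    proof
      fix x assume "x \<in> I"
      then have "x - s \<in> {t. t + s \<in> I}" by simp
      then show "x \<in> {t. t + - s \<in> I'}" using 1(1) by auto
    qed
    show "\<forall>t\<in>I. \<gamma>' (t + - s) = \<gamma> t"
    proof
      fix x assume "x \<in> I"
      then have "x - s \<in> {t. t + s \<in> I}" by simp
      then show "\<gamma>' (x + - s) = \<gamma> x" using bspec[OF 1(2), of "x - s"] by simp
    qed
  qed
  then have 2: "y + s \<in> I" if "y \<in> I'" for y using that by force
  have 3: "{x. x + t \<in> J} \<subseteq> I'" "\<forall>x\<in>{x. x + t \<in> J}. \<delta> (x + t) = \<gamma>' x"
    using univ[OF integral_curve_shift[OF \<delta>(1), of t]] \<delta> by auto
  show ?thesis
  proof
    fix y assume "y \<in> \<delta> ` J"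
    then obtain x where x: "x \<in> J" "y = \<delta> x" by blast
    then have m: "x - t \<in> {x. x + t \<in> J}" by simp
    then have "x - t \<in> I'" using 3(1) by blast
    then have m': "x - t + s \<in> I" by (rule 2)
    have "y = \<gamma>' (x - t)" using bspec[OF 3(2) m] x(2) by simp
    also have "\<dots> = \<gamma> (x - t + s)" using 1(2) m' by force
    finally show "y \<in> \<gamma> ` I" using m' by blast
  qed
qed

end


section \<open>Leaves, flow boxes and the foliation property\<close>

context lipschitz_field
begin

definition leaves :: "(real^2) set set" where
  "leaves = {\<gamma> ` I | I \<gamma>. maximal_integral_curve V \<Omega> I \<gamma>}"

text \<open>Used twice: leaves that meet coincide, and a plaque of a flow box that meets a leaf lies
  in it.\<close>

lemma leaf_absorbs:
  assumes L: "L \<in> leaves" and \<delta>: "integral_curve V \<Omega> J \<delta>" and meet: "\<delta> ` J \<inter> L \<noteq> {}"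
  shows "\<delta> ` J \<subseteq> L"
proof -
  obtain I \<gamma> where I: "L = \<gamma> ` I" "maximal_integral_curve V \<Omega> I \<gamma>"
    using L by (auto simp: leaves_def)
  obtain s t where "s \<in> I" "t \<in> J" "\<delta> t = \<gamma> s" using meet I(1) by auto
  then show ?thesis using maximal_integral_curve_absorbs[OF I(2) _ \<delta>] I(1) by blast
qed

lemma leafE:
  assumes "L \<in> leaves"
  obtains I \<gamma> where "L = \<gamma> ` I" "integral_curve V \<Omega> I \<gamma>"
  using assms unfolding leaves_def maximal_integral_curve_def by blast

lemma partition_on_leaves: "partition_on \<Omega> leaves"
proof (rule partition_onI)
  have "L \<subseteq> \<Omega>" if "L \<in> leaves" for L
    using that by (rule leafE) (auto simp: integral_curve_def)
  moreover have "\<exists>L\<in>leaves. p \<in> L" if p: "p \<in> \<Omega>" for p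
  proof -
    obtain I \<gamma> where "maximal_integral_curve V \<Omega> I \<gamma>" "0 \<in> I" "\<gamma> 0 = p"
      using maximal_integral_curve_through[OF p] by blast
    then have "\<gamma> ` I \<in> leaves" "p \<in> \<gamma> ` I" by (auto simp: leaves_def)
    then show ?thesis by blast
  qed
  ultimately show "\<Union> leaves = \<Omega>" by blast
  show "disjnt L L'" if L: "L \<in> leaves" "L' \<in> leaves" "L \<noteq> L'" for L L'
  proof (rule ccontr)
    assume "\<not> disjnt L L'"
    then have meet: "L \<inter> L' \<noteq> {}" "L' \<inter> L \<noteq> {}" by (auto simp: disjnt_def)
    have "L \<subseteq> L'" using L(1) by (rule leafE) (use leaf_absorbs[OF L(2)] meet in blast)
    moreover have "L' \<subseteq> L" using L(2) by (rule leafE) (use leaf_absorbs[OF L(1)] meet in blast)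
    ultimately show False using L(3) by blast
  qed
  show "{} \<notin> leaves"
  proof
    assume "{} \<in> leaves"
    then show False by (rule leafE) (auto simp: integral_curve_def)
  qed
qed

lemma connected_leaf: "L \<in> leaves \<Longrightarrow> connected L"
  by (erule leafE) (auto simp: integral_curve_iff is_interval_connected intro!: connected_continuous_image solution_onD(3))

text \<open>The chart flows a short segment orthogonal to \<open>V p\<close> for a short time. Only
  continuity and injectivity of \<psi> are established; invariance of domain then supplies openness
  of the image and continuity of the inverse. Reparametrising both coordinates by
  \<open>arctan\<close> makes the whole plane the parameter domain. The last conclusion says that an
  integral curve stays in its plaque for a while.\<close>

lemma flow_box:
  assumes p: "p \<in> \<Omega>" and Vp: "V p \<noteq> 0"
  obtains W \<phi> and \<psi> :: "real^2 \<Rightarrow> real^2" where "open W" "p \<in> W" "W \<subseteq> \<Omega>" "homeomorphism W UNIV \<phi> \<psi>"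
    "\<And>c. \<exists>J \<delta>. integral_curve V \<Omega> J \<delta> \<and> {q\<in>W. \<phi> q $ 2 = c} = \<delta> ` J"
    "\<And>I \<gamma> t. integral_curve V \<Omega> I \<gamma> \<Longrightarrow> t \<in> I \<Longrightarrow> \<gamma> t \<in> W \<Longrightarrow>
      eventually (\<lambda>s. s \<in> I \<and> \<gamma> s \<in> W \<and> \<phi> (\<gamma> s) $ 2 = \<phi> (\<gamma> t) $ 2) (nhds t)"
proof -
  define e where "e = V p"
  have ee: "e \<bullet> e > 0" using Vp by (simp add: e_def)
  obtain \<rho> \<Lambda> where \<rho>: "\<rho> > 0" "\<Lambda> \<ge> 0" "cball p \<rho> \<subseteq> \<Omega>"
    and lip: "\<forall>x\<in>cball p \<rho>. \<forall>y\<in>cball p \<rho>. norm (V x - V y) \<le> \<Lambda> * norm (x - y)"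
    using locally_lipschitz[OF p] by blast
  \<comment> \<open>On this ball the field differs from \<open>e\<close> by at most half of
    \<open>norm e\<close>, hence points to the side of \<open>e\<close>.\<close>
  define \<eta> where "\<eta> = min \<rho> (norm e / (2 * (\<Lambda> + 1)))"
  have \<eta>: "\<eta> > 0" "cball p \<eta> \<subseteq> cball p \<rho>" using \<rho> ee by (auto simp: \<eta>_def)
  have forward: "V x \<bullet> e > 0" if x: "x \<in> cball p \<eta>" for x
  proof -
    have "norm (V p - V x) \<le> \<Lambda> * norm (p - x)" using lip x \<eta> \<rho>(1) by (meson centre_in_cball less_imp_le subsetD)
    also have "\<dots> \<le> \<Lambda> * (norm e / (2 * (\<Lambda> + 1)))"
      using x \<rho>(2) by (intro mult_left_mono) (auto simp: \<eta>_def dist_norm)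
    also have "\<dots> \<le> norm e / 2" using \<rho>(2) by (simp add: field_simps)
    finally have n: "norm (e - V x) \<le> norm e / 2" by (simp add: e_def)
    have "(e - V x) \<bullet> e \<le> norm (e - V x) * norm e" by (rule norm_cauchy_schwarz)
    also have "\<dots> \<le> norm e / 2 * norm e" using n by (intro mult_right_mono) auto
    also have "\<dots> = (e \<bullet> e) / 2" by (simp add: power2_norm_eq_inner[symmetric] power2_eq_square)
    finally show ?thesis using ee unfolding inner_diff_left by linarith
  qed
  obtain d r \<Phi> where d: "d > 0" and r: "r > 0" and \<Phi>0: "\<And>x. x \<in> cball p d \<Longrightarrow> \<Phi> x 0 = x"
    and \<Phi>: "\<And>x. x \<in> cball p d \<Longrightarrow> solution_on {- r..r} (\<Phi> x)"
    and \<Phi>_in: "\<And>x t. x \<in> cball p d \<Longrightarrow> t \<in> {- r..r} \<Longrightarrow> \<Phi> x t \<in> cball p \<eta>"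
    and \<Phi>_cont: "continuous_on (cball p d \<times> {- r..r}) (\<lambda>(x, t). \<Phi> x t)"
    by (rule local_flow[OF p \<eta>(1)]) blast
  define e' :: "real^2" where "e' = vector [- e $ 2, e $ 1]"
  have e': "e' \<bullet> e = 0" "norm e' = norm e"
    by (simp_all add: e'_def norm_eq_sqrt_inner inner_vec_def sum_2)
  have e'0: "e' \<noteq> 0" using e'(2) ee by auto
  \<comment> \<open>As \<open>arctan\<close> is bounded by 2 in absolute value,
    \<open>c\<^sub>1\<close> keeps times below \<open>r / 4\<close> and \<open>c\<^sub>2\<close>
    keeps the segment within distance \<open>d\<close> of \<open>p\<close>.\<close>
  define c\<^sub>1 where "c\<^sub>1 = r / 8"
  define c\<^sub>2 where "c\<^sub>2 = d / (2 * norm e)"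
  have c: "c\<^sub>1 > 0" "c\<^sub>2 > 0" using r d ee by (auto simp: c\<^sub>1_def c\<^sub>2_def)
  have arctan: "\<bar>arctan y\<bar> < 2" for y
    using arctan_bounded[of y] pi_less_4 by auto
  define T where "T z = c\<^sub>1 * arctan z" for z
  define S where "S z = p + (c\<^sub>2 * arctan z) *\<^sub>R e'" for z
  have T: "\<bar>T z\<bar> < r / 4" for z
    using arctan[of z] c(1) by (simp add: T_def abs_mult c\<^sub>1_def)
  have S: "S z \<in> cball p d" for z
  proof -
    have "norm ((c\<^sub>2 * arctan z) *\<^sub>R e') = c\<^sub>2 * norm e * \<bar>arctan z\<bar>"
      using c(2) by (simp add: abs_mult e')
    also have "\<dots> = d / 2 * \<bar>arctan z\<bar>" using ee by (simp add: c\<^sub>2_def)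
    also have "\<dots> \<le> d / 2 * 2" using arctan[of z] d by (intro mult_left_mono) auto
    finally show ?thesis by (simp add: S_def dist_norm)
  qed
  have T_in: "T z \<in> {- r..r}" for z using T[of z] r by (auto simp: abs_less_iff)
  define \<psi> :: "real^2 \<Rightarrow> real^2" where "\<psi> q = \<Phi> (S (q $ 2)) (T (q $ 1))" for q
  have \<psi>_cont: "continuous_on UNIV \<psi>"
  proof -
    have "continuous_on UNIV (\<lambda>q::real^2. (S (q $ 2), T (q $ 1)))"
      unfolding S_def T_def by (intro continuous_intros)
    from continuous_on_compose2[OF \<Phi>_cont this] show ?thesis
      using S T_in by (simp add: \<psi>_def[abs_def] image_subset_iff del: mem_cball)
  qed
  \<comment> \<open>If two flow lines from the segment meet, uniqueness puts both starting points on
    one line, at times 0 and \<open>t' - t\<close>. The component along \<open>e\<close> vanishes at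
    both but is strictly increasing in time. The bound \<open>r / 4\<close> keeps the shifted times
    within \<open>{- r..r}\<close>.\<close>
  have arrival: "x = y \<and> t = t'"
    if eq: "\<Phi> x t = \<Phi> y t'" and xy: "x \<in> cball p d" "y \<in> cball p d" "(x - p) \<bullet> e = 0" "(y - p) \<bullet> e = 0"
      and tt: "\<bar>t\<bar> < r / 4" "\<bar>t'\<bar> < r / 4" for x y t t'
  proof -
    have s1: "solution_on {- (r / 2)..r / 2} (\<Phi> x)"
      using r by (intro solution_on_subset[OF \<Phi>[OF xy(1)]]) auto
    have s2: "solution_on {- (r / 2)..r / 2} (\<lambda>s. \<Phi> y (s + (t' - t)))"
      using tt by (intro solution_on_subset[OF solution_on_shift[OF \<Phi>[OF xy(2)]]]) auto
    have "\<Phi> x 0 = \<Phi> y (0 + (t' - t))"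
      by (rule solution_unique[OF is_interval_cc s1 s2, of t]) (use eq tt r in auto)
    then have x: "x = \<Phi> y (t' - t)" using \<Phi>0[OF xy(1)] by simp
    define f where "f s = (\<Phi> y s - p) \<bullet> e" for s
    have f: "(f has_real_derivative V (\<Phi> y s) \<bullet> e) (at s)" if "s \<in> {- r<..<r}" for s
    proof -
      have "(\<Phi> y has_vector_derivative V (\<Phi> y s)) (at s)"
        using solution_onD(2)[OF \<Phi>[OF xy(2)], of s] that at_within_Icc_at[of "- r" s r] by auto
      then have "((\<lambda>s. (\<Phi> y s - p) \<bullet> e) has_derivative (\<lambda>h. (h *\<^sub>R V (\<Phi> y s)) \<bullet> e)) (at s)"
        unfolding has_vector_derivative_def by (auto intro!: derivative_eq_intros)
      then show ?thesis
        unfolding has_field_derivative_def f_def[abs_def] by (rule has_derivative_eq_rhs) (simp add: fun_eq_iff)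
    qed
    have incr: "f a < f b" if "a < b" "a \<in> {- r<..<r}" "b \<in> {- r<..<r}" for a b
    proof (rule DERIV_pos_imp_increasing[OF that(1)])
      fix s assume "a \<le> s" "s \<le> b"
      then have "s \<in> {- r<..<r}" "s \<in> {- r..r}" using that by auto
      then show "\<exists>z. (f has_real_derivative z) (at s) \<and> 0 < z"
        using f forward[OF \<Phi>_in[OF xy(2)]] by blast
    qed
    have ff: "f 0 = 0" "f (t' - t) = 0"
      using xy x \<Phi>0[OF xy(2)] by (simp_all add: f_def)
    have "t' - t = 0"
    proof (rule ccontr)
      assume "t' - t \<noteq> 0"
      then have "t' - t < 0 \<or> 0 < t' - t" by linarith
      moreover have "t' - t \<in> {- r<..<r}" "0 \<in> {- r<..<r}"
        using tt r unfolding greaterThanLessThan_iff abs_less_iff by linarith+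
      ultimately show False using incr[of "t' - t" 0] incr[of 0 "t' - t"] ff by auto
    qed
    then show ?thesis using x \<Phi>0[OF xy(2)] by simp
  qed
  have S_perp: "(S z - p) \<bullet> e = 0" for z by (simp add: S_def e')
  have "inj \<psi>"
  proof (rule injI)
    fix q q' assume "\<psi> q = \<psi> q'"
    then have "S (q $ 2) = S (q' $ 2) \<and> T (q $ 1) = T (q' $ 1)"
      unfolding \<psi>_def by (rule arrival[OF _ S S S_perp S_perp T T])
    then have "q $ 2 = q' $ 2" "q $ 1 = q' $ 1"
      using c e'0 by (auto simp: S_def T_def arctan_eq_iff)
    then show "q = q'" by (simp add: vec_eq_iff forall_2)
  qed
  then obtain \<phi> where "homeomorphism UNIV (range \<psi>) \<psi> \<phi>"
    using invariance_of_domain_homeomorphism[OF open_UNIV \<psi>_cont] by auto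
  then have homeo: "homeomorphism (range \<psi>) UNIV \<phi> \<psi>" by (rule homeomorphism_symD)
  have \<phi>\<psi>: "\<phi> (\<psi> q) = q" for q using homeo by (auto simp: homeomorphism_def)
  show ?thesis
  proof (rule that[OF _ _ _ homeo])
    show "open (range \<psi>)" using invariance_of_domain[OF \<psi>_cont open_UNIV \<open>inj \<psi>\<close>] .
    have "\<psi> 0 = p" using \<Phi>0[of p] d by (simp add: \<psi>_def S_def T_def)
    then show "p \<in> range \<psi>" by (metis rangeI)
    show "range \<psi> \<subseteq> \<Omega>"
      using solution_onD(1)[OF \<Phi>[OF S] T_in] by (auto simp: \<psi>_def)
    show "\<exists>J \<delta>. integral_curve V \<Omega> J \<delta> \<and> {q \<in> range \<psi>. \<phi> q $ 2 = a} = \<delta> ` J" for a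
    proof (intro exI conjI)
      let ?J = "{c\<^sub>1 * - (pi / 2)<..<c\<^sub>1 * (pi / 2)}"
      have range_T: "range T = ?J"
      proof
        have "c\<^sub>1 * - (pi / 2) < T z" "T z < c\<^sub>1 * (pi / 2)" for z
          using arctan_bounded[of z] c(1) unfolding T_def by (intro mult_strict_left_mono; simp)+
        then show "range T \<subseteq> ?J" by auto
        show "?J \<subseteq> range T"
        proof
          fix t assume "t \<in> ?J"
          then have "- (pi / 2) < t / c\<^sub>1" "t / c\<^sub>1 < pi / 2" using c(1) by (auto simp: field_simps)
          then have "T (tan (t / c\<^sub>1)) = t" using c(1) by (simp add: T_def arctan_tan)
          then show "t \<in> range T" by (metis rangeI)
        qed
      qed
      have "?J \<subseteq> {- r..r}" using T_in unfolding range_T[symmetric] by auto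
      then have "solution_on ?J (\<Phi> (S a))" by (rule solution_on_subset[OF \<Phi>[OF S]])
      moreover have "0 \<in> ?J" using c(1) by auto
      ultimately show "integral_curve V \<Omega> ?J (\<Phi> (S a))"
        unfolding integral_curve_iff by (auto simp: is_interval_oo)
      have "{q \<in> range \<psi>. \<phi> q $ 2 = a} = \<psi> ` {y. y $ 2 = a}" by (auto simp: \<phi>\<psi>)
      also have "\<dots> = \<Phi> (S a) ` range T"
      proof
        show "\<psi> ` {y. y $ 2 = a} \<subseteq> \<Phi> (S a) ` range T" by (auto simp: \<psi>_def)
        show "\<Phi> (S a) ` range T \<subseteq> \<psi> ` {y. y $ 2 = a}"
        proof clarify
          fix z
          have "\<Phi> (S a) (T z) = \<psi> (vector [z, a])" by (simp add: \<psi>_def)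
          then show "\<Phi> (S a) (T z) \<in> \<psi> ` {y. y $ 2 = a}" by (metis (mono_tags) image_eqI mem_Collect_eq vector_2(2))
        qed
      qed
      finally show "{q \<in> range \<psi>. \<phi> q $ 2 = a} = \<Phi> (S a) ` ?J" by (simp only: range_T)
    qed
    show "eventually (\<lambda>s. s \<in> I \<and> \<gamma> s \<in> range \<psi> \<and> \<phi> (\<gamma> s) $ 2 = \<phi> (\<gamma> t) $ 2) (nhds t)"
      if \<gamma>: "integral_curve V \<Omega> I \<gamma>" "t \<in> I" "\<gamma> t \<in> range \<psi>" for I \<gamma> t
    proof -
      obtain q where q: "\<gamma> t = \<psi> q" using \<gamma>(3) by blast
      let ?a = "q $ 2"
      have I: "open I" "is_interval I" "solution_on I \<gamma>" using \<gamma>(1) by (auto simp: integral_curve_iff)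
      \<comment> \<open>The shift aligns \<gamma> with the flow line of the plaque so that both are
        at \<open>\<psi> q\<close> at time \<open>t\<close>; \<open>?K\<close> is the interval on
        which both are defined.\<close>
      let ?K = "I \<inter> {s. s + (T (q $ 1) - t) \<in> {- r..r}}"
      have int: "is_interval ?K"
      proof (intro is_interval_Int I)
        have "{s. s + (T (q $ 1) - t) \<in> {- r..r}} = {- r - (T (q $ 1) - t)..r - (T (q $ 1) - t)}" by auto
        then show "is_interval {s. s + (T (q $ 1) - t) \<in> {- r..r}}" by (simp only: is_interval_cc)
      qed
      have agree: "\<gamma> s = \<Phi> (S ?a) (s + (T (q $ 1) - t))" if "s \<in> ?K" for s
      proof (rule solution_unique[OF int _ _ _ _ that])
        show "solution_on ?K \<gamma>" by (rule solution_on_subset[OF I(3)]) blast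
        show "solution_on ?K (\<lambda>s. \<Phi> (S ?a) (s + (T (q $ 1) - t)))"
          by (rule solution_on_subset[OF solution_on_shift[OF \<Phi>[OF S]]]) blast
        show "t \<in> ?K" using \<gamma>(2) T_in[of "q $ 1"] by simp
        show "\<gamma> t = \<Phi> (S ?a) (t + (T (q $ 1) - t))" by (simp add: q \<psi>_def)
      qed
      \<comment> \<open>Times whose shift lies in the range of \<open>T\<close>, so that the point
        on the flow line has chart coordinates, with second coordinate \<open>?a\<close>.\<close>
      let ?U = "I \<inter> (\<lambda>s. (s + (T (q $ 1) - t)) / c\<^sub>1) -` {- (pi / 2)<..<pi / 2}"
      have "open ?U" using c(1) by (intro open_Int I open_vimage continuous_intros) auto
      moreover have "t \<in> ?U" using \<gamma>(2) c(1) arctan_bounded by (auto simp: T_def)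
      moreover have "s \<in> I \<and> \<gamma> s \<in> range \<psi> \<and> \<phi> (\<gamma> s) $ 2 = \<phi> (\<gamma> t) $ 2" if s: "s \<in> ?U" for s
      proof -
        define z where "z = tan ((s + (T (q $ 1) - t)) / c\<^sub>1)"
        have z: "T z = s + (T (q $ 1) - t)" using s c(1) by (simp add: T_def z_def arctan_tan)
        then have "s \<in> ?K" using s T_in[of z] by simp
        then have "\<gamma> s = \<psi> (vector [z, ?a])" using agree z by (simp add: \<psi>_def)
        then show ?thesis using s by (simp add: q \<phi>\<psi>)
      qed
      ultimately show ?thesis unfolding eventually_nhds by blast
    qed
  qed
qed

lemma foliation_leaves:
  assumes nz: "\<And>p. p \<in> \<Omega> \<Longrightarrow> V p \<noteq> 0"
  shows "foliation \<Omega> leaves"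
  unfolding foliation_def
proof (intro conjI ballI partition_on_leaves connected_leaf)
  fix p assume p: "p \<in> \<Omega>"
  obtain W \<phi> and \<psi> :: "real^2 \<Rightarrow> real^2" where W: "open W" "p \<in> W" "W \<subseteq> \<Omega>" "homeomorphism W UNIV \<phi> \<psi>"
    and plaque: "\<And>c. \<exists>J \<delta>. integral_curve V \<Omega> J \<delta> \<and> {q\<in>W. \<phi> q $ 2 = c} = \<delta> ` J"
    and local: "\<And>I \<gamma> t. integral_curve V \<Omega> I \<gamma> \<Longrightarrow> t \<in> I \<Longrightarrow> \<gamma> t \<in> W \<Longrightarrow>
      eventually (\<lambda>s. s \<in> I \<and> \<gamma> s \<in> W \<and> \<phi> (\<gamma> s) $ 2 = \<phi> (\<gamma> t) $ 2) (nhds t)"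
    by (rule flow_box[OF p nz[OF p]]) blast
  have main: "\<exists>c. C = {q \<in> W. \<phi> q $ 2 = c}" if L: "L \<in> leaves" and C: "C \<in> components (L \<inter> W)" for L C
  proof -
    obtain I \<gamma> where I: "L = \<gamma> ` I" "integral_curve V \<Omega> I \<gamma>" using L by (rule leafE)
    define A where "A = {t \<in> I. \<gamma> t \<in> W}"
    define g where "g t = \<phi> (\<gamma> t) $ 2" for t
    \<comment> \<open>The transversal coordinate is locally constant along the leaf, so it takes only countably many
      values there, and hence is constant on the connected set \<open>C\<close>.\<close>
    have "g ` A \<subseteq> g ` (A \<inter> \<rat>)"
    proof
      fix y assume "y \<in> g ` A"
      then obtain t where t: "t \<in> I" "\<gamma> t \<in> W" "y = g t" by (auto simp: A_def)
      obtain U where U: "open U" "t \<in> U" "\<forall>s\<in>U. s \<in> I \<and> \<gamma> s \<in> W \<and> \<phi> (\<gamma> s) $ 2 = \<phi> (\<gamma> t) $ 2"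
        using local[OF I(2) t(1,2)] unfolding eventually_nhds by blast
      obtain \<epsilon> where \<epsilon>: "\<epsilon> > 0" "ball t \<epsilon> \<subseteq> U" using U(1,2) open_contains_ball by blast
      \<comment> \<open>A value taken at \<open>t\<close> is also taken at a rational time nearby,
        by local constancy.\<close>
      obtain s where s: "s \<in> \<rat>" "t < s" "s < t + \<epsilon>" using Rats_dense_in_real[of t "t + \<epsilon>"] \<epsilon>(1) by auto
      then have "s \<in> U" using \<epsilon>(2) by (auto simp: dist_real_def subset_iff)
      then show "y \<in> g ` (A \<inter> \<rat>)" using U(3) s(1) t(3) by (auto simp: A_def g_def intro!: image_eqI[of _ _ s])
    qed
    then have count: "countable (g ` A)"
      by (rule countable_subset) (intro countable_image countable_Int2 countable_rat)
    have CLW: "C \<subseteq> L \<inter> W" and C_conn: "connected C" and C_ne: "C \<noteq> {}"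
      using in_components_subset[OF C] in_components_connected[OF C] in_components_nonempty[OF C] by auto
    have "continuous_on C (\<lambda>q. \<phi> q $ 2)"
    proof -
      have "continuous_on W \<phi>" using W(4) by (simp add: homeomorphism_def)
      then show ?thesis using CLW by (intro continuous_intros) (auto intro: continuous_on_subset)
    qed
    then have conn: "connected ((\<lambda>q. \<phi> q $ 2) ` C)" using C_conn by (rule connected_continuous_image)
    have "(\<lambda>q. \<phi> q $ 2) ` C \<subseteq> g ` A" using CLW I(1) by (auto simp: g_def A_def)
    then have count': "countable ((\<lambda>q. \<phi> q $ 2) ` C)" using count countable_subset by blast
    obtain q\<^sub>0 where q0: "q\<^sub>0 \<in> C" using C_ne by blast
    define c where "c = \<phi> q\<^sub>0 $ 2"
    have "\<phi> q $ 2 = c" if "q \<in> C" for q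
      using connected_uncountable[OF conn, of "\<phi> q $ 2" c] count' that q0 by (auto simp: c_def)
    then have sub: "C \<subseteq> {q \<in> W. \<phi> q $ 2 = c}" using CLW by blast
    obtain J \<delta> where J: "integral_curve V \<Omega> J \<delta>" "{q\<in>W. \<phi> q $ 2 = c} = \<delta> ` J"
      using plaque[of c] by blast
    \<comment> \<open>For the reverse inclusion: the plaque is an integral curve meeting
      \<open>L\<close>, hence contained in \<open>L\<close>, and being connected it lies in the
      component \<open>C\<close>.\<close>
    have "\<delta> ` J \<subseteq> L" using sub q0 CLW J(2) by (intro leaf_absorbs[OF L J(1)]) blast
    then have "{q \<in> W. \<phi> q $ 2 = c} \<subseteq> L \<inter> W" using J(2) by blast
    moreover have "connected {q \<in> W. \<phi> q $ 2 = c}"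
      unfolding J(2) using J(1)
      by (auto simp: integral_curve_iff is_interval_connected intro!: connected_continuous_image solution_onD(3))
    ultimately have "{q \<in> W. \<phi> q $ 2 = c} \<subseteq> C"
      using components_maximal[OF C] sub q0 by blast
    then show ?thesis using sub by blast
  qed
  show "\<exists>W (\<phi> :: real^2 \<Rightarrow> real^2) \<psi>. open W \<and> p \<in> W \<and> W \<subseteq> \<Omega> \<and> homeomorphism W UNIV \<phi> \<psi> \<and>
      (\<forall>L\<in>leaves. \<forall>C\<in>components (L \<inter> W). \<exists>c. C = {q \<in> W. \<phi> q $ 2 = c})"
    by (rule exI[of _ W], rule exI[of _ \<phi>], rule exI[of _ \<psi>]) (intro conjI ballI W main)
qed auto

end


section \<open>Application to the field of a vanishing viscosity solution\<close>

lemma lipschitz_field_X1: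
  assumes \<sigma>: "\<And>j. smooth_on UNIV (\<sigma> j)" and \<Omega>: "open \<Omega>" and u: "vanishing_viscosity_solution \<sigma> \<Omega> u"
  shows "lipschitz_field (X1 \<sigma> u) \<Omega>"
proof
  show "open \<Omega>" by fact
  fix p assume p: "p \<in> \<Omega>"
  obtain l \<epsilon> v where "regular_approximation \<sigma> \<Omega> u l \<epsilon> v"
    by (rule vanishing_viscosity_solution_regular_approximation[OF u \<Omega>])
  then have l: "l > 0" and ub: "\<And>x. x \<in> \<Omega> \<Longrightarrow> \<bar>u x\<bar> \<le> l"
    and ul: "\<And>x y. x \<in> \<Omega> \<Longrightarrow> y \<in> \<Omega> \<Longrightarrow> \<bar>u x - u y\<bar> \<le> l * dist x y"
    unfolding regular_approximation_def by auto
  obtain \<rho> where \<rho>: "\<rho> > 0" "cball p \<rho> \<subseteq> \<Omega>"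
    using \<Omega> p open_contains_cball by blast
  obtain M where M: "M > 0" "\<forall>w\<in>slab p \<rho> l. \<forall>w'\<in>slab p \<rho> l. norm (field \<sigma> w - field \<sigma> w') \<le> M * norm (w - w')"
    using slab_bounds[of \<sigma> p \<rho> l, OF \<sigma>] by blast
  have "norm (X1 \<sigma> u x - X1 \<sigma> u y) \<le> M * (1 + l) * norm (x - y)" if xy: "x \<in> cball p \<rho>" "y \<in> cball p \<rho>" for x y
  proof -
    have x: "x \<in> \<Omega>" "y \<in> \<Omega>" using xy \<rho>(2) by blast+
    have "norm (X1 \<sigma> u x - X1 \<sigma> u y) \<le> M * norm (pt x (u x) - pt y (u y))"
      using M(2) pt_in_slab[OF xy(1) ub[OF x(1)]] pt_in_slab[OF xy(2) ub[OF x(2)]] by (simp add: X1_eq)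
    also have "\<dots> \<le> M * (norm (x - y) + l * norm (x - y))"
      using norm_pt_le[of "x - y" "u x - u y"] ul[OF x] M(1)
      by (intro mult_left_mono) (auto simp: pt_diff dist_norm)
    finally show ?thesis by (simp add: algebra_simps)
  qed
  moreover have "M * (1 + l) \<ge> 0" using M(1) l by simp
  ultimately show "\<exists>\<rho>>0. \<exists>\<Lambda>\<ge>0. cball p \<rho> \<subseteq> \<Omega> \<and>
      (\<forall>x\<in>cball p \<rho>. \<forall>y\<in>cball p \<rho>. norm (X1 \<sigma> u x - X1 \<sigma> u y) \<le> \<Lambda> * norm (x - y))"
    using \<rho> by blast
qed

text \<open>The affine characteristic is started at \<open>\<gamma> (t - h)\<close>, so that
  \<open>t\<close> becomes an interior time; by uniqueness it follows \<gamma> up to time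
  \<open>t + h\<close>.\<close>

lemma integral_curve_locally_affine:
  assumes \<sigma>: "\<And>j. smooth_on UNIV (\<sigma> j)" and \<Omega>: "open \<Omega>" and u: "vanishing_viscosity_solution \<sigma> \<Omega> u"
    and \<gamma>: "integral_curve (X1 \<sigma> u) \<Omega> I \<gamma>" and t: "t \<in> I"
  obtains h a c where "h > 0" "\<And>s. \<bar>s - t\<bar> < h \<Longrightarrow> u (\<gamma> s) = a + c * s"
proof -
  interpret lipschitz_field "X1 \<sigma> u" \<Omega> by (rule lipschitz_field_X1[OF \<sigma> \<Omega> u])
  have I: "open I" "solution_on I \<gamma>" using \<gamma> by (auto simp: integral_curve_iff)
  obtain d r where d: "d > 0" and r: "r > 0"
    and affine: "\<forall>x\<in>cball (\<gamma> t) d. \<exists>\<Gamma> c. \<Gamma> 0 = x \<and> (\<forall>s\<in>{0..r}. \<Gamma> s \<in> \<Omega> \<and>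
      (\<Gamma> has_vector_derivative X1 \<sigma> u (\<Gamma> s)) (at s within {0..r}) \<and> u (\<Gamma> s) = u x + c * s)"
    using local_affine_characteristics[OF \<sigma> \<Omega> u solution_onD(1)[OF I(2) t]] by blast
  obtain e\<^sub>1 where e1: "e\<^sub>1 > 0" "cball t e\<^sub>1 \<subseteq> I" using I(1) t open_contains_cball by blast
  obtain e\<^sub>2 where e2: "e\<^sub>2 > 0" "\<forall>s\<in>I. dist s t < e\<^sub>2 \<longrightarrow> dist (\<gamma> s) (\<gamma> t) < d"
    using solution_onD(3)[OF I(2)] t d unfolding continuous_on_iff by blast
  \<comment> \<open>\<open>2 * h \<le> r\<close> lets the characteristic cover the whole interval
    around \<open>t\<close>, and halving \<open>e\<^sub>2\<close> keeps \<open>t - h\<close>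
    strictly within the continuity radius.\<close>
  define h where "h = min (min e\<^sub>1 (e\<^sub>2 / 2)) (r / 2)"
  have h: "h > 0" "h \<le> e\<^sub>1" "h < e\<^sub>2" "2 * h \<le> r" using e1(1) e2(1) r by (auto simp: h_def)
  have near: "s \<in> I" if "\<bar>s - t\<bar> \<le> h" for s
    using that h(2) e1(2) by (auto simp: dist_real_def subset_iff abs_minus_commute)
  have "dist (\<gamma> (t - h)) (\<gamma> t) < d" using e2(2) near[of "t - h"] h by (simp add: dist_real_def)
  then have "\<gamma> (t - h) \<in> cball (\<gamma> t) d" by (simp add: dist_commute)
  then obtain \<Gamma> c where \<Gamma>: "\<Gamma> 0 = \<gamma> (t - h)" "\<forall>s\<in>{0..r}. \<Gamma> s \<in> \<Omega> \<and>
      (\<Gamma> has_vector_derivative X1 \<sigma> u (\<Gamma> s)) (at s within {0..r}) \<and> u (\<Gamma> s) = u (\<gamma> (t - h)) + c * s"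
    using affine by blast
  have sol1: "solution_on {0..2 * h} \<Gamma>"
    by (rule solution_on_subset[of "{0..r}"]) (use \<Gamma>(2) h in \<open>auto simp: solution_on_def\<close>)
  have sol2: "solution_on {0..2 * h} (\<lambda>s. \<gamma> (s + (t - h)))"
    by (rule solution_on_subset[OF solution_on_shift[OF I(2)]]) (auto intro!: near)
  have "u (\<gamma> s) = u (\<gamma> (t - h)) - c * (t - h) + c * s" if s: "\<bar>s - t\<bar> < h" for s
  proof -
    have m: "s - (t - h) \<in> {0..2 * h}" using s by (auto simp: abs_less_iff)
    have "\<Gamma> (s - (t - h)) = \<gamma> (s - (t - h) + (t - h))"
      by (rule solution_unique[OF is_interval_cc sol1 sol2, of 0]) (use \<Gamma>(1) h(1) m in auto)
    then have "u (\<gamma> s) = u (\<gamma> (t - h)) + c * (s - (t - h))"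
      using bspec[OF \<Gamma>(2), of "s - (t - h)"] m h(4) by simp
    then show ?thesis by (simp add: algebra_simps)
  qed
  then show ?thesis by (rule that[OF h(1)])
qed

theorem corollary1p3:
  fixes \<Omega> :: "(real^2) set"
    and \<sigma> :: "2 \<Rightarrow> real^3 \<Rightarrow> real"
    and u :: "real^2 \<Rightarrow> real"
  assumes "open \<Omega>"
    and "\<And>j. smooth_on UNIV (\<sigma> j)"
    and "\<And>p. \<bar>\<sigma> 1 p * partial_deriv (\<sigma> 2) 3 p - \<sigma> 2 p * partial_deriv (\<sigma> 1) 3 p\<bar> > 0"
    and "vanishing_viscosity_solution \<sigma> \<Omega> u"
  shows "foliation \<Omega> {\<gamma> ` I | I \<gamma>. maximal_integral_curve (X1 \<sigma> u) \<Omega> I \<gamma>}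
    \<and> (\<forall>p\<in>\<Omega>. \<exists>I \<gamma>. maximal_integral_curve (X1 \<sigma> u) \<Omega> I \<gamma> \<and> 0 \<in> I \<and> \<gamma> 0 = p
         \<and> (\<forall>J \<delta>. integral_curve (X1 \<sigma> u) \<Omega> J \<delta> \<and> 0 \<in> J \<and> \<delta> 0 = p
              \<longrightarrow> J \<subseteq> I \<and> (\<forall>t\<in>J. \<delta> t = \<gamma> t)))
    \<and> (\<forall>p\<in>\<Omega>. \<forall>I \<gamma> s. maximal_integral_curve (X1 \<sigma> u) \<Omega> I \<gamma> \<and> s \<in> I \<and> \<gamma> s = p
         \<longrightarrow> (\<lambda>t. u (\<gamma> t)) differentiable (at s)
           \<and> (\<forall>t\<in>I. (\<lambda>t. u (\<gamma> t)) differentiable (at t)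
                  \<and> (deriv (\<lambda>t. u (\<gamma> t)) has_real_derivative 0) (at t)))"
proof -
  interpret lipschitz_field "X1 \<sigma> u" \<Omega> by (rule lipschitz_field_X1[OF assms(2,1,4)])
  \<comment> \<open>This is where the nondegeneracy hypothesis enters: its determinant vanishes
    wherever both components of the field do.\<close>
  have nz: "X1 \<sigma> u p \<noteq> 0" for p
  proof
    assume z: "X1 \<sigma> u p = 0"
    have "\<sigma> j (graph_point u p) = 0" for j
      using arg_cong[OF z, of "\<lambda>x. x $ j"] by (simp add: X1_def)
    then show False using assms(3)[of "graph_point u p"] by simp
  qed
  have diff: "(\<lambda>t. u (\<gamma> t)) differentiable (at t) \<and> (deriv (\<lambda>t. u (\<gamma> t)) has_real_derivative 0) (at t)"
    if \<gamma>: "maximal_integral_curve (X1 \<sigma> u) \<Omega> I \<gamma>" "t \<in> I" for I \<gamma> t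
  proof -
    have "integral_curve (X1 \<sigma> u) \<Omega> I \<gamma>" using \<gamma>(1) by (simp add: maximal_integral_curve_def)
    then obtain h a c where h: "h > 0" "\<And>s. \<bar>s - t\<bar> < h \<Longrightarrow> u (\<gamma> s) = a + c * s"
      by (rule integral_curve_locally_affine[OF assms(2,1,4) _ \<gamma>(2)]) blast
    have D: "((\<lambda>t. u (\<gamma> t)) has_real_derivative c) (at s)" if "s \<in> ball t h" for s
    proof (rule has_field_derivative_transform_within_open[OF _ open_ball that])
      show "((\<lambda>s. a + c * s) has_real_derivative c) (at s)" by (auto intro!: derivative_eq_intros)
      show "a + c * x = u (\<gamma> x)" if "x \<in> ball t h" for x
        using h(2)[of x] that by (simp add: dist_real_def abs_minus_commute)
    qed
    have t: "t \<in> ball t h" using h(1) by simp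
    have "(deriv (\<lambda>t. u (\<gamma> t)) has_real_derivative 0) (at t)"
    proof (rule has_field_derivative_transform_within_open[OF DERIV_const[of c] open_ball t])
      show "c = deriv (\<lambda>t. u (\<gamma> t)) s" if "s \<in> ball t h" for s
        using DERIV_imp_deriv[OF D[OF that]] by simp
    qed
    then show ?thesis using D[OF t] real_differentiable_def by blast
  qed
  show ?thesis
    using diff by (intro conjI ballI maximal_integral_curve_through
      foliation_leaves[OF nz, unfolded leaves_def]) auto
qed

end
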